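(* Given integers $r,n\geq 1$, there exists an integer $\ell=\ell(r,n)\geq 0$, depending only on $r$ and $n$, such that, for any finite set $S$ of $r$ matrices in $\mathrm{GL}_n(\mathbb{C})$ generating a group $G=\langle S\rangle\leq \mathrm{GL}_n(\mathbb{C})$ of infinite order, there is an element of infinite order in $G$ with word length $\leq \ell$ in $S$.
   Context: The word length of an element $g\in G$ in $S$ is the minimum integer $k\geq 0$ such that $g=s_1\cdots s_k$ for some $s_1,\dots,s_k\in S\cup S^{-1}$. *)

theory Defs
  imports
    Complex_Main
    "Jordan_Normal_Form.Matrix"
    "HOL-Algebra.Generated_Groups"
    "HOL-Algebra.Multiplicative_Group"
begin

definition GL :: "nat \<Rightarrow> complex mat monoid" where
  "GL n = units_of (ring_mat TYPE(complex) n ())"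

lemma group_GL: "group (GL n)"
proof -
  interpret ring "ring_mat TYPE(complex) n ()" by (rule ring_mat)
  show ?thesis unfolding GL_def by (rule units_group)
qed

lemma carrier_GL:
  "carrier (GL n) = {A \<in> carrier_mat n n. \<exists>B \<in> carrier_mat n n. B * A = 1\<^sub>m n \<and> A * B = 1\<^sub>m n}"
  by (simp add: GL_def units_of_carrier Units_def ring_mat_simps)

lemma mult_GL: "A \<otimes>\<^bsub>GL n\<^esub> B = A * B"
  by (simp add: GL_def units_of_mult ring_mat_simps)

lemma one_GL: "\<one>\<^bsub>GL n\<^esub> = 1\<^sub>m n"
  by (simp add: GL_def units_of_one ring_mat_simps)

(* Words in the letters S \<union> S^{-1}; the empty word represents the identity. *)
definition word_length :: "('a, 'b) monoid_scheme \<Rightarrow> 'a set \<Rightarrow> 'a \<Rightarrow> nat" where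
  "word_length G S g =
    (LEAST k. \<exists>w. length w = k \<and> set w \<subseteq> S \<union> (\<lambda>s. inv\<^bsub>G\<^esub> s) ` S \<and>
                  g = foldr (\<lambda>x y. x \<otimes>\<^bsub>G\<^esub> y) w \<one>\<^bsub>G\<^esub>)"

(* The minimum in word_length ranges over a nonempty set for every element of the
   generated subgroup (outside of it, word_length carries no information). *)
lemma (in group) generate_iff_word:
  assumes "S \<subseteq> carrier G"
  shows "g \<in> generate G S \<longleftrightarrow>
    (\<exists>w. set w \<subseteq> S \<union> (\<lambda>s. inv s) ` S \<and> g = foldr (\<lambda>x y. x \<otimes> y) w \<one>)"
proof
  have closed: "foldr (\<lambda>x y. x \<otimes> y) w \<one> \<in> carrier G"
    if "set w \<subseteq> S \<union> (\<lambda>s. inv s) ` S" for w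
    using that assms by (induction w) auto
  have app: "foldr (\<lambda>x y. x \<otimes> y) (v @ w) \<one> = foldr (\<lambda>x y. x \<otimes> y) v \<one> \<otimes> foldr (\<lambda>x y. x \<otimes> y) w \<one>"
    if "set v \<subseteq> S \<union> (\<lambda>s. inv s) ` S" "set w \<subseteq> S \<union> (\<lambda>s. inv s) ` S" for v w
    using that(1)
  proof (induction v)
    case Nil
    then show ?case using closed[OF that(2)] by simp
  next
    case (Cons a v)
    then have "a \<in> carrier G" using assms by auto
    then show ?case using Cons closed[OF that(2)] closed[of v] by (simp add: m_assoc)
  qed
  show "\<exists>w. set w \<subseteq> S \<union> (\<lambda>s. inv s) ` S \<and> g = foldr (\<lambda>x y. x \<otimes> y) w \<one>" if "g \<in> generate G S"
    using that
  proof (induction rule: generate.induct)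
    case one
    show ?case by (rule exI[of _ "[]"]) simp
  next
    case (incl h)
    then show ?case using assms by (intro exI[of _ "[h]"]) auto
  next
    case (inv h)
    then show ?case using assms by (intro exI[of _ "[inv h]"]) auto
  next
    case (eng h1 h2)
    then obtain v w where "set v \<subseteq> S \<union> (\<lambda>s. inv s) ` S" "h1 = foldr (\<lambda>x y. x \<otimes> y) v \<one>"
      "set w \<subseteq> S \<union> (\<lambda>s. inv s) ` S" "h2 = foldr (\<lambda>x y. x \<otimes> y) w \<one>" by blast
    then show ?case using app by (intro exI[of _ "v @ w"]) simp
  qed
  show "g \<in> generate G S"
    if "\<exists>w. set w \<subseteq> S \<union> (\<lambda>s. inv s) ` S \<and> g = foldr (\<lambda>x y. x \<otimes> y) w \<one>"
  proof -
    have "foldr (\<lambda>x y. x \<otimes> y) w \<one> \<in> generate G S" if "set w \<subseteq> S \<union> (\<lambda>s. inv s) ` S" for w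
      using that by (induction w) (auto intro: generate.intros)
    with that show ?thesis by blast
  qed
qed

(* The library's group.ord is 0 exactly on the elements of infinite order (group.ord_eq_0). *)
definition infinite_order :: "('a, 'b) monoid_scheme \<Rightarrow> 'a \<Rightarrow> bool" where
  "infinite_order G g \<longleftrightarrow> group.ord G g = 0"

lemma (in group) infinite_order_iff:
  assumes "g \<in> carrier G"
  shows "infinite_order G g \<longleftrightarrow> (\<forall>k::nat. k > 0 \<longrightarrow> g [^] k \<noteq> \<one>)"
  using assms by (simp add: infinite_order_def ord_eq_0)

end

theory Submission
  imports Defs "Jordan_Normal_Form.Spectral_Radius"
begin

text \<open>Suppose that all short words in the generators have finite order. Then their traces are sums of
  \<open>n\<close> roots of unity, hence lie in a cyclotomic field and are bounded by \<open>n\<close> at all conjugates. A maximal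
  nonzero minor \<open>(tr (x\<^sub>i y\<^sub>j))\<close> of the trace form on short words turns them into matrices over this field
  with a controlled common denominator. By the product formula that denominator is not small at half
  of the conjugates, so that these matrices are bounded there.

  If \<open>g\<close> is a short word, then by pigeonhole a power \<open>a = g\<^sup>q\<close> with bounded \<open>q\<close> is close to 1 at a positive
  proportion of the conjugates, and so are the conjugates \<open>h a h\<^sup>-\<^sup>1\<close>. Iterated commutators of elements close to
  1 shrink geometrically, while they stay bounded at all other places; by the product formula a long
  one is trivial. As in the proof of Jordan's theorem this forces \<open>a\<close> to commute with \<open>h a h\<^sup>-\<^sup>1\<close>. Commuting
  conjugates of \<open>a\<close> are simultaneously diagonalizable with eigenvalues among those of \<open>a\<close>, so that there
  are at most \<open>n\<^sup>n\<close> of them, and the centralizer of \<open>a\<close> has bounded index.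

  If \<open>a\<close> is not central, the centralizer commutes with strictly more orthogonal idempotents, and one
  argues by induction. If all such powers are central, the traces of the words \<open>x\<^sub>i g s g\<^sup>-\<^sup>1 y\<^sub>j\<close> take
  boundedly many values, the center has bounded index, and it is a finitely generated commutative
  group generated by elements of finite order. In either case the group is finite.\<close>

section \<open>A ring containing all matrix rings\<close>

text \<open>The orders of the short words are finite but not bounded in advance, so neither the
  degree of the cyclotomic field nor the common exponent \<open>M\<close> of the words may enter a
  bound. Every estimate is therefore made for a proportion of the conjugates: a nonzero algebraic
  integer that is bounded at all conjugates cannot be arbitrarily small at a fixed proportion of
  them. The constant \<open>C\<close> bounding the representations depends on \<open>n\<close>
  alone, hence so does the exponent bound \<open>Q\<close>; both are fixed before any word length.
  This order matters, because the length \<open>L\<close> of the words whose powers are tested for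
  centrality is computed from \<open>Q\<close>, and the length of the words that must be torsion
  from \<open>L\<close>. The representations are not defined on the whole group, whose long words
  may have infinite order: they are multiplicative only on words up to a prescribed length
  \<open>W\<close>, and each step keeps account of the lengths it uses. Jordan's argument ends with
  a central commutator near 1; it has exponent \<open>n!\<close>, again independent of
  \<open>M\<close>, so it can be near 1 only by being 1.\<close>

text \<open>An element is a scalar matrix of infinite size plus a matrix with finitely many nonzero
  entries. This is a single ring with unit into which all \<open>GL n\<close> embed, by extending with the
  identity outside of the upper left block, and on which the trace of the finite part is cyclic
  without side conditions.\<close>

typedef smat = "{(c::complex, A::nat \<Rightarrow> nat \<Rightarrow> complex). \<exists>N. \<forall>i j. (N \<le> i \<or> N \<le> j) \<longrightarrow> A i j = 0}"
  by (rule exI[of _ "(0, \<lambda>_ _. 0)"]) auto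

setup_lifting type_definition_smat

lift_definition scal :: "smat \<Rightarrow> complex" is fst .

lift_definition ent :: "smat \<Rightarrow> nat \<Rightarrow> nat \<Rightarrow> complex" is snd .

definition supp_le :: "nat \<Rightarrow> smat \<Rightarrow> bool" where
  "supp_le N x \<longleftrightarrow> (\<forall>i j. (N \<le> i \<or> N \<le> j) \<longrightarrow> ent x i j = 0)"

lemma supp_le_exists: "\<exists>N. supp_le N x"
proof -
  have "\<exists>N. \<forall>i j. N \<le> i \<or> N \<le> j \<longrightarrow> snd (Rep_smat x) i j = 0"
    using Rep_smat[of x] unfolding mem_Collect_eq case_prod_beta by (rule exE) (rule exI, assumption)
  then show ?thesis by (simp add: supp_le_def ent.rep_eq)
qed

lemma supp_le_mono: "supp_le N x \<Longrightarrow> N \<le> N' \<Longrightarrow> supp_le N' x"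
  by (auto simp: supp_le_def)

lemma supp_le_common:
  obtains N where "supp_le N x" "supp_le N y"
  using that supp_le_exists[of x] supp_le_exists[of y] supp_le_mono[OF _ max.cobounded1]
    supp_le_mono[OF _ max.cobounded2] by blast

lemma supp_le_common3:
  obtains N where "supp_le N x" "supp_le N y" "supp_le N z"
proof -
  obtain N M where "supp_le N x" "supp_le N y" "supp_le M z"
    using supp_le_common supp_le_exists by metis
  then show thesis using that[of "max N M"] supp_le_mono max.cobounded1 max.cobounded2 by blast
qed

lemma smat_eqI:
  assumes "scal x = scal y" "\<And>i j. ent x i j = ent y i j"
  shows "x = y"
  using assms by transfer (auto simp: fun_eq_iff)

definition mk_smat :: "complex \<Rightarrow> (nat \<Rightarrow> nat \<Rightarrow> complex) \<Rightarrow> smat" where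
  "mk_smat c A = Abs_smat (c, A)"

lemma
  assumes "\<And>i j. N \<le> i \<or> N \<le> j \<Longrightarrow> A i j = 0"
  shows scal_mk: "scal (mk_smat c A) = c" and ent_mk: "ent (mk_smat c A) = A"
proof -
  have "(c, A) \<in> {(c, A). \<exists>N. \<forall>i j. N \<le> i \<or> N \<le> j \<longrightarrow> A i j = 0}"
    using assms by blast
  then show "scal (mk_smat c A) = c" "ent (mk_smat c A) = A"
    by (auto simp: mk_smat_def scal.rep_eq ent.rep_eq Abs_smat_inverse)
qed

text \<open>Summing over the support of row \<open>i\<close> of \<open>x\<close> avoids choosing a
  block size in the definition.\<close>

definition emul :: "smat \<Rightarrow> smat \<Rightarrow> nat \<Rightarrow> nat \<Rightarrow> complex" where
  "emul x y i j = (\<Sum>k | ent x i k \<noteq> 0. ent x i k * ent y k j)"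

lemma emul_eq:
  assumes "supp_le N x"
  shows "emul x y i j = (\<Sum>k<N. ent x i k * ent y k j)"
  unfolding emul_def
  by (rule sum.mono_neutral_left) (use assms in \<open>auto simp: supp_le_def not_less[symmetric]\<close>)

lemma emul_eq_0: "supp_le N x \<Longrightarrow> supp_le N y \<Longrightarrow> N \<le> i \<or> N \<le> j \<Longrightarrow> emul x y i j = 0"
  by (auto simp: emul_eq supp_le_def intro!: sum.neutral)

instantiation smat :: ring_1
begin

definition "0 = mk_smat 0 (\<lambda>_ _. 0)"
definition "1 = mk_smat 1 (\<lambda>_ _. 0)"
definition "x + y = mk_smat (scal x + scal y) (\<lambda>i j. ent x i j + ent y i j)"
definition "- x = mk_smat (- scal x) (\<lambda>i j. - ent x i j)" for x :: smat
definition "x - y = mk_smat (scal x - scal y) (\<lambda>i j. ent x i j - ent y i j)"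
definition "x * y = mk_smat (scal x * scal y)
  (\<lambda>i j. scal x * ent y i j + scal y * ent x i j + emul x y i j)"

lemma scal_ent_0: "scal 0 = 0" "ent 0 i j = 0"
  unfolding zero_smat_def by (subst scal_mk[where N=0] ent_mk[where N=0]; simp)+

lemma scal_ent_1: "scal 1 = 1" "ent 1 i j = 0"
  unfolding one_smat_def by (subst scal_mk[where N=0] ent_mk[where N=0]; simp)+

lemma scal_ent_add: "scal (x + y) = scal x + scal y" "ent (x + y) i j = ent x i j + ent y i j"
proof -
  obtain N where "supp_le N x" "supp_le N y" by (rule supp_le_common)
  then have *: "\<And>i j. N \<le> i \<or> N \<le> j \<Longrightarrow> ent x i j + ent y i j = 0" by (auto simp: supp_le_def)
  show "scal (x + y) = scal x + scal y" "ent (x + y) i j = ent x i j + ent y i j"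
    unfolding plus_smat_def by (subst scal_mk[OF *] ent_mk[OF *]; simp)+
qed

lemma scal_ent_minus: "scal (x - y) = scal x - scal y" "ent (x - y) i j = ent x i j - ent y i j"
proof -
  obtain N where "supp_le N x" "supp_le N y" by (rule supp_le_common)
  then have *: "\<And>i j. N \<le> i \<or> N \<le> j \<Longrightarrow> ent x i j - ent y i j = 0" by (auto simp: supp_le_def)
  show "scal (x - y) = scal x - scal y" "ent (x - y) i j = ent x i j - ent y i j"
    unfolding minus_smat_def by (subst scal_mk[OF *] ent_mk[OF *]; simp)+
qed

lemma scal_ent_uminus: "scal (- x) = - scal x" "ent (- x) i j = - ent x i j" for x :: smat
proof -
  obtain N where "supp_le N x" using supp_le_exists by blast
  then have *: "\<And>i j. N \<le> i \<or> N \<le> j \<Longrightarrow> - ent x i j = 0" by (auto simp: supp_le_def)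
  show "scal (- x) = - scal x" "ent (- x) i j = - ent x i j"
    unfolding uminus_smat_def by (subst scal_mk[OF *] ent_mk[OF *]; simp)+
qed

lemma scal_ent_mult: "scal (x * y) = scal x * scal y"
  "ent (x * y) i j = scal x * ent y i j + scal y * ent x i j + emul x y i j"
proof -
  obtain N where "supp_le N x" "supp_le N y" by (rule supp_le_common)
  then have *: "\<And>i j. N \<le> i \<or> N \<le> j \<Longrightarrow> scal x * ent y i j + scal y * ent x i j + emul x y i j = 0"
    by (auto simp: emul_eq_0) (auto simp: supp_le_def)
  show "scal (x * y) = scal x * scal y"
    "ent (x * y) i j = scal x * ent y i j + scal y * ent x i j + emul x y i j"
    unfolding times_smat_def by (subst scal_mk[OF *] ent_mk[OF *]; simp)+
qed

lemmas smat_simps = scal_ent_0 scal_ent_1 scal_ent_add scal_ent_minus scal_ent_uminus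

instance
proof
  fix x y z :: smat
  show "x * y * z = x * (y * z)"
  proof (rule smat_eqI)
    fix i j
    obtain N where N: "supp_le N x" "supp_le N y" "supp_le N z" by (rule supp_le_common3)
    have xy: "supp_le N (x * y)" using N by (auto simp: supp_le_def scal_ent_mult emul_eq_0[OF N(1,2)])
    have "(\<Sum>k<N. (\<Sum>l<N. ent x i l * ent y l k) * ent z k j)
        = (\<Sum>l<N. ent x i l * (\<Sum>k<N. ent y l k * ent z k j))"
      unfolding sum_distrib_left sum_distrib_right by (subst sum.swap) (simp add: mult.assoc)
    then show "ent (x * y * z) i j = ent (x * (y * z)) i j"
      using N xy by (simp add: scal_ent_mult emul_eq[where N=N] algebra_simps sum.distrib sum_distrib_left)
  qed (simp add: scal_ent_mult)
  show "(x + y) * z = x * z + y * z"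
  proof (rule smat_eqI)
    fix i j
    obtain N where N: "supp_le N x" "supp_le N y" "supp_le N z" by (rule supp_le_common3)
    then have xy: "supp_le N (x + y)" by (auto simp: supp_le_def smat_simps)
    show "ent ((x + y) * z) i j = ent (x * z + y * z) i j"
      using N xy by (simp add: scal_ent_mult smat_simps emul_eq[where N=N] algebra_simps sum.distrib)
  qed (simp add: scal_ent_mult smat_simps algebra_simps)
  show "x * (y + z) = x * y + x * z"
  proof (rule smat_eqI)
    fix i j
    obtain N where N: "supp_le N x" using supp_le_exists by blast
    show "ent (x * (y + z)) i j = ent (x * y + x * z) i j"
      using N by (simp add: scal_ent_mult smat_simps emul_eq[where N=N] algebra_simps sum.distrib)
  qed (simp add: scal_ent_mult smat_simps algebra_simps)
  show "1 * x = x" by (rule smat_eqI) (auto simp: scal_ent_mult smat_simps emul_def)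
  show "x * 1 = x" by (rule smat_eqI) (auto simp: scal_ent_mult smat_simps emul_def)
  have "scal (0::smat) \<noteq> scal 1" by (simp add: smat_simps)
  then show "(0::smat) \<noteq> 1" by metis
qed (rule smat_eqI; simp add: smat_simps algebra_simps)+

end

lemma ent_mult:
  "supp_le N x \<Longrightarrow> ent (x * y) i j = scal x * ent y i j + scal y * ent x i j + (\<Sum>k<N. ent x i k * ent y k j)"
  by (simp add: scal_ent_mult emul_eq)

lemma supp_le_simps [simp]:
  "supp_le N 0" "supp_le N 1"
  "supp_le N x \<Longrightarrow> supp_le N y \<Longrightarrow> supp_le N (x + y)"
  "supp_le N x \<Longrightarrow> supp_le N y \<Longrightarrow> supp_le N (x - y)"
  "supp_le N x \<Longrightarrow> supp_le N (- x)"
  "supp_le N x \<Longrightarrow> supp_le N y \<Longrightarrow> supp_le N (x * y)"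
  by (auto simp: supp_le_def smat_simps scal_ent_mult)
    (auto simp: emul_eq_0[of N, unfolded supp_le_def])

lemma supp_le_power [simp]: "supp_le N x \<Longrightarrow> supp_le N (x ^ k)"
  by (induction k) auto

lemma supp_le_sum [simp]: "(\<And>i. i \<in> I \<Longrightarrow> supp_le N (f i)) \<Longrightarrow> supp_le N (\<Sum>i\<in>I. f i)"
  by (induction I rule: infinite_finite_induct) auto

lemma scal_power: "scal (x ^ k) = scal x ^ k"
  by (induction k) (auto simp: smat_simps scal_ent_mult)

lemma scal_sum: "scal (\<Sum>i\<in>I. f i) = (\<Sum>i\<in>I. scal (f i))"
  by (induction I rule: infinite_finite_induct) (auto simp: smat_simps)

definition cscal :: "complex \<Rightarrow> smat" where
  "cscal c = mk_smat c (\<lambda>_ _. 0)"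

lemma scal_cscal [simp]: "scal (cscal c) = c" and ent_cscal [simp]: "ent (cscal c) i j = 0"
  unfolding cscal_def by (subst scal_mk[where N=0] ent_mk[where N=0]; simp)+

lemma supp_le_cscal [simp]: "supp_le N (cscal c)"
  by (simp add: supp_le_def)

lemma scal_cscal_mult [simp]: "scal (cscal c * x) = c * scal x"
  and ent_cscal_mult [simp]: "ent (cscal c * x) i j = c * ent x i j"
  by (simp_all add: scal_ent_mult emul_def)

lemma cscal_simps:
  "cscal 0 = 0" "cscal 1 = 1" "cscal (a + b) = cscal a + cscal b" "cscal (a * b) = cscal a * cscal b"
  "cscal (- a) = - cscal a" "cscal (a - b) = cscal a - cscal b"
  by (rule smat_eqI; simp add: smat_simps)+

lemma cscal_sum: "cscal (\<Sum>i\<in>I. f i) = (\<Sum>i\<in>I. cscal (f i))"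
  by (induction I rule: infinite_finite_induct) (auto simp: cscal_simps)

lemma cscal_commute: "x * cscal c = cscal c * x"
proof (rule smat_eqI)
  obtain N where "supp_le N x" using supp_le_exists by blast
  then show "ent (x * cscal c) i j = ent (cscal c * x) i j" for i j
    by (simp add: ent_mult)
qed (simp add: scal_ent_mult)

lemma cscal_left_commute: "x * (cscal c * y) = cscal c * (x * y)"
  by (metis cscal_commute mult.assoc)

section \<open>The trace\<close>

text \<open>\<open>n\<close> fixes the size of the block on which the scalar part is counted, as an
  infinite scalar matrix has no trace. For \<open>supp_le n x\<close> this is the trace of the
  \<open>n\<close> by \<open>n\<close> block.\<close>

definition tr :: "nat \<Rightarrow> smat \<Rightarrow> complex" where
  "tr n x = of_nat n * scal x + (\<Sum>i | ent x i i \<noteq> 0. ent x i i)"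

lemma tr_eq:
  assumes "supp_le N x"
  shows "tr n x = of_nat n * scal x + (\<Sum>i<N. ent x i i)"
proof -
  have "(\<Sum>i | ent x i i \<noteq> 0. ent x i i) = (\<Sum>i<N. ent x i i)"
    by (rule sum.mono_neutral_left) (use assms in \<open>auto simp: supp_le_def not_less[symmetric]\<close>)
  then show ?thesis by (simp add: tr_def)
qed

lemma tr_commute: "tr n (x * y) = tr n (y * x)"
proof -
  obtain N where N: "supp_le N x" "supp_le N y" by (rule supp_le_common)
  have "(\<Sum>i<N. \<Sum>k<N. ent x i k * ent y k i) = (\<Sum>i<N. \<Sum>k<N. ent y i k * ent x k i)"
    by (subst sum.swap) (simp add: mult.commute)
  then show ?thesis
    using N by (simp add: tr_eq[where N=N] ent_mult[where N=N] scal_ent_mult(1) sum.distrib)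
qed

lemma tr_add: "tr n (x + y) = tr n x + tr n y"
proof -
  obtain N where N: "supp_le N x" "supp_le N y" by (rule supp_le_common)
  then show ?thesis by (simp add: tr_eq[where N=N] smat_simps sum.distrib algebra_simps)
qed

lemma tr_cscal_mult: "tr n (cscal c * x) = c * tr n x"
proof -
  obtain N where N: "supp_le N x" using supp_le_exists by blast
  then show ?thesis by (simp add: tr_eq[where N=N] smat_simps sum_distrib_left algebra_simps)
qed

lemma tr_0 [simp]: "tr n 0 = 0"
  using tr_cscal_mult[of n 0 0] by (simp add: cscal_simps)

lemma tr_1 [simp]: "tr n 1 = of_nat n"
  by (simp add: tr_def smat_simps)

lemma tr_sum: "tr n (\<Sum>i\<in>I. f i) = (\<Sum>i\<in>I. tr n (f i))"
  by (induction I rule: infinite_finite_induct) (auto simp: tr_add)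

text \<open>The entrywise sum norm is submultiplicative and satisfies \<open>nrm 1 = 1\<close>, so
  that estimates for products acquire no factor depending on the block size.\<close>

definition nrm :: "smat \<Rightarrow> real" where
  "nrm x = cmod (scal x) + (\<Sum>p | ent x (fst p) (snd p) \<noteq> 0. cmod (ent x (fst p) (snd p)))"

lemma nrm_eq:
  assumes "supp_le N x"
  shows "nrm x = cmod (scal x) + (\<Sum>i<N. \<Sum>j<N. cmod (ent x i j))"
proof -
  have "(\<Sum>p | ent x (fst p) (snd p) \<noteq> 0. cmod (ent x (fst p) (snd p)))
      = (\<Sum>p\<in>{..<N}\<times>{..<N}. cmod (ent x (fst p) (snd p)))"
    by (rule sum.mono_neutral_left)
      (use assms in \<open>auto simp: supp_le_def simp flip: not_le\<close>)
  then show ?thesis by (simp add: nrm_def sum.cartesian_product case_prod_beta)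
qed

lemma nrm_nonneg [simp]: "0 \<le> nrm x"
  by (auto simp: nrm_def intro!: add_nonneg_nonneg sum_nonneg)

lemma nrm_1 [simp]: "nrm 1 = 1"
  by (simp add: nrm_def smat_simps)

lemma nrm_minus [simp]: "nrm (- x) = nrm x"
  by (simp add: nrm_def smat_simps)

lemma nrm_minus_commute: "nrm (x - y) = nrm (y - x)"
  by (metis minus_diff_eq nrm_minus)

lemma nrm_add: "nrm (x + y) \<le> nrm x + nrm y"
proof -
  obtain N where N: "supp_le N x" "supp_le N y" by (rule supp_le_common)
  have "(\<Sum>i<N. \<Sum>j<N. cmod (ent x i j + ent y i j)) \<le> (\<Sum>i<N. \<Sum>j<N. cmod (ent x i j) + cmod (ent y i j))"
    by (intro sum_mono norm_triangle_ineq)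
  moreover have "cmod (scal x + scal y) \<le> cmod (scal x) + cmod (scal y)" by (rule norm_triangle_ineq)
  ultimately show ?thesis
    using N by (simp add: nrm_eq[where N=N] smat_simps sum.distrib)
qed

lemma nrm_diff: "nrm (x - y) \<le> nrm x + nrm y"
  by (metis add_uminus_conv_diff nrm_add nrm_minus)

lemma nrm_mult: "nrm (x * y) \<le> nrm x * nrm y"
proof -
  obtain N where N: "supp_le N x" "supp_le N y" by (rule supp_le_common)
  define X Y where "X = (\<Sum>i<N. \<Sum>j<N. cmod (ent x i j))" and "Y = (\<Sum>i<N. \<Sum>j<N. cmod (ent y i j))"
  have "cmod (scal x * ent y i j + scal y * ent x i j + (\<Sum>k<N. ent x i k * ent y k j))
     \<le> cmod (scal x) * cmod (ent y i j) + cmod (scal y) * cmod (ent x i j)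
        + (\<Sum>k<N. cmod (ent x i k) * cmod (ent y k j))" for i j
    by (rule order_trans[OF norm_triangle_ineq] add_mono sum_norm_le | simp add: norm_mult)+
  then have "(\<Sum>i<N. \<Sum>j<N. cmod (ent (x * y) i j)) \<le> (\<Sum>i<N. \<Sum>j<N. 
     cmod (scal x) * cmod (ent y i j) + cmod (scal y) * cmod (ent x i j)
        + (\<Sum>k<N. cmod (ent x i k) * cmod (ent y k j)))"
    using N by (intro sum_mono) (simp add: ent_mult[where N=N])
  also have "\<dots> = cmod (scal x) * Y + cmod (scal y) * X
      + (\<Sum>i<N. \<Sum>j<N. \<Sum>k<N. cmod (ent x i k) * cmod (ent y k j))"
    by (simp add: X_def Y_def sum.distrib sum_distrib_left)
  also have "(\<Sum>i<N. \<Sum>j<N. \<Sum>k<N. cmod (ent x i k) * cmod (ent y k j))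
      = (\<Sum>i<N. \<Sum>k<N. cmod (ent x i k) * (\<Sum>j<N. cmod (ent y k j)))"
    unfolding sum_distrib_left by (intro sum.cong refl sum.swap)
  also have "\<dots> \<le> (\<Sum>i<N. \<Sum>k<N. cmod (ent x i k) * Y)"
  proof (intro sum_mono mult_left_mono)
    fix k assume "k \<in> {..<N}"
    then show "(\<Sum>j<N. cmod (ent y k j)) \<le> Y"
      unfolding Y_def by (intro member_le_sum[where f = "\<lambda>k. \<Sum>j<N. cmod (ent y k j)"]) (auto intro: sum_nonneg)
  qed auto
  also have "\<dots> = X * Y" by (simp add: X_def sum_distrib_right)
  finally have "(\<Sum>i<N. \<Sum>j<N. cmod (ent (x * y) i j)) \<le> cmod (scal x) * Y + cmod (scal y) * X + X * Y"
    by simp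
  moreover have "nrm x = cmod (scal x) + X" "nrm y = cmod (scal y) + Y"
    using N by (simp_all add: nrm_eq X_def Y_def)
  moreover have "nrm (x * y) = cmod (scal x) * cmod (scal y) + (\<Sum>i<N. \<Sum>j<N. cmod (ent (x * y) i j))"
    using N by (simp add: nrm_eq[where N=N] scal_ent_mult(1) norm_mult)
  ultimately show ?thesis by (simp add: algebra_simps)
qed

lemma cmod_ent_le_nrm: "cmod (ent x i j) \<le> nrm x"
proof -
  obtain N0 where "supp_le N0 x" using supp_le_exists by blast
  then have N: "supp_le (Suc (N0 + i + j)) x" by (rule supp_le_mono) simp
  let ?N = "Suc (N0 + i + j)"
  have "cmod (ent x i j) \<le> (\<Sum>j<?N. cmod (ent x i j))"
    by (intro member_le_sum[where f = "\<lambda>j. cmod (ent x i j)"]) auto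
  also have "\<dots> \<le> (\<Sum>i<?N. \<Sum>j<?N. cmod (ent x i j))"
    by (intro member_le_sum[where f = "\<lambda>i. \<Sum>j<?N. cmod (ent x i j)"] sum_nonneg) auto
  also have "\<dots> \<le> nrm x" using N by (simp add: nrm_eq[where N="?N"])
  finally show ?thesis .
qed

lemma nrm_eq_0: "nrm x = 0 \<Longrightarrow> x = 0"
  by (rule smat_eqI)
    (use cmod_ent_le_nrm[of x] in \<open>auto simp: smat_simps nrm_def add_nonneg_eq_0_iff sum_nonneg\<close>)

section \<open>Transfer to matrices of fixed size\<close>

definition to_mat :: "nat \<Rightarrow> smat \<Rightarrow> complex mat" where
  "to_mat n x = mat n n (\<lambda>(i,j). (if i = j then scal x else 0) + ent x i j)"

text \<open>\<open>c\<close> is the diagonal value beyond the block: 1 for group elements, 0 for the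
  block identity. It is subtracted on the diagonal because the scalar part is stored
  separately.\<close>

definition of_mat :: "nat \<Rightarrow> complex \<Rightarrow> complex mat \<Rightarrow> smat" where
  "of_mat n c A = mk_smat c (\<lambda>i j. if i < n \<and> j < n then A $$ (i,j) - (if i = j then c else 0) else 0)"

lemma to_mat_carrier [simp]: "to_mat n x \<in> carrier_mat n n" "dim_row (to_mat n x) = n" "dim_col (to_mat n x) = n"
  by (simp_all add: to_mat_def)

lemma scal_of_mat [simp]: "scal (of_mat n c A) = c"
  and ent_of_mat: "ent (of_mat n c A) i j = (if i < n \<and> j < n then A $$ (i,j) - (if i = j then c else 0) else 0)"
  unfolding of_mat_def by (subst scal_mk[where N=n] ent_mk[where N=n]; auto)+

lemma supp_le_of_mat [simp]: "supp_le n (of_mat n c A)"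
  by (simp add: supp_le_def ent_of_mat)

lemma to_mat_of_mat [simp]: "A \<in> carrier_mat n n \<Longrightarrow> to_mat n (of_mat n c A) = A"
  by (intro eq_matI) (auto simp: to_mat_def ent_of_mat)

lemma of_mat_to_mat: "supp_le n x \<Longrightarrow> of_mat n (scal x) (to_mat n x) = x"
  by (rule smat_eqI) (auto simp: to_mat_def ent_of_mat supp_le_def)

lemma to_mat_inject: "supp_le n x \<Longrightarrow> supp_le n y \<Longrightarrow> scal x = scal y \<Longrightarrow> to_mat n x = to_mat n y \<Longrightarrow> x = y"
  by (metis of_mat_to_mat)

lemma to_mat_1: "to_mat n 1 = 1\<^sub>m n"
  by (intro eq_matI) (auto simp: to_mat_def smat_simps)

lemma to_mat_mult:
  assumes "supp_le n x"
  shows "to_mat n (x * y) = to_mat n x * to_mat n y"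
proof (intro eq_matI)
  fix i j assume "i < dim_row (to_mat n x * to_mat n y)" "j < dim_col (to_mat n x * to_mat n y)"
  then have ij: "i < n" "j < n" by auto
  have "(to_mat n x * to_mat n y) $$ (i,j) = (\<Sum>k<n. ((if i = k then scal x else 0) + ent x i k) * ((if k = j then scal y else 0) + ent y k j))"
    using ij by (simp add: to_mat_def scalar_prod_def atLeast0LessThan)
  also have "\<dots> = (\<Sum>k<n. if i = k then (if k = j then scal x * scal y else 0) else 0) + (\<Sum>k<n. if i = k then scal x * ent y k j else 0)
      + (\<Sum>k<n. if k = j then scal y * ent x i k else 0) + (\<Sum>k<n. ent x i k * ent y k j)"
    unfolding sum.distrib[symmetric] by (intro sum.cong refl) (simp add: algebra_simps)
  also have "\<dots> = to_mat n (x * y) $$ (i,j)"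
    using ij assms by (simp add: to_mat_def scal_ent_mult(1) ent_mult)
  finally show "to_mat n (x * y) $$ (i,j) = (to_mat n x * to_mat n y) $$ (i,j)" by simp
qed auto

lemma tr_to_mat: "supp_le n x \<Longrightarrow> tr n x = (\<Sum>i<n. to_mat n x $$ (i,i))"
  by (simp add: tr_eq to_mat_def sum.distrib)

lemma of_mat_mult:
  assumes "A \<in> carrier_mat n n" "B \<in> carrier_mat n n"
  shows "of_mat n (c * d) (A * B) = of_mat n c A * of_mat n d B"
  by (rule to_mat_inject[of n]) (use assms in \<open>auto simp: to_mat_mult scal_ent_mult(1)\<close>)

lemma of_mat_1: "of_mat n 1 (1\<^sub>m n) = 1"
  by (rule to_mat_inject[of n]) (auto simp: smat_simps to_mat_1)

section \<open>Triangular form, traces and eigenvalues\<close>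

definition diag :: "smat \<Rightarrow> nat \<Rightarrow> complex" where
  "diag x i = scal x + ent x i i"

definition upper_tri :: "smat \<Rightarrow> bool" where
  "upper_tri x \<longleftrightarrow> (\<forall>i j. j < i \<longrightarrow> ent x i j = 0)"

text \<open>This is Schur triangularization of the block; \<open>p\<close> and \<open>q\<close> are
  extended by the identity, so conjugation leaves the scalar part of \<open>x\<close>
  unchanged.\<close>

lemma upper_tri_similar:
  assumes "supp_le n x"
  obtains p q b where "supp_le n p" "supp_le n q" "supp_le n b" "p * q = 1" "q * p = 1"
    "scal b = scal x" "x = p * b * q" "upper_tri b"
proof -
  let ?A = "to_mat n x"
  obtain as where "char_poly ?A = (\<Prod> a \<leftarrow> as. [:- a, 1:])"
    using char_poly_factorized[OF to_mat_carrier(1)] by blast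
  from schur_decomposition_exists[OF to_mat_carrier(1) this]
  obtain B where B: "B \<in> carrier_mat n n" "upper_triangular B" "similar_mat ?A B" by blast
  obtain m P Q where mPQ: "{?A, B, P, Q} \<subseteq> carrier_mat m m" "P * Q = 1\<^sub>m m" "Q * P = 1\<^sub>m m"
    "?A = P * B * Q" using similar_matD[OF B(3)] by blast
  have "to_mat n x \<in> carrier_mat m m" using mPQ(1) by blast
  then have mn: "m = n" using to_mat_carrier(2)[of n x] by (metis carrier_matD(1))
  from mPQ(1) have PQ: "P \<in> carrier_mat n n" "Q \<in> carrier_mat n n" unfolding mn by blast+
  let ?p = "of_mat n 1 P" and ?q = "of_mat n 1 Q" and ?b = "of_mat n (scal x) B"
  have "x = of_mat n (1 * scal x * 1) (P * B * Q)"
    using of_mat_to_mat[OF assms] unfolding mPQ(4) by simp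
  also have "\<dots> = ?p * ?b * ?q"
    using B(1) PQ by (simp only: of_mat_mult mult_carrier_mat)
  finally have "x = ?p * ?b * ?q" .
  moreover have "?p * ?q = 1" "?q * ?p = 1"
    using of_mat_mult[OF PQ, of 1 1] of_mat_mult[OF PQ(2,1), of 1 1] mPQ(2,3)
    by (simp_all add: of_mat_1 mn)
  moreover have "upper_tri ?b"
    using B by (auto simp: upper_tri_def ent_of_mat upper_triangular_def)
  ultimately show thesis using that[of ?p ?q ?b] by simp
qed

lemma upper_tri_mult:
  assumes "upper_tri x" "upper_tri y"
  shows "upper_tri (x * y)" "diag (x * y) i = diag x i * diag y i"
proof -
  obtain N where N: "supp_le N x" "supp_le N y" by (rule supp_le_common)
  have "(\<Sum>k<N. ent x i k * ent y k j) = 0" if "j < i" for i j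
  proof (rule sum.neutral, intro ballI)
    fix k show "ent x i k * ent y k j = 0"
      using assms that by (cases "k < i") (auto simp: upper_tri_def)
  qed
  then show "upper_tri (x * y)"
    using assms N by (auto simp: upper_tri_def ent_mult[where N=N])
  have "(\<Sum>k<N. ent x i k * ent y k i) = (\<Sum>k<N. if k = i then ent x i i * ent y i i else 0)"
    using assms by (intro sum.cong refl) (metis linorder_neqE_nat mult_zero_left mult_zero_right upper_tri_def)
  also have "\<dots> = ent x i i * ent y i i"
    using N by (auto simp: supp_le_def)
  finally show "diag (x * y) i = diag x i * diag y i"
    using N by (simp add: diag_def ent_mult[where N=N] scal_ent_mult(1) algebra_simps)
qed

lemma upper_tri_power:
  assumes "upper_tri x"
  shows "upper_tri (x ^ k)" "diag (x ^ k) i = diag x i ^ k"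
proof -
  have "upper_tri (x ^ k) \<and> diag (x ^ k) i = diag x i ^ k"
    by (induction k)
      (use assms upper_tri_mult in \<open>auto simp: upper_tri_def diag_def smat_simps\<close>)
  then show "upper_tri (x ^ k)" "diag (x ^ k) i = diag x i ^ k" by auto
qed

lemma conj_power:
  fixes p q b :: "'a::monoid_mult"
  assumes "q * p = 1" "p * q = 1"
  shows "(p * b * q) ^ k = p * b ^ k * q"
proof (induction k)
  case (Suc k)
  have "p * b * q * (p * b ^ k * q) = p * b * (q * p) * b ^ k * q" by (simp add: mult.assoc)
  then show ?case using Suc assms by (simp add: mult.assoc)
qed (use assms in auto)

lemma tr_conj: "q * p = 1 \<Longrightarrow> tr n (p * b * q) = tr n b"
  by (metis mult.assoc mult_1 tr_commute)

text \<open>The \<open>\<beta> i\<close> are the diagonal entries of one triangular form of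
  \<open>x\<close>, so the same roots of unity give the traces of all powers.\<close>

lemma torsion_trace:
  assumes "supp_le n x" "x ^ M = 1"
  obtains \<beta> :: "nat \<Rightarrow> complex" where "\<And>i. \<beta> i ^ M = 1" "\<And>k. tr n (x ^ k) = (\<Sum>i<n. \<beta> i ^ k)"
proof -
  obtain p q b where pq: "supp_le n p" "supp_le n q" "supp_le n b" "p * q = 1" "q * p = 1"
    "scal b = scal x" "x = p * b * q" "upper_tri b"
    by (rule upper_tri_similar[OF assms(1)])
  have bk: "x ^ k = p * b ^ k * q" for k using conj_power pq by metis
  have "b ^ M = q * (p * b ^ M * q) * p"
    using pq(5) by (metis mult.assoc mult_1 mult.right_neutral)
  then have "b ^ M = 1" using bk[of M] assms(2) pq(5) by simp
  then have "diag b i ^ M = 1" for i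
    using upper_tri_power(2)[OF pq(8), of M i] by (simp add: diag_def smat_simps)
  moreover have "tr n (x ^ k) = (\<Sum>i<n. diag b i ^ k)" for k
  proof -
    have "tr n (x ^ k) = tr n (b ^ k)" by (simp only: bk tr_conj[OF pq(5)])
    also have "\<dots> = (\<Sum>i<n. diag (b ^ k) i)"
      by (simp add: tr_eq[OF supp_le_power[OF pq(3)]] diag_def sum.distrib)
    finally show ?thesis by (simp add: upper_tri_power(2)[OF pq(8)])
  qed
  ultimately show thesis using that by blast
qed

text \<open>\<open>m\<close> is the rank. A triangular form of an idempotent has only 0 and 1 on its
  diagonal, which gives both the trace and the determinant of the map that is \<open>c\<close> on
  the image of \<open>p\<close> and 1 on its kernel.\<close>

lemma idempotent_trace:
  assumes p: "supp_le n p" "scal p = 0" "p * p = p"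
  obtains m where "tr n p = of_nat m" "m \<le> n" "m = 0 \<longleftrightarrow> p = 0"
    "\<And>c. det (to_mat n (1 - p + cscal c * p)) = c ^ m"
proof -
  obtain u v b where pq: "supp_le n u" "supp_le n v" "supp_le n b" "u * v = 1" "v * u = 1"
    "scal b = scal p" "p = u * b * v" "upper_tri b"
    by (rule upper_tri_similar[OF p(1)])
  have bb: "b = v * p * u" using pq by (metis mult.assoc mult_1 mult.right_neutral)
  have "b * b = v * p * (u * v) * p * u" unfolding bb by (simp add: mult.assoc)
  also have "\<dots> = v * (p * p) * u" unfolding pq(4) by (simp add: mult.assoc)
  finally have idb: "b * b = b" by (simp only: p(3) bb)
  have sb: "scal b = 0" using pq p by simp
  have "diag b i = 0 \<or> diag b i = 1" for i
    using upper_tri_mult(2)[OF pq(8) pq(8), of i] unfolding idb by auto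
  then have db: "diag b i = (if diag b i \<noteq> 0 then 1 else 0)" for i by metis
  define m where "m = card {i. i < n \<and> diag b i \<noteq> 0}"
  have "tr n p = tr n b" by (simp only: pq(7) tr_conj[OF pq(5)])
  also have "\<dots> = (\<Sum>i<n. diag b i)" by (simp add: tr_eq[OF pq(3)] diag_def sb)
  also have "\<dots> = (\<Sum>i<n. if diag b i \<noteq> 0 then 1 else 0)" using db by (intro sum.cong refl)
  also have "\<dots> = of_nat m" unfolding m_def by (subst sum.If_cases) (auto simp: Int_def)
  finally have 1: "tr n p = of_nat m" .
  have 2: "m \<le> n" unfolding m_def using card_mono[of "{..<n}" "{i. i < n \<and> diag b i \<noteq> 0}"] by auto
  have 3: "m = 0 \<longleftrightarrow> p = 0"
  proof
    assume "m = 0"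
    then have "ent b i i = 0" if "i < n" for i using that sb by (auto simp: m_def diag_def)
    then have d0: "ent b i i = 0" for i using pq(3) by (cases "i < n") (auto simp: supp_le_def)
    \<comment> \<open>A strictly upper triangular idempotent vanishes, by induction on the distance
      from the diagonal: in an entry of \<open>b * b\<close> each product has a factor on or below
      the diagonal, or one nearer to it.\<close>
    have e0: "ent b i j = 0" for i j
    proof (induction "j - i" arbitrary: i j rule: less_induct)
      case less
      show ?case
      proof (cases "i < j \<and> j < n")
        case True
        have "ent b i j = (\<Sum>k<n. ent b i k * ent b k j)"
          using ent_mult[OF pq(3), of b i j] idb sb by simp
        also have "\<dots> = 0"
        proof (rule sum.neutral, intro ballI)
          fix k assume "k \<in> {..<n}"
          then show "ent b i k * ent b k j = 0"
            using True less[of k i] d0[of i] pq(8)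
            by (cases k i rule: linorder_cases; cases k j rule: linorder_cases)
              (auto simp: upper_tri_def d0)
        qed
        finally show ?thesis .
      next
        case False
        then show ?thesis using pq(3,8) d0
          by (cases i j rule: linorder_cases) (auto simp: upper_tri_def supp_le_def not_less)
      qed
    qed
    have "b = 0" by (rule smat_eqI) (auto simp: e0 sb smat_simps)
    then show "p = 0" using pq by simp
  qed (use 1 in simp)
  have 4: "det (to_mat n (1 - p + cscal c * p)) = c ^ m" for c
  proof -
    let ?d = "1 - b + cscal c * b"
    have "1 - p + cscal c * p = u * ?d * v"
    proof -
      have "u * ?d * v = u * v - u * b * v + cscal c * (u * b * v)"
        by (simp add: algebra_simps cscal_left_commute)
      then show ?thesis by (simp only: pq(4) pq(7)[symmetric])
    qed
    then have "to_mat n (1 - p + cscal c * p) = to_mat n u * to_mat n ?d * to_mat n v"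
      using pq(1-3) by (simp add: to_mat_mult)
    then have "det (to_mat n (1 - p + cscal c * p)) = det (to_mat n u) * det (to_mat n ?d) * det (to_mat n v)"
      by (simp add: det_mult[of _ n] mult_carrier_mat[of _ n n])
    moreover have "det (to_mat n u) * det (to_mat n v) = 1"
      using pq(1,4) to_mat_mult[of n u v] det_mult[OF to_mat_carrier(1) to_mat_carrier(1), of n u v]
      by (metis det_one to_mat_1)
    ultimately have *: "det (to_mat n (1 - p + cscal c * p)) = det (to_mat n ?d)"
      by (metis mult.commute mult.left_commute mult_1)
    have "upper_triangular (to_mat n ?d)"
      using pq(8) by (auto simp: upper_triangular_def to_mat_def upper_tri_def smat_simps)
    then have "det (to_mat n ?d) = prod_list (diag_mat (to_mat n ?d))"
      using det_upper_triangular to_mat_carrier(1) by blast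
    also have "\<dots> = (\<Prod>i<n. 1 + (c - 1) * diag b i)"
      by (simp add: diag_mat_def to_mat_def prod.list_conv_set_nth atLeast0LessThan smat_simps sb diag_def algebra_simps)
    also have "\<dots> = (\<Prod>i<n. if diag b i \<noteq> 0 then c else 1)"
      by (rule prod.cong[OF refl]) (subst db, auto)
    also have "\<dots> = c ^ m" unfolding m_def by (subst prod.If_cases) (auto simp: Int_def)
    finally show ?thesis using * by simp
  qed
  show thesis by (rule that[OF 1 2 3 4])
qed

text \<open>Eigenvalues are tested on matrices \<open>E\<close> because eigenprojections supply such
  eigenmatrices directly. With \<open>scal E = 0\<close> the matrix lies in the block, and any
  nonzero column of it is an eigenvector.\<close>

lemma finite_eigenvalues:
  assumes "supp_le n x"
  obtains A where "finite A" "card A \<le> n"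
    "\<And>E c. supp_le n E \<Longrightarrow> scal E = 0 \<Longrightarrow> E \<noteq> 0 \<Longrightarrow> x * E = cscal c * E \<Longrightarrow> c \<in> A"
proof (rule that[of "spectrum (to_mat n x)"])
  fix E c assume E: "supp_le n E" "scal E = 0" "E \<noteq> 0" "x * E = cscal c * E"
  from E(1-3) obtain a b where ab: "ent E a b \<noteq> 0" "a < n" "b < n"
    by (metis linorder_not_less scal_ent_0 smat_eqI supp_le_def)
  let ?v = "vec n (\<lambda>i. ent E i b)"
  have "to_mat n x *\<^sub>v ?v = c \<cdot>\<^sub>v ?v"
  proof (rule eq_vecI)
    fix i assume "i < dim_vec (c \<cdot>\<^sub>v ?v)"
    then have i: "i < n" by simp
    have "(to_mat n x *\<^sub>v ?v) $ i = (\<Sum>k<n. ((if i = k then scal x else 0) + ent x i k) * ent E k b)"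
      using i by (simp add: to_mat_def scalar_prod_def atLeast0LessThan)
    also have "\<dots> = (\<Sum>k<n. (if i = k then scal x * ent E k b else 0) + ent x i k * ent E k b)"
      by (rule sum.cong) (auto simp: algebra_simps)
    also have "\<dots> = ent (x * E) i b"
      using i by (simp add: ent_mult[OF assms] sum.distrib E(2))
    finally show "(to_mat n x *\<^sub>v ?v) $ i = (c \<cdot>\<^sub>v ?v) $ i" using i E by simp
  qed simp
  moreover have "?v \<noteq> 0\<^sub>v n" using ab by (metis index_vec index_zero_vec(1))
  ultimately show "c \<in> spectrum (to_mat n x)"
    unfolding spectrum_def eigenvalue_def eigenvector_def by (auto intro!: exI[of _ ?v])
qed (use card_finite_spectrum[OF to_mat_carrier(1)] in auto)

text \<open>The Gram matrix factors through the space of \<open>n\<close> by \<open>n\<close> matrices, which has dimension \<open>n\<^sup>2\<close>.\<close>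

lemma trace_form_minor:
  assumes "\<And>i. i < d \<Longrightarrow> supp_le n (x i)" "\<And>j. j < d \<Longrightarrow> supp_le n (y j)"
    and "det (mat d d (\<lambda>(i,j). tr n (x i * y j))) \<noteq> 0"
  shows "d \<le> n * n"
proof (rule ccontr)
  assume "\<not> d \<le> n * n"
  then have d: "n * n < d" by simp
  obtain h where h: "bij_betw h {..<n * n} ({..<n} \<times> {..<n})"
    using ex_bij_betw_nat_finite[of "{..<n} \<times> {..<n}"] by (auto simp: atLeast0LessThan)
  \<comment> \<open>Both factors are padded by zeros from the inner dimension \<open>n * n\<close>
    up to \<open>d\<close>. Since \<open>n * n < d\<close>, column \<open>n * n\<close> of
    \<open>A\<close> is zero and \<open>A\<close> is singular.\<close>
  define A where "A = mat d d (\<lambda>(i,k). if k < n * n then to_mat n (x i) $$ h k else 0)"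
  define B where "B = mat d d (\<lambda>(k,j). if k < n * n then to_mat n (y j) $$ (snd (h k), fst (h k)) else 0)"
  have "mat d d (\<lambda>(i,j). tr n (x i * y j)) = A * B"
  proof (rule eq_matI)
    fix i j assume "i < dim_row (A * B)" "j < dim_col (A * B)"
    then have ij: "i < d" "j < d" by (auto simp: A_def B_def)
    have "(A * B) $$ (i,j) = (\<Sum>k<d. A $$ (i,k) * B $$ (k,j))"
      using ij by (simp add: A_def B_def scalar_prod_def atLeast0LessThan)
    also have "\<dots> = (\<Sum>k<n*n. A $$ (i,k) * B $$ (k,j))"
      using d ij by (intro sum.mono_neutral_right) (auto simp: A_def)
    also have "\<dots> = (\<Sum>k<n*n. (\<lambda>(a,b). to_mat n (x i) $$ (a,b) * to_mat n (y j) $$ (b,a)) (h k))"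
      using d ij by (intro sum.cong) (auto simp: A_def B_def split: prod.splits)
    also have "\<dots> = (\<Sum>(a,b)\<in>{..<n} \<times> {..<n}. to_mat n (x i) $$ (a,b) * to_mat n (y j) $$ (b,a))"
      by (rule sum.reindex_bij_betw[OF h])
    also have "\<dots> = tr n (x i * y j)"
      using assms(1,2) ij
      by (simp add: tr_to_mat to_mat_mult scalar_prod_def atLeast0LessThan flip: sum.cartesian_product)
    finally show "mat d d (\<lambda>(i,j). tr n (x i * y j)) $$ (i,j) = (A * B) $$ (i,j)" using ij by simp
  qed (auto simp: A_def B_def)
  moreover have "A *\<^sub>v unit_vec d (n * n) = 0\<^sub>v d"
    using d by (intro eq_vecI) (auto simp: A_def scalar_prod_def unit_vec_def intro!: sum.neutral)
  then have "\<exists>v. v \<in> carrier_vec d \<and> v \<noteq> 0\<^sub>v d \<and> A *\<^sub>v v = 0\<^sub>v d"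
    using d by (intro exI[of _ "unit_vec d (n * n)"]) auto
  then have "det A = 0"
    by (subst det_0_iff_vec_prod_zero[of A d]) (auto simp: A_def)
  moreover have "det (A * B) = det A * det B"
    by (rule det_mult[of _ d]) (auto simp: A_def B_def)
  ultimately show False
    using assms(3) by simp
qed

section \<open>Eigenprojections of elements of finite order\<close>

lemma cscal_cscal: "cscal a * (cscal b * y) = cscal (a * b) * y"
  by (simp add: cscal_simps mult.assoc)

abbreviation rou :: "nat \<Rightarrow> complex set" where
  "rou M \<equiv> {z. z ^ M = 1}"

lemma finite_rou: "M > 0 \<Longrightarrow> finite (rou M)"
  by (rule finite_roots_unity) simp

lemma rou_nonzero: "c \<in> rou M \<Longrightarrow> M > 0 \<Longrightarrow> c \<noteq> 0"
  by (auto simp: power_0_left)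

lemma sum_powers_rou: "z \<in> rou M \<Longrightarrow> (\<Sum>k<M. z ^ k) = (if z = 1 then of_nat M else 0)"
  by (simp add: sum_gp_strict)

text \<open>Multiplication by the primitive root \<open>w\<close> permutes the roots of unity and
  scales the sum by a factor that is not 1 when \<open>k\<close> is nonzero.\<close>

lemma sum_rou_powers:
  assumes "k < M"
  shows "(\<Sum>z\<in>rou M. inverse z ^ k) = (if k = 0 then of_nat M else 0)"
proof (cases "k = 0")
  case True
  then show ?thesis using assms by (simp add: card_roots_unity_eq)
next
  case False
  define w where "w = cis (2 * pi * real 1 / real M)"
  have M: "M > 0" using assms by simp
  have wM: "w ^ M = 1" using M by (simp add: w_def DeMoivre)
  have wk: "w ^ j = cis (2 * pi * real j / real M)" for j by (simp add: w_def DeMoivre mult_ac)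
  have w0: "w \<noteq> 0" by (simp add: w_def)
  have "w ^ k \<noteq> 1"
  proof
    assume "w ^ k = 1"
    then have "cis (2 * pi * real k / real M) = cis (2 * pi * real 0 / real M)" by (simp add: wk)
    then have "k = 0"
      using inj_onD[OF bij_betw_imp_inj_on[OF bij_betw_roots_unity[OF M]], of k 0] assms M by auto
    then show False using False by simp
  qed
  have "bij_betw (\<lambda>z. w * z) (rou M) (rou M)"
    by (rule bij_betwI[where g = "\<lambda>z. inverse w * z"])
      (use wM w0 in \<open>auto simp: power_mult_distrib power_inverse\<close>)
  then have "(\<Sum>z\<in>rou M. inverse z ^ k) = (\<Sum>z\<in>rou M. inverse (w * z) ^ k)"
    by (rule sum.reindex_bij_betw[symmetric])
  also have "\<dots> = inverse (w ^ k) * (\<Sum>z\<in>rou M. inverse z ^ k)"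
    by (simp add: sum_distrib_left power_mult_distrib power_inverse)
  finally show ?thesis using \<open>w ^ k \<noteq> 1\<close> w0 False by (simp add: field_simps)
qed

text \<open>If \<open>x ^ M = 1\<close>, this discrete Fourier average is the projection onto the
  \<open>c\<close>-eigenspace of \<open>x\<close>. Being a polynomial in \<open>x\<close>, it
  commutes with whatever commutes with \<open>x\<close>.\<close>

definition eproj :: "nat \<Rightarrow> complex \<Rightarrow> smat \<Rightarrow> smat" where
  "eproj M c x = cscal (1 / of_nat M) * (\<Sum>k<M. cscal (inverse c ^ k) * x ^ k)"

lemma supp_le_eproj [simp]: "supp_le n x \<Longrightarrow> supp_le n (eproj M c x)"
  by (simp add: eproj_def)

text \<open>An element of scalar part 1 has only the eigenvalue 1 outside the block. The projection
  for \<open>c = 1\<close> is therefore infinite, which is why that eigenvalue is treated apart in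
  what follows.\<close>

lemma scal_eproj:
  assumes "scal x = 1" "c \<in> rou M" "M > 0"
  shows "scal (eproj M c x) = (if c = 1 then 1 else 0)"
proof -
  have "inverse c \<in> rou M" using assms by (simp add: power_inverse)
  from sum_powers_rou[OF this] show ?thesis
    using assms by (auto simp: eproj_def scal_sum scal_power)
qed

lemma commute_power: "y * x = x * y \<Longrightarrow> y * x ^ k = x ^ k * y" for x :: "'a::monoid_mult"
  using power_commuting_commutes[of x y k] by simp

lemma eproj_commute:
  assumes "y * x = x * y"
  shows "y * eproj M c x = eproj M c x * y"
proof -
  have "y * (\<Sum>k<M. cscal (inverse c ^ k) * x ^ k) = (\<Sum>k<M. cscal (inverse c ^ k) * x ^ k) * y"
    unfolding sum_distrib_left sum_distrib_right
    by (intro sum.cong refl) (simp add: cscal_left_commute commute_power[OF assms] mult.assoc)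
  then show ?thesis by (simp add: eproj_def cscal_left_commute mult.assoc)
qed

text \<open>Multiplication by \<open>x\<close> shifts the summation index cyclically, as the terms
  for \<open>k = M\<close> and \<open>k = 0\<close> agree.\<close>

lemma eproj_eigen:
  assumes "x ^ M = 1" "c \<in> rou M" "M > 0"
  shows "x * eproj M c x = cscal c * eproj M c x"
proof -
  have c: "c \<noteq> 0" "inverse c ^ M = 1" using assms rou_nonzero by (auto simp: power_inverse)
  let ?f = "\<lambda>k. cscal (inverse c ^ k) * x ^ k"
  have "(\<Sum>k<M. ?f (Suc k)) = (\<Sum>k<M. ?f k)"
    using sum.lessThan_Suc_shift[of ?f M] assms(1) c(2) by (simp add: cscal_simps)
  have "x * (\<Sum>k<M. ?f k) = (\<Sum>k<M. cscal c * ?f (Suc k))"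
    unfolding sum_distrib_left
  proof (intro sum.cong refl)
    fix k
    have "cscal c * ?f (Suc k) = cscal (c * inverse c ^ Suc k) * x ^ Suc k"
      by (simp add: cscal_simps mult.assoc)
    moreover have "x * ?f k = cscal (inverse c ^ k) * x ^ Suc k"
      by (subst cscal_left_commute) simp
    moreover have "c * inverse c ^ Suc k = inverse c ^ k" using c(1) by simp
    ultimately show "x * ?f k = cscal c * ?f (Suc k)" by (simp only:)
  qed
  also have "\<dots> = cscal c * (\<Sum>k<M. ?f k)"
    using \<open>(\<Sum>k<M. ?f (Suc k)) = (\<Sum>k<M. ?f k)\<close> by (simp flip: sum_distrib_left)
  finally have "x * (\<Sum>k<M. ?f k) = cscal c * (\<Sum>k<M. ?f k)" .
  then show ?thesis
    unfolding eproj_def cscal_left_commute[of x] by (simp only: cscal_left_commute[of "cscal c"])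
qed

lemma eigen_power:
  assumes "x * y = cscal c * y"
  shows "x ^ k * y = cscal (c ^ k) * y"
proof (induction k)
  case (Suc k)
  have "x ^ Suc k * y = x ^ k * (x * y)" by (simp add: power_Suc2 mult.assoc del: power_Suc)
  also have "\<dots> = cscal c * (cscal (c ^ k) * y)" by (simp only: assms cscal_left_commute[of "x ^ k"] Suc)
  finally show ?case by (simp add: cscal_simps mult.assoc)
qed (simp add: cscal_simps)

lemma eproj_on_eigen:
  assumes "x * y = cscal b * y" "b \<in> rou M" "c \<in> rou M" "M > 0"
  shows "eproj M c x * y = (if b = c then y else 0)"
proof -
  have c: "c \<noteq> 0" using assms rou_nonzero by auto
  have "b / c \<in> rou M" using assms by (simp add: power_divide)
  have "(\<Sum>k<M. cscal (inverse c ^ k) * x ^ k) * y = (\<Sum>k<M. cscal ((b / c) ^ k) * y)"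
    unfolding sum_distrib_right
    by (intro sum.cong refl)
      (simp add: mult.assoc eigen_power[OF assms(1)] cscal_cscal power_mult_distrib power_inverse divide_inverse mult.commute)
  also have "\<dots> = cscal (if b = c then of_nat M else 0) * y"
    using sum_powers_rou[OF \<open>b / c \<in> rou M\<close>] c
    by (simp flip: sum_distrib_right cscal_sum)
  finally have "eproj M c x * y = cscal (1 / of_nat M) * (cscal (if b = c then of_nat M else 0) * y)"
    by (simp add: eproj_def mult.assoc)
  then show ?thesis
    using assms(4) by (simp add: cscal_cscal cscal_simps(1,2))
qed

lemma sum_eproj:
  assumes "M > 0"
  shows "(\<Sum>c\<in>rou M. eproj M c x) = 1"
proof -
  have "(\<Sum>c\<in>rou M. \<Sum>k<M. cscal (inverse c ^ k) * x ^ k) = (\<Sum>k<M. cscal (\<Sum>c\<in>rou M. inverse c ^ k) * x ^ k)"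
    by (subst sum.swap) (simp add: cscal_sum sum_distrib_right)
  also have "\<dots> = (\<Sum>k<M. if k = 0 then cscal (of_nat M) else 0)"
    by (intro sum.cong refl) (simp add: sum_rou_powers cscal_simps)
  also have "\<dots> = cscal (of_nat M)" using assms by simp
  finally have "(\<Sum>c\<in>rou M. eproj M c x) = cscal (1 / of_nat M) * cscal (of_nat M)"
    unfolding eproj_def by (simp only: sum_distrib_left[symmetric])
  then show ?thesis
    using assms by (simp add: cscal_simps(4)[symmetric] cscal_simps(2))
qed

lemma eproj_nonzero_exists:
  assumes "M > 0" "E \<noteq> 0"
  obtains c where "c \<in> rou M" "eproj M c x * E \<noteq> 0"
proof -
  have "(\<Sum>c\<in>rou M. eproj M c x * E) = E"
    using sum_eproj[OF assms(1), of x] by (simp flip: sum_distrib_right)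
  then have "\<exists>c\<in>rou M. eproj M c x * E \<noteq> 0" using assms(2) by (metis sum.neutral)
  then show thesis using that by blast
qed

lemma eproj_idem:
  assumes "x ^ M = 1" "c \<in> rou M" "b \<in> rou M" "M > 0"
  shows "eproj M c x * eproj M b x = (if b = c then eproj M b x else 0)"
  using eproj_on_eigen[OF eproj_eigen[OF assms(1,3,4)] assms(3,2,4)] .

lemma torsion_eq_1:
  assumes "x ^ M = 1" "M > 0" "\<And>c. c \<in> rou M \<Longrightarrow> c \<noteq> 1 \<Longrightarrow> eproj M c x = 0"
  shows "x = 1"
proof -
  have "(\<Sum>c\<in>rou M. eproj M c x) = (\<Sum>c\<in>{1}. eproj M c x)"
    using assms by (intro sum.mono_neutral_right finite_rou) auto
  then have "eproj M 1 x = 1" using sum_eproj[OF assms(2)] by simp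
  then show "x = 1" using eproj_eigen[OF assms(1), of 1] assms(2) by (simp add: cscal_simps)
qed

text \<open>\<open>x\<close> acts as \<open>c\<close> on the image of \<open>eproj M c x\<close>,
  and these images span everything. This turns a bound on the orders of the eigenvalues into an
  exponent independent of \<open>M\<close>.\<close>

lemma torsion_power_eq_1:
  assumes "x ^ M = 1" "M > 0" "\<And>c. c \<in> rou M \<Longrightarrow> eproj M c x \<noteq> 0 \<Longrightarrow> c ^ N = 1"
  shows "x ^ N = 1"
proof -
  have "x ^ N = (\<Sum>c\<in>rou M. x ^ N * eproj M c x)"
    by (simp add: sum_eproj[OF assms(2)] flip: sum_distrib_left)
  also have "\<dots> = (\<Sum>c\<in>rou M. eproj M c x)"
  proof (intro sum.cong refl)
    fix c assume c: "c \<in> rou M"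
    then show "x ^ N * eproj M c x = eproj M c x"
      using assms(3)[OF c] eigen_power[OF eproj_eigen[OF assms(1) c assms(2)]]
      by (cases "eproj M c x = 0") (auto simp: cscal_simps)
  qed
  finally show ?thesis by (simp add: sum_eproj[OF assms(2)])
qed

text \<open>A sum of \<open>n\<close> roots of unity equals \<open>n\<close> only if all of them are
  1. Then every projection for an eigenvalue other than 1 has trace 0, hence rank 0.\<close>

lemma torsion_tr_eq_n:
  assumes "supp_le n x" "scal x = 1" "x ^ M = 1" "M > 0" "tr n x = of_nat n"
  shows "x = 1"
proof (rule torsion_eq_1[OF assms(3,4)])
  fix c assume c: "c \<in> rou M" "c \<noteq> 1"
  obtain \<beta> :: "nat \<Rightarrow> complex" where \<beta>: "\<And>i. \<beta> i ^ M = 1" "\<And>k. tr n (x ^ k) = (\<Sum>i<n. \<beta> i ^ k)"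
    using torsion_trace[OF assms(1,3)] by metis
  have nb: "cmod (\<beta> i) = 1" for i
  proof -
    have "cmod (\<beta> i) ^ M = 1 ^ M" by (simp add: \<beta>(1) flip: norm_power)
    then show ?thesis using assms(4) power_eq_imp_eq_base[of "cmod (\<beta> i)" M 1] by simp
  qed
  have "(\<Sum>i<n. \<beta> i) = of_nat n" using \<beta>(2)[of 1] assms(5) by simp
  from arg_cong[OF this, of Re] have "(\<Sum>i<n. 1 - Re (\<beta> i)) = 0"
    by (simp add: sum_subtractf)
  moreover have le: "0 \<le> 1 - Re (\<beta> i)" for i
    using complex_Re_le_cmod[of "\<beta> i"] nb[of i] by simp
  ultimately have re: "Re (\<beta> i) = 1" if "i < n" for i
    using that by (subst (asm) sum_nonneg_eq_0_iff) auto
  have b1: "\<beta> i = 1" if "i < n" for i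
    using re[OF that] nb[of i] by (simp add: complex_eq_iff cmod_def)
  have trx: "tr n (x ^ k) = of_nat n" for k
    by (simp add: \<beta>(2) b1)
  have ic: "inverse c \<in> rou M" using c by (simp add: power_inverse)
  let ?p = "eproj M c x"
  have "tr n ?p = (1 / of_nat M) * ((\<Sum>k<M. inverse c ^ k) * of_nat n)"
    by (simp add: eproj_def tr_cscal_mult tr_sum trx sum_distrib_right)
  then have t0: "tr n ?p = 0" using sum_powers_rou[OF ic] c by simp
  have s0: "supp_le n ?p" "scal ?p = 0" "?p * ?p = ?p"
    using assms c by (simp_all add: scal_eproj eproj_idem)
  obtain m where "tr n ?p = of_nat m" "m = 0 \<longleftrightarrow> ?p = 0"
    using idempotent_trace[OF s0] by metis
  then show "?p = 0" using t0 by simp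
qed

lemma torsion_nonzero:
  fixes x :: "'a::ring_1"
  assumes "x ^ M = 1" "M > 0" "E \<noteq> 0"
  shows "x * E \<noteq> 0"
proof
  assume "x * E = 0"
  then have "x ^ (M - 1) * (x * E) = 0" by simp
  moreover have "x ^ (M - 1) * x = x ^ M" using assms(2) by (metis power_minus_mult)
  ultimately show False using assms by (simp add: mult.assoc[symmetric])
qed

text \<open>If \<open>x y x\<^sup>-\<^sup>1 = z y\<close> with \<open>z\<close> central, conjugation by \<open>x\<close> multiplies the eigenvalues of \<open>y\<close>
  on an eigenspace of \<open>z\<close> by the eigenvalue of \<open>z\<close>, so that the latter has order at most \<open>n\<close>.\<close>

lemma central_commutator_exponent:
  assumes x: "supp_le n x" "x ^ M = 1"
    and y: "supp_le n y" "scal y = 1" "y ^ M = 1"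
    and z: "supp_le n z" "scal z = 1" "z ^ M = 1"
    and M: "M > 0"
    and comm: "x * y = z * y * x" "z * x = x * z" "z * y = y * z"
  shows "z ^ fact n = 1"
proof (rule torsion_power_eq_1[OF z(3) M])
  fix c assume c: "c \<in> rou M" "eproj M c z \<noteq> 0"
  show "c ^ fact n = 1"
  proof (cases "c = 1")
    case False
    obtain b where b: "b \<in> rou M" "eproj M b y * eproj M c z \<noteq> 0"
      using eproj_nonzero_exists[OF M c(2)] by metis
    define E where "E = eproj M b y * eproj M c z"
    have E: "supp_le n E" "scal E = 0" "E \<noteq> 0"
      using y z c False b by (auto simp: E_def scal_ent_mult(1) scal_eproj M)
    have yE: "y * E = cscal b * E"
      unfolding E_def using eproj_eigen[OF y(3) b(1) M] by (simp add: mult.assoc[symmetric])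
    have zE: "z * E = cscal c * E"
    proof -
      have "z * E = eproj M b y * (z * eproj M c z)"
        unfolding E_def using eproj_commute[OF comm(3), of M b] by (simp add: mult.assoc[symmetric])
      then show ?thesis
        by (simp only: eproj_eigen[OF z(3) c(1) M] cscal_left_commute[of "eproj M b y"] E_def)
    qed
    have c0: "c \<noteq> 0" using c M rou_nonzero by auto
    \<comment> \<open>Each application of \<open>x\<close> carries an eigenmatrix of
      \<open>y\<close> to another one, with the eigenvalue divided by \<open>c\<close>, and stays in
      the \<open>c\<close>-eigenspace of \<open>z\<close>.\<close>
    have step: "y * (x ^ i * E) = cscal (b / c ^ i) * (x ^ i * E) \<and> z * (x ^ i * E) = cscal c * (x ^ i * E)
      \<and> x ^ i * E \<noteq> 0" for i
    proof (induction i)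
      case 0
      then show ?case using yE zE E by simp
    next
      case (Suc i)
      define F where "F = x ^ i * E"
      have IH: "y * F = cscal (b / c ^ i) * F" "z * F = cscal c * F" "F \<noteq> 0"
        using Suc by (auto simp: F_def)
      have zG: "z * (x * F) = cscal c * (x * F)"
      proof -
        have "z * (x * F) = x * (z * F)" using comm(2) by (simp add: mult.assoc[symmetric])
        then show ?thesis by (simp only: IH(2) cscal_left_commute[of x])
      qed
      have "cscal c * (y * (x * F)) = y * (z * (x * F))" by (simp add: zG cscal_left_commute)
      also have "\<dots> = z * y * x * F" using comm(3) by (simp add: mult.assoc[symmetric])
      also have "\<dots> = x * (y * F)" using comm(1) by (simp add: mult.assoc[symmetric])
      also have "\<dots> = cscal (b / c ^ i) * (x * F)" by (simp add: IH cscal_left_commute)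
      finally have "cscal (inverse c) * (cscal c * (y * (x * F))) = cscal (inverse c) * (cscal (b / c ^ i) * (x * F))"
        by simp
      moreover have "inverse c * (b / c ^ i) = b / c ^ Suc i" "inverse c * c = 1"
        using c0 by (simp_all add: field_simps)
      ultimately have "y * (x * F) = cscal (b / c ^ Suc i) * (x * F)"
        by (simp only: cscal_cscal cscal_simps(2) mult_1)
      moreover have "x * F \<noteq> 0" by (rule torsion_nonzero[OF x(2) M IH(3)])
      ultimately show ?case using zG by (simp add: F_def mult.assoc)
    qed
    obtain A where A: "finite A" "card A \<le> n"
      "\<And>E c. supp_le n E \<Longrightarrow> scal E = 0 \<Longrightarrow> E \<noteq> 0 \<Longrightarrow> y * E = cscal c * E \<Longrightarrow> c \<in> A"
      using finite_eigenvalues[OF y(1)] by metis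
    have "b / c ^ i \<in> A" for i
      using step[of i] E x by (intro A(3)[of "x ^ i * E"]) (auto simp: scal_ent_mult(1))
    \<comment> \<open>The \<open>n + 1\<close> indices meet at most \<open>n\<close> eigenvalues of
      \<open>y\<close>, so two of the quotients \<open>b / c ^ i\<close> coincide.\<close>
    then have "card ((\<lambda>i. b / c ^ i) ` {0..n}) \<le> card A"
      by (intro card_mono A) auto
    then have "\<not> inj_on (\<lambda>i. b / c ^ i) {0..n}"
      using A(2) by (auto dest: card_image)
    then obtain i j where ij: "i < j" "j \<le> n" "b / c ^ i = b / c ^ j"
      unfolding inj_on_def by (metis atLeastAtMost_iff linorder_neqE_nat)
    have b0: "b \<noteq> 0" using b M rou_nonzero by auto
    have "c ^ i * c ^ (j - i) = c ^ j" using ij(1) by (simp add: power_add[symmetric])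
    moreover have "c ^ i = c ^ j" using ij(3) b0 c0 by (simp add: frac_eq_eq)
    ultimately have "c ^ (j - i) = 1" using c0 by simp
    moreover have "(j - i) dvd fact n" using ij by (intro dvd_fact) auto
    ultimately show ?thesis by (metis dvd_def power_mult power_one)
  qed simp
qed

section \<open>Families of orthogonal idempotents\<close>

definition idn :: "nat \<Rightarrow> smat" where
  "idn n = of_mat n 0 (1\<^sub>m n)"

lemma supp_le_idn [simp]: "supp_le n (idn n)" and scal_idn [simp]: "scal (idn n) = 0"
  and ent_idn: "ent (idn n) i j = (if i < n \<and> i = j then 1 else 0)"
  by (auto simp: idn_def ent_of_mat)

lemma tr_idn: "tr n (idn n) = of_nat n"
  by (simp add: tr_eq[of n] ent_idn)

lemma mult_idn:
  assumes "supp_le n x" "scal x = 0"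
  shows "x * idn n = x" "idn n * x = x"
proof -
  have "(\<Sum>k<n. ent x i k * ent (idn n) k j) = (\<Sum>k<n. if k = j then ent x i j else 0)" for i j
    by (rule sum.cong) (auto simp: ent_idn)
  then show "x * idn n = x"
    using assms by (intro smat_eqI) (auto simp: scal_ent_mult(1) ent_mult[OF assms(1)] supp_le_def)
  have "(\<Sum>k<n. ent (idn n) i k * ent x k j) = (\<Sum>k<n. if k = i then ent x i j else 0)" for i j
    by (rule sum.cong) (auto simp: ent_idn)
  then show "idn n * x = x"
    using assms by (intro smat_eqI) (auto simp: scal_ent_mult(1) ent_mult[OF supp_le_idn] supp_le_def)
qed

text \<open>\<open>1 - idn n\<close> is the identity outside the block, where elements of scalar
  part 1 act trivially.\<close>

lemma mult_compl_idn:
  assumes "supp_le n x" "scal x = 1"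
  shows "x * (1 - idn n) = 1 - idn n" "(1 - idn n) * x = 1 - idn n"
proof -
  have "(x - 1) * idn n = x - 1" "idn n * (x - 1) = x - 1"
    using assms by (auto intro!: mult_idn simp: smat_simps)
  then show "x * (1 - idn n) = 1 - idn n" "(1 - idn n) * x = 1 - idn n"
    by (auto simp: algebra_simps)
qed

text \<open>Such a family decomposes the block into nonzero subspaces. Its sum is
  \<open>idn n\<close> and not 1 because its members have scalar part 0.\<close>

definition orth_fam :: "nat \<Rightarrow> smat set \<Rightarrow> bool" where
  "orth_fam n F \<longleftrightarrow> finite F \<and> (\<forall>E\<in>F. supp_le n E \<and> scal E = 0 \<and> E \<noteq> 0 \<and> E * E = E) \<and>
     (\<forall>E\<in>F. \<forall>E'\<in>F. E \<noteq> E' \<longrightarrow> E * E' = 0) \<and> \<Sum>F = idn n"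

lemma orth_famD:
  assumes "orth_fam n F"
  shows "finite F" "\<And>E. E \<in> F \<Longrightarrow> supp_le n E" "\<And>E. E \<in> F \<Longrightarrow> scal E = 0" "\<And>E. E \<in> F \<Longrightarrow> E \<noteq> 0"
    "\<And>E. E \<in> F \<Longrightarrow> E * E = E" "\<And>E E'. E \<in> F \<Longrightarrow> E' \<in> F \<Longrightarrow> E \<noteq> E' \<Longrightarrow> E * E' = 0" "\<Sum>F = idn n"
  using assms unfolding orth_fam_def by blast+

text \<open>The traces of the members are positive integers with sum \<open>n\<close>.\<close>

lemma orth_fam_card:
  assumes "orth_fam n F"
  shows "card F \<le> n"
proof -
  note F = orth_famD[OF assms]
  have "\<exists>m. tr n E = of_nat m \<and> 1 \<le> m" if "E \<in> F" for E
    using idempotent_trace[OF F(2,3,5)] F(4) that by (metis One_nat_def Suc_leI not_gr_zero)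
  then obtain m where m: "\<And>E. E \<in> F \<Longrightarrow> tr n E = of_nat (m E)" "\<And>E. E \<in> F \<Longrightarrow> 1 \<le> m E"
    by metis
  have "of_nat n = tr n (\<Sum>F)" by (simp add: F(7) tr_idn)
  also have "\<dots> = of_nat (\<Sum>E\<in>F. m E)" by (simp add: tr_sum m(1))
  finally have "n = (\<Sum>E\<in>F. m E)" by (metis of_nat_eq_iff)
  moreover have "(\<Sum>E\<in>F. 1) \<le> (\<Sum>E\<in>F. m E)" by (rule sum_mono) (rule m(2))
  ultimately show ?thesis by simp
qed

lemma orth_fam_single: "n > 0 \<Longrightarrow> orth_fam n {idn n}"
  using tr_idn[of n] by (auto simp: orth_fam_def mult_idn)

lemma orth_fam_expand:
  assumes "orth_fam n F" "supp_le n x" "scal x = 1"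
  shows "x = 1 - idn n + (\<Sum>E\<in>F. x * E)"
proof -
  have "(\<Sum>E\<in>F. x * E) = x * idn n" using orth_famD(7)[OF assms(1)] by (simp flip: sum_distrib_left)
  moreover have "x = x * (1 - idn n) + x * idn n" by (simp add: algebra_simps)
  ultimately show ?thesis using mult_compl_idn(1)[OF assms(2,3)] by simp
qed

text \<open>The new family consists of the nonzero products \<open>eproj M c x * E\<close>. Each
  \<open>E\<close> survives for at least one \<open>c\<close>; if the number of members does not
  grow, it survives for exactly one, and \<open>x\<close> is scalar on \<open>E\<close>.\<close>

lemma orth_fam_refine:
  assumes F: "orth_fam n F" and x: "supp_le n x" "x ^ M = 1" "M > 0"
    and comm: "\<And>E. E \<in> F \<Longrightarrow> E * x = x * E"
  obtains F' where "orth_fam n F'"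
    "\<And>E'. E' \<in> F' \<Longrightarrow> \<exists>c. x * E' = cscal c * E'"
    "\<And>E'. E' \<in> F' \<Longrightarrow> \<exists>c. \<exists>E\<in>F. E' = eproj M c x * E"
    "card F \<le> card F'"
    "card F = card F' \<Longrightarrow> \<forall>E\<in>F. \<exists>c. x * E = cscal c * E"
proof -
  note FD = orth_famD[OF F]
  define g where "g = (\<lambda>(c,E). eproj M c x * E)"
  define P where "P = {q \<in> rou M \<times> F. g q \<noteq> 0}"
  have finP: "finite P" unfolding P_def using finite_rou[OF x(3)] FD(1) by auto
  have ce: "E * eproj M c x = eproj M c x * E" if "E \<in> F" for E c
    by (rule eproj_commute[OF comm[OF that]])
  have gg: "g q * g q' = (if q = q' then g q else 0)" if "q \<in> P" "q' \<in> P" for q q'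
  proof -
    obtain c E b E' where q: "q = (c,E)" "q' = (b,E')" by fastforce
    have in': "c \<in> rou M" "b \<in> rou M" "E \<in> F" "E' \<in> F" using that by (auto simp: P_def q)
    have "g q * g q' = eproj M c x * (E * eproj M b x) * E'" by (simp add: q g_def mult.assoc)
    also have "\<dots> = (eproj M c x * eproj M b x) * (E * E')" unfolding ce[OF in'(3)] by (simp add: mult.assoc)
    also have "\<dots> = (if b = c then eproj M b x else 0) * (if E = E' then E else 0)"
      using eproj_idem[OF x(2) in'(1,2) x(3)] FD(5,6) in' by auto
    finally show ?thesis by (auto simp: q g_def)
  qed
  have inj: "inj_on g P"
  proof (rule inj_onI, rule ccontr)
    fix q q' assume q: "q \<in> P" "q' \<in> P" "g q = g q'" "q \<noteq> q'"
    then have "g q = 0" using gg[OF q(1,2)] gg[OF q(1,1)] by simp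
    then show False using q by (simp add: P_def)
  qed
  define F' where "F' = g ` P"
  have "\<Sum>F' = (\<Sum>q\<in>P. g q)" unfolding F'_def using sum.reindex[OF inj, of "\<lambda>x. x"] by simp
  also have "\<dots> = (\<Sum>q\<in>rou M \<times> F. g q)"
    unfolding P_def by (rule sum.mono_neutral_left) (use finite_rou[OF x(3)] FD(1) in auto)
  also have "\<dots> = (\<Sum>c\<in>rou M. \<Sum>E\<in>F. eproj M c x * E)"
    by (simp add: g_def sum.cartesian_product)
  also have "\<dots> = (\<Sum>E\<in>F. (\<Sum>c\<in>rou M. eproj M c x) * E)"
    by (subst sum.swap) (simp add: sum_distrib_right)
  also have "\<dots> = idn n" using FD(7) by (simp add: sum_eproj[OF x(3)])
  finally have sumF': "\<Sum>F' = idn n" .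
  have fam: "orth_fam n F'"
    unfolding orth_fam_def
  proof (intro conjI ballI impI)
    show "finite F'" by (simp add: F'_def finP)
    fix E assume "E \<in> F'"
    then obtain q where q: "E = g q" "q \<in> P" by (auto simp: F'_def)
    then show "E \<noteq> 0" "E * E = E" using gg by (auto simp: P_def)
    show "supp_le n E" "scal E = 0"
      using q FD(2,3) x by (auto simp: P_def g_def scal_ent_mult(1))
    fix E' assume "E' \<in> F'" "E \<noteq> E'"
    then obtain q' where "E' = g q'" "q' \<in> P" "q \<noteq> q'" using q by (auto simp: F'_def)
    then show "E * E' = 0" using q gg[of q q'] by simp
  qed (rule sumF')
  have eig: "\<exists>c. x * E' = cscal c * E'" if E': "E' \<in> F'" for E'
  proof -
    obtain c E where "E' = eproj M c x * E" "c \<in> rou M" using E' by (auto simp: F'_def P_def g_def)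
    then have "x * E' = cscal c * E'"
      using eproj_eigen[OF x(2) _ x(3), of c] by (simp add: mult.assoc[symmetric])
    then show ?thesis by blast
  qed
  have snd: "snd ` P = F"
  proof
    show "F \<subseteq> snd ` P"
    proof
      fix E assume E: "E \<in> F"
      obtain c where "c \<in> rou M" "eproj M c x * E \<noteq> 0"
        using eproj_nonzero_exists[OF x(3) FD(4)[OF E]] by metis
      then have "(c, E) \<in> P" using E by (auto simp: P_def g_def)
      then show "E \<in> snd ` P" by force
    qed
  qed (auto simp: P_def)
  have cardF': "card F' = card P" unfolding F'_def by (rule card_image[OF inj])
  have cl: "card F \<le> card F'" using card_image_le[OF finP, of snd] by (simp add: cardF' snd)
  have ceq: "\<forall>E\<in>F. \<exists>c. x * E = cscal c * E" if "card F = card F'"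
  proof
    fix E assume E: "E \<in> F"
    have injs: "inj_on snd P" using that finP by (intro eq_card_imp_inj_on) (auto simp: snd cardF')
    obtain c where c: "c \<in> rou M" "eproj M c x * E \<noteq> 0"
      using eproj_nonzero_exists[OF x(3) FD(4)[OF E]] by metis
    have "eproj M b x * E = 0" if "b \<in> rou M" "b \<noteq> c" for b
    proof (rule ccontr)
      assume "eproj M b x * E \<noteq> 0"
      then have "(b, E) \<in> P" "(c, E) \<in> P" using that c E by (auto simp: P_def g_def)
      then show False using inj_onD[OF injs] that by fastforce
    qed
    then have "(\<Sum>b\<in>rou M. eproj M b x * E) = (\<Sum>b\<in>{c}. eproj M b x * E)"
      using c finite_rou[OF x(3)] by (intro sum.mono_neutral_right) auto
    then have "eproj M c x * E = E"
      using sum_eproj[OF x(3), of x] by (simp flip: sum_distrib_right)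
    then have "x * E = cscal c * E"
      using eproj_eigen[OF x(2) c(1) x(3)] by (metis mult.assoc)
    then show "\<exists>c. x * E = cscal c * E" by blast
  qed
  show thesis
  proof (rule that[OF fam eig _ cl ceq])
    show "\<exists>c. \<exists>E\<in>F. E' = eproj M c x * E" if "E' \<in> F'" for E'
      using that by (auto simp: F'_def P_def g_def)
  qed
qed

lemma commute_mult: "y * a = a * y \<Longrightarrow> y * b = b * y \<Longrightarrow> y * (a * b) = (a * b) * y"
  for y :: "'a::semigroup_mult"
  by (metis mult.assoc)

text \<open>If the family did not grow, \<open>x\<close> would be a linear combination of its
  members on the block and would commute with \<open>s\<close>. The last conclusion allows an
  induction to continue with the centralizer of \<open>x\<close> and the larger family.\<close>

lemma orth_fam_split:
  assumes F: "orth_fam n F" and x: "supp_le n x" "scal x = 1" "x ^ M = 1" "M > 0"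
    and comm: "\<And>E. E \<in> F \<Longrightarrow> E * x = x * E"
    and s: "supp_le n s" "scal s = 1" "s * x \<noteq> x * s" "\<And>E. E \<in> F \<Longrightarrow> s * E = E * s"
  obtains F' where "orth_fam n F'" "card F < card F'"
    "\<And>y E'. y * x = x * y \<Longrightarrow> (\<And>E. E \<in> F \<Longrightarrow> y * E = E * y) \<Longrightarrow> E' \<in> F' \<Longrightarrow> y * E' = E' * y"
proof -
  obtain F' where F': "orth_fam n F'"
    "\<And>E'. E' \<in> F' \<Longrightarrow> \<exists>c. \<exists>E\<in>F. E' = eproj M c x * E"
    "card F \<le> card F'"
    "card F = card F' \<Longrightarrow> \<forall>E\<in>F. \<exists>c. x * E = cscal c * E"
    using orth_fam_refine[OF F x(1,3,4) comm] by metis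
  have "card F \<noteq> card F'"
  proof
    assume "card F = card F'"
    from F'(4)[OF this] obtain c where c: "\<And>E. E \<in> F \<Longrightarrow> x * E = cscal (c E) * E" by metis
    have xe: "x = 1 - idn n + (\<Sum>E\<in>F. cscal (c E) * E)"
      using orth_fam_expand[OF F x(1,2)] c by simp
    have "s * (\<Sum>E\<in>F. cscal (c E) * E) = (\<Sum>E\<in>F. cscal (c E) * E) * s"
      unfolding sum_distrib_left sum_distrib_right
      by (intro sum.cong refl) (simp add: cscal_left_commute s(4) mult.assoc)
    moreover have "s * (1 - idn n) = (1 - idn n) * s" using mult_compl_idn s by metis
    ultimately have "s * x = x * s" by (subst (1 2) xe) (simp only: distrib_left distrib_right)
    then show False using s(3) by simp
  qed
  then have "card F < card F'" using F'(3) by simp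
  moreover have "y * E' = E' * y"
    if y: "y * x = x * y" "\<And>E. E \<in> F \<Longrightarrow> y * E = E * y" "E' \<in> F'" for y E'
  proof -
    obtain c E where E: "E \<in> F" "E' = eproj M c x * E" using F'(2)[OF y(3)] by blast
    then show ?thesis using commute_mult eproj_commute[OF y(1)] y(2) by metis
  qed
  ultimately show thesis using that F'(1) by blast
qed

text \<open>The last clause is the invariant of the induction: the next element commutes with
  \<open>C\<close>, hence with the family found so far, which it can then refine.\<close>

lemma commuting_eigenfamily:
  assumes "finite C" "n > 0" "M > 0" "\<And>c. c \<in> C \<Longrightarrow> supp_le n c \<and> scal c = 1 \<and> c ^ M = 1"
    "\<And>c d. c \<in> C \<Longrightarrow> d \<in> C \<Longrightarrow> c * d = d * c"
  shows "\<exists>F. orth_fam n F \<and> (\<forall>c\<in>C. \<forall>E\<in>F. \<exists>b. c * E = cscal b * E) \<and>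
    (\<forall>y. supp_le n y \<longrightarrow> scal y = 1 \<longrightarrow> (\<forall>c\<in>C. y * c = c * y) \<longrightarrow> (\<forall>E\<in>F. y * E = E * y))"
  using assms(1,4,5)
proof (induction C rule: finite_induct)
  case empty
  have "y * idn n = idn n * y" if "supp_le n y" "scal y = 1" for y
    using mult_compl_idn[OF that] by (simp add: algebra_simps)
  then show ?case using orth_fam_single[OF assms(2)] by (intro exI[of _ "{idn n}"]) auto
next
  case (insert x C)
  have "\<And>c. c \<in> C \<Longrightarrow> supp_le n c \<and> scal c = 1 \<and> c ^ M = 1" "\<And>c d. c \<in> C \<Longrightarrow> d \<in> C \<Longrightarrow> c * d = d * c"
    using insert.prems by blast+
  from insert.IH[OF this] obtain F where F: "orth_fam n F" "\<forall>c\<in>C. \<forall>E\<in>F. \<exists>b. c * E = cscal b * E"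
    "\<forall>y. supp_le n y \<longrightarrow> scal y = 1 \<longrightarrow> (\<forall>c\<in>C. y * c = c * y) \<longrightarrow> (\<forall>E\<in>F. y * E = E * y)" by blast
  have x: "supp_le n x" "scal x = 1" "x ^ M = 1" using insert.prems by auto
  have xC: "x * c = c * x" if "c \<in> C" for c using insert.prems(2)[of x c] that by simp
  have xF: "E * x = x * E" if "E \<in> F" for E using F(3) x xC that by metis
  obtain F' where F': "orth_fam n F'" "\<And>E'. E' \<in> F' \<Longrightarrow> \<exists>c. x * E' = cscal c * E'"
    "\<And>E'. E' \<in> F' \<Longrightarrow> \<exists>c. \<exists>E\<in>F. E' = eproj M c x * E"
    using orth_fam_refine[OF F(1) x(1,3) assms(3) xF] by metis
  have "\<exists>b. c * E' = cscal b * E'" if c: "c \<in> C" "E' \<in> F'" for c E'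
  proof -
    obtain d E where E: "E \<in> F" "E' = eproj M d x * E" using F'(3)[OF c(2)] by blast
    obtain b where b: "c * E = cscal b * E" using F(2) c(1) E(1) by blast
    have "c * E' = eproj M d x * (c * E)"
      using eproj_commute[OF xC[OF c(1), symmetric], of M d] by (simp add: E(2) mult.assoc[symmetric])
    then show ?thesis by (metis b cscal_left_commute E(2))
  qed
  moreover have "y * E' = E' * y"
    if y: "supp_le n y" "scal y = 1" "\<forall>c\<in>insert x C. y * c = c * y" "E' \<in> F'" for y E'
  proof -
    obtain d E where E: "E \<in> F" "E' = eproj M d x * E" using F'(3)[OF y(4)] by blast
    have "y * x = x * y" "y * E = E * y" using y(1-3) F(3) E(1) by auto
    then show ?thesis unfolding E(2) by (intro commute_mult eproj_commute)
  qed
  ultimately show ?case using F'(1,2) by blast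
qed

text \<open>On a common eigenfamily of at most \<open>n\<close> idempotents, an element of
  \<open>C\<close> is determined by its eigenvalues, each of which is one of the at most
  \<open>n\<close> elements of \<open>A\<close>.\<close>

lemma card_commuting_bound:
  assumes C: "finite C" "n > 0" "M > 0" "\<And>c. c \<in> C \<Longrightarrow> supp_le n c \<and> scal c = 1 \<and> c ^ M = 1"
    "\<And>c d. c \<in> C \<Longrightarrow> d \<in> C \<Longrightarrow> c * d = d * c"
    and A: "finite A" "card A \<le> n"
    "\<And>c E b. c \<in> C \<Longrightarrow> supp_le n E \<Longrightarrow> scal E = 0 \<Longrightarrow> E \<noteq> 0 \<Longrightarrow> c * E = cscal b * E \<Longrightarrow> b \<in> A"
  shows "card C \<le> n ^ n"
proof -
  obtain F where F: "orth_fam n F" "\<And>c E. c \<in> C \<Longrightarrow> E \<in> F \<Longrightarrow> \<exists>b. c * E = cscal b * E"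
    using commuting_eigenfamily[OF C] by metis
  note FD = orth_famD[OF F(1)]
  define b where "b = (\<lambda>c E. SOME b. c * E = cscal b * E)"
  have b: "c * E = cscal (b c E) * E" if "c \<in> C" "E \<in> F" for c E
    unfolding b_def by (rule someI_ex[OF F(2)[OF that]])
  define f where "f = (\<lambda>c. restrict (b c) F)"
  have "inj_on f C"
  proof (rule inj_onI)
    fix c d assume cd: "c \<in> C" "d \<in> C" "f c = f d"
    have "c * E = d * E" if "E \<in> F" for E
      using fun_cong[OF cd(3), of E] b[of _ E] cd that by (simp add: f_def)
    then show "c = d"
      using orth_fam_expand[OF F(1), of c] orth_fam_expand[OF F(1), of d] C(4) cd(1,2) by simp
  qed
  then have "card C = card (f ` C)" by (simp add: card_image)
  also have "\<dots> \<le> card (F \<rightarrow>\<^sub>E A)"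
  proof (rule card_mono)
    show "finite (F \<rightarrow>\<^sub>E A)" using FD(1) A(1) by (intro finite_PiE)
    show "f ` C \<subseteq> F \<rightarrow>\<^sub>E A"
      using A(3)[OF _ FD(2,3,4) b] by (auto simp: f_def)
  qed
  also have "\<dots> = card A ^ card F" using FD(1) by (simp add: card_funcsetE)
  also have "\<dots> \<le> n ^ card F" by (intro power_mono A) simp
  also have "\<dots> \<le> n ^ n" using orth_fam_card[OF F(1)] C(2) by (intro power_increasing) auto
  finally show ?thesis .
qed

text \<open>A central \<open>z\<close> relating powers of \<open>u s v\<close> and \<open>u g s g\<^sup>-\<^sup>1 v\<close> has determinant 1 on each of its
  eigenspaces, because these two words have the same determinant there.\<close>

lemma central_quotient_exponent:
  assumes supp: "supp_le n u" "supp_le n s" "supp_le n v" "supp_le n g" "supp_le n h"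
    and z: "supp_le n z" "scal z = 1" "z ^ M = 1" "M > 0"
    and comm: "z * u = u * z" "z * s = s * z" "z * v = v * z" "z * g = g * z" "z * h = h * z"
    and gh: "g * h = 1" and tor: "(u * s * v) ^ M = 1"
    and eq: "(u * g * s * h * v) ^ Q = z * (u * s * v) ^ Q"
  shows "z ^ fact n = 1"
proof (rule torsion_power_eq_1[OF z(3,4)])
  fix c assume c: "c \<in> rou M" "eproj M c z \<noteq> 0"
  define p where "p = eproj M c z"
  show "c ^ fact n = 1"
  proof (cases "c = 1")
    case False
    have p: "supp_le n p" "scal p = 0" "p * p = p" "z * p = cscal c * p"
      using c z False by (simp_all add: p_def scal_eproj eproj_idem eproj_eigen)
    \<comment> \<open>\<open>D x\<close> is the determinant of \<open>x\<close> on the image of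
      \<open>p\<close>, completed by the identity on the kernel; it is multiplicative on elements
      commuting with \<open>p\<close>.\<close>
    define D where "D = (\<lambda>x. det (to_mat n (1 - p + p * x)))"
    have D1: "D 1 = 1" by (simp add: D_def to_mat_1)
    have Dmult: "D (x * y) = D x * D y" if "supp_le n x" "supp_le n y" "x * p = p * x" for x y
    proof -
      have a: "p * (p * w) = p * w" "x * (p * w) = p * (x * w)" for w
        using p(3) that(3) by (simp_all add: mult.assoc[symmetric])
      have "(1 - p + p * x) * (1 - p + p * y) = 1 - p + p * (x * y)"
        by (simp add: algebra_simps a p(3) that(3))
      then have "to_mat n (1 - p + p * (x * y)) = to_mat n (1 - p + p * x) * to_mat n (1 - p + p * y)"
        using p(1) that(1) to_mat_mult[of n "1 - p + p * x" "1 - p + p * y"] by simp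
      then show ?thesis unfolding D_def by (simp add: det_mult[of _ n])
    qed
    have cp: "x * p = p * x" if "z * x = x * z" for x
      unfolding p_def using eproj_commute that by metis
    have Dpow: "D (x ^ k) = D x ^ k" if "supp_le n x" "x * p = p * x" for x k
      by (induction k) (simp_all add: D1 Dmult that)
    let ?w1 = "u * s * v" and ?w = "u * g * s * h * v"
    note cps = comm[THEN cp]
    have cw1: "?w1 * p = p * ?w1" and cw: "?w * p = p * ?w"
      using cps by (metis commute_mult)+
    have sw: "supp_le n ?w1" "supp_le n ?w" using supp by auto
    have Dw: "D ?w = D u * D g * D s * D h * D v" "D ?w1 = D u * D s * D v"
      using cps supp commute_mult[of p] by (simp_all add: Dmult)
    moreover have "D g * D h = 1" using Dmult[of g h] cps supp gh D1 by simp
    ultimately have "D ?w = D ?w1" by (simp add: mult.assoc mult.left_commute)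
    moreover have "D ?w ^ Q = D z * D ?w1 ^ Q"
    proof -
      have "D ?w ^ Q = D (z * ?w1 ^ Q)" using Dpow[OF sw(2) cw, of Q] eq by simp
      also have "\<dots> = D z * D (?w1 ^ Q)" by (rule Dmult) (use z sw cp in simp_all)
      finally show ?thesis by (simp add: Dpow[OF sw(1) cw1])
    qed
    \<comment> \<open>Torsion makes this determinant nonzero, so that it can be cancelled and
      \<open>D z = 1\<close> follows.\<close>
    moreover have "D ?w1 ^ M = 1" using Dpow[OF sw(1) cw1, of M] tor D1 by simp
    then have "D ?w1 \<noteq> 0" using z(4) by (auto simp: power_0_left)
    ultimately have "D z = 1" by simp
    moreover have "p * z = cscal c * p" using cp[of z] p(4) by simp
    ultimately have d1: "det (to_mat n (1 - p + cscal c * p)) = 1" by (simp add: D_def)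
    \<comment> \<open>On the image of \<open>p\<close> the element \<open>z\<close> is the scalar
      \<open>c\<close>, so its determinant there is \<open>c\<close> to the rank of
      \<open>p\<close>, a number between 1 and \<open>n\<close>.\<close>
    obtain m where "m \<le> n" "m = 0 \<longleftrightarrow> p = 0" "\<And>c. det (to_mat n (1 - p + cscal c * p)) = c ^ m"
      using idempotent_trace[OF p(1-3)] by metis
    then have "c ^ m = 1" "m dvd fact n" using d1 c(2) by (auto simp: p_def intro!: dvd_fact)
    then show ?thesis by (metis dvd_def power_mult power_one)
  qed simp
qed

section \<open>Words in a symmetric set\<close>

text \<open>The length is exact. In a set containing 1 the shorter words are included through
  padding by 1, see \<open>words_mono\<close>.\<close>

primrec words :: "'a::monoid_mult set \<Rightarrow> nat \<Rightarrow> 'a set" where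
  "words X 0 = {1}"
| "words X (Suc k) = {s * g | s g. s \<in> X \<and> g \<in> words X k}"

lemma words_Suc_image: "words X (Suc k) = (\<lambda>(s,g). s * g) ` (X \<times> words X k)"
  by auto

lemma finite_words [simp]: "finite X \<Longrightarrow> finite (words X k)"
  by (induction k) (auto simp: words_Suc_image simp del: words.simps(2))

lemma card_words_le:
  assumes "finite X"
  shows "card (words X k) \<le> card X ^ k"
proof (induction k)
  case (Suc k)
  have "card (words X (Suc k)) \<le> card (X \<times> words X k)"
    unfolding words_Suc_image using assms by (intro card_image_le) auto
  also have "\<dots> \<le> card X * card X ^ k" using Suc by (simp add: card_cartesian_product)
  finally show ?case by simp
qed simp

lemma words_mult: "g \<in> words X k \<Longrightarrow> h \<in> words X l \<Longrightarrow> g * h \<in> words X (k + l)"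
proof (induction k arbitrary: g)
  case (Suc k)
  then obtain s g' where "g = s * g'" "s \<in> X" "g' \<in> words X k" by auto
  then show ?case using Suc.IH[of g'] Suc.prems(2) by (auto simp: mult.assoc)
qed simp

lemma words_power: "g \<in> words X k \<Longrightarrow> g ^ q \<in> words X (q * k)"
  by (induction q) (auto intro: words_mult)

lemma words_letter: "x \<in> X \<Longrightarrow> x \<in> words X 1"
  by force

lemma words_commute:
  "\<forall>s\<in>X. y * s = s * y \<Longrightarrow> g \<in> words X k \<Longrightarrow> y * g = g * y"
  by (induction k arbitrary: g) (auto intro: commute_mult)

lemma words_mono:
  assumes "1 \<in> X" "k \<le> l"
  shows "words X k \<subseteq> words X l"
proof -
  have "words X k \<subseteq> words X (Suc k)" for k
    using assms(1) by (force intro: exI[of _ 1])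
  then show ?thesis using lift_Suc_mono_le[of "words X"] assms(2) by blast
qed

lemma one_in_words: "1 \<in> X \<Longrightarrow> 1 \<in> words X k"
  using words_mono[of X 0 k] by simp

lemma words_words: "X' \<subseteq> words X m \<Longrightarrow> words X' k \<subseteq> words X (m * k)"
proof (induction k)
  case (Suc k)
  then show ?case by (auto intro!: words_mult)
qed simp

text \<open>The ring has no inverse operation; the value is meaningful only for two-sided
  units.\<close>

definition minv :: "'a::monoid_mult \<Rightarrow> 'a" where
  "minv g = (SOME h. g * h = 1 \<and> h * g = 1)"

lemma minv_eqI:
  assumes "g * h = 1" "h * g = 1"
  shows "minv g = h"
proof -
  have "g * minv g = 1" "minv g * g = 1"
    unfolding minv_def by (rule someI2[of _ h]; use assms in simp)+
  then show ?thesis using assms by (metis mult.assoc mult_1 mult.right_neutral)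
qed

definition sym_gens :: "nat \<Rightarrow> smat set \<Rightarrow> bool" where
  "sym_gens n X \<longleftrightarrow> finite X \<and> 1 \<in> X \<and> (\<forall>x\<in>X. supp_le n x \<and> scal x = 1) \<and>
     (\<forall>x\<in>X. \<exists>y\<in>X. x * y = 1 \<and> y * x = 1)"

lemma sym_gens_words:
  assumes "sym_gens n X" "g \<in> words X k"
  shows "supp_le n g" "scal g = 1"
proof -
  have "supp_le n g \<and> scal g = 1"
    using assms(2)
  proof (induction k arbitrary: g)
    case (Suc k)
    then obtain s h where sh: "g = s * h" "s \<in> X" "h \<in> words X k" by auto
    then show ?case using Suc.IH[of h] assms(1) by (auto simp: sym_gens_def scal_ent_mult(1))
  qed (simp add: smat_simps)
  then show "supp_le n g" "scal g = 1" by auto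
qed

lemma sym_gens_inverse:
  assumes "sym_gens n X" "g \<in> words X k"
  shows "minv g \<in> words X k" "g * minv g = 1" "minv g * g = 1"
proof -
  have "\<exists>h\<in>words X k. g * h = 1 \<and> h * g = 1"
    using assms(2)
  proof (induction k arbitrary: g)
    case (Suc k)
    then obtain s h where sh: "g = s * h" "s \<in> X" "h \<in> words X k" by auto
    obtain s' where s': "s' \<in> X" "s * s' = 1" "s' * s = 1" using assms(1) sh(2) by (auto simp: sym_gens_def)
    obtain h' where h': "h' \<in> words X k" "h * h' = 1" "h' * h = 1" using Suc.IH[OF sh(3)] by blast
    have "h' * s' \<in> words X (k + 1)" by (intro words_mult h' words_letter s')
    moreover have "g * (h' * s') = s * (h * h') * s'" "h' * s' * g = h' * (s' * s) * h"
      by (simp_all add: sh mult.assoc)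
    ultimately show ?case using s' h' by auto
  qed simp
  then obtain h where "h \<in> words X k" "g * h = 1" "h * g = 1" by blast
  then show "minv g \<in> words X k" "g * minv g = 1" "minv g * g = 1" using minv_eqI by metis+
qed

lemma sym_gensD:
  assumes "sym_gens n X"
  shows "finite X" "1 \<in> X"
  using assms by (auto simp: sym_gens_def)

definition torsion :: "'a::monoid_mult set \<Rightarrow> bool" where
  "torsion A \<longleftrightarrow> (\<forall>g\<in>A. \<exists>M>0. g ^ M = 1)"

lemma torsion_mono: "torsion B \<Longrightarrow> A \<subseteq> B \<Longrightarrow> torsion A"
  by (auto simp: torsion_def)

text \<open>The exponent is the product of individual ones and depends on the set; it gives
  finiteness of orders but no uniform bound.\<close>

lemma torsion_common_exponent:
  assumes "finite A" "torsion A"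
  obtains M where "M > 0" "\<And>g. g \<in> A \<Longrightarrow> g ^ M = 1"
proof -
  obtain m where m: "\<And>g. g \<in> A \<Longrightarrow> m g > 0 \<and> g ^ m g = 1"
    using assms(2) unfolding torsion_def by metis
  have "g ^ (\<Prod>h\<in>A. m h) = 1" if "g \<in> A" for g
  proof -
    have "m g dvd (\<Prod>h\<in>A. m h)" using assms(1) that by (intro dvd_prodI) auto
    then show ?thesis using m[OF that] by (metis dvd_def power_mult power_one)
  qed
  moreover have "(\<Prod>h\<in>A. m h) > 0" using m by (intro prod_pos) auto
  ultimately show thesis using that by blast
qed

text \<open>As long as the images keep growing, each step adds an element, so a stall occurs within
  the ball in which the images have been counted. At the stall, words of length \<open>j + 1\<close>
  take no new value.\<close>

lemma image_words_stall:
  assumes "finite X" "1 \<in> X" "card (f ` words X (Suc J)) \<le> J"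
  obtains j where "j \<le> J" "f ` words X (Suc j) \<subseteq> f ` words X j"
proof (rule ccontr)
  assume "\<not> thesis"
  then have neq: "\<And>j. j \<le> J \<Longrightarrow> \<not> f ` words X (Suc j) \<subseteq> f ` words X j" using that by blast
  have "j < card (f ` words X j)" if "j \<le> Suc J" for j
    using that
  proof (induction j)
    case (Suc j)
    have "f ` words X j \<subseteq> f ` words X (Suc j)"
      by (rule image_mono, rule words_mono[OF assms(2)]) simp
    moreover have "\<not> f ` words X (Suc j) \<subseteq> f ` words X j" by (rule neq) (use Suc.prems in linarith)
    ultimately have "f ` words X j \<subset> f ` words X (Suc j)" by (rule psubsetI[OF _ contrapos_nn[OF _ equalityD2]])
    then have "card (f ` words X j) < card (f ` words X (Suc j))"
      by (rule psubset_card_mono[rotated]) (rule finite_imageI, rule finite_words, rule assms(1))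
    moreover have "j < card (f ` words X j)" by (rule Suc.IH) (use Suc.prems in linarith)
    ultimately show ?case by linarith
  qed simp
  from this[of "Suc J"] show False using assms(3) by linarith
qed

text \<open>Powers of a new generator \<open>x\<close> can be collected in front of a word and
  reduced modulo \<open>M\<close>.\<close>

lemma finite_words_commuting:
  fixes X :: "'a::monoid_mult set"
  assumes "finite X" "M > 0" "\<And>x. x \<in> X \<Longrightarrow> x ^ M = 1" "\<And>x y. x \<in> X \<Longrightarrow> y \<in> X \<Longrightarrow> x * y = y * x"
  shows "finite (\<Union>k. words X k)"
  using assms(1,3,4)
proof (induction X rule: finite_induct)
  case empty
  have "words {} k \<subseteq> {1}" for k :: nat by (cases k) auto
  then have "(\<Union>k. words {} k) \<subseteq> {1::'a}" by blast
  then show ?case by (rule finite_subset) simp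
next
  case (insert x X)
  have IH: "finite (\<Union>k. words X k)" using insert by blast
  let ?f = "\<lambda>(i,g). x ^ i * g"
  have "words (insert x X) k \<subseteq> ?f ` ({..<M} \<times> (\<Union>k. words X k))" for k
  proof (induction k)
    case 0
    have "?f (0, 1) \<in> ?f ` ({..<M} \<times> (\<Union>k. words X k))"
      using assms(2) by (intro imageI) (auto intro: exI[of _ 0])
    then show ?case by simp
  next
    case (Suc k)
    show ?case
    proof
      fix w assume "w \<in> words (insert x X) (Suc k)"
      then obtain s g where w: "w = s * g" "s \<in> insert x X" "g \<in> words (insert x X) k" by auto
      then obtain i h l where g: "g = x ^ i * h" "i < M" "h \<in> words X l" using Suc by auto
      show "w \<in> ?f ` ({..<M} \<times> (\<Union>k. words X k))"
      proof (cases "s = x")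
        case True
        have "x ^ (Suc i mod M) = x ^ Suc i"
          using insert.prems(1)[of x] g(2) by (cases "Suc i = M") auto
        then have "w = ?f (Suc i mod M, h)" using w g True by (simp add: mult.assoc)
        then show ?thesis using g assms(2) by force
      next
        case False
        then have s: "s \<in> X" using w by simp
        have "s * x ^ i = x ^ i * s" by (rule commute_power) (use insert.prems(2) s in auto)
        then have "w = ?f (i, s * h)" using w g by (simp add: mult.assoc[symmetric])
        moreover have "s * h \<in> words X (Suc l)" using s g by auto
        ultimately show ?thesis using g by blast
      qed
    qed
  qed
  then have "(\<Union>k. words (insert x X) k) \<subseteq> ?f ` ({..<M} \<times> (\<Union>k. words X k))" by blast
  then show ?case by (rule finite_subset) (intro finite_imageI finite_cartesian_product finite_lessThan IH)
qed

text \<open>If the words of length \<open>j\<close> contain a transversal of the centralizer of \<open>Y\<close>, then the Schreier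
  generators \<open>t'\<^sup>-\<^sup>1 s t\<close> of the latter have length at most \<open>2 j + 1\<close>.\<close>

definition schreier :: "smat set \<Rightarrow> nat \<Rightarrow> smat set \<Rightarrow> smat set" where
  "schreier X j Y = {h \<in> words X (2 * j + 1). \<forall>y\<in>Y. h * y = y * h}"

lemma sym_gens_schreier:
  assumes "sym_gens n X"
  shows "sym_gens n (schreier X j Y)"
  unfolding sym_gens_def
proof (intro conjI ballI)
  note X = sym_gensD[OF assms]
  show "finite (schreier X j Y)"
    by (rule finite_subset[of _ "words X (2 * j + 1)"]) (use X in \<open>auto simp: schreier_def simp del: words.simps\<close>)
  show "1 \<in> schreier X j Y"
    using one_in_words[OF X(2)] by (auto simp: schreier_def simp del: words.simps)
  fix x assume x: "x \<in> schreier X j Y"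
  then have xw: "x \<in> words X (2 * j + 1)" by (simp add: schreier_def)
  show "supp_le n x" "scal x = 1" using sym_gens_words[OF assms xw] by auto
  note i = sym_gens_inverse[OF assms xw]
  have "minv x * y = y * minv x" if "y \<in> Y" for y
  proof -
    have "x * y = y * x" using x that by (simp add: schreier_def)
    then have "minv x * (x * y) * minv x = minv x * (y * x) * minv x" by simp
    then have "(minv x * x) * y * minv x = minv x * y * (x * minv x)" by (simp only: mult.assoc)
    then show ?thesis using i by simp
  qed
  then have "minv x \<in> schreier X j Y" using i by (simp add: schreier_def)
  then show "\<exists>y\<in>schreier X j Y. x * y = 1 \<and> y * x = 1" using i by blast
qed

text \<open>Each letter \<open>s\<close> in front of \<open>t * h\<close> is absorbed by rewriting
  \<open>s * t\<close> as \<open>t' * h'\<close>, so the transversal part keeps length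
  \<open>j\<close> for words of any length.\<close>

lemma words_schreier:
  assumes "1 \<in> X"
    and "\<And>g. g \<in> words X (Suc j) \<Longrightarrow> \<exists>t\<in>words X j. \<exists>h\<in>schreier X j Y. g = t * h"
  shows "words X k \<subseteq> {t * h | t h. t \<in> words X j \<and> h \<in> words (schreier X j Y) k}"
proof (induction k)
  case 0
  then show ?case using one_in_words[OF assms(1), of j] by (auto intro!: exI[of _ 1])
next
  case (Suc k)
  show ?case
  proof
    fix w assume "w \<in> words X (Suc k)"
    then obtain s g where w: "w = s * g" "s \<in> X" "g \<in> words X k" by auto
    then obtain t h where g: "g = t * h" "t \<in> words X j" "h \<in> words (schreier X j Y) k" using Suc by blast
    have "s * t \<in> words X (Suc j)" using w g by auto
    then obtain t' h' where t': "t' \<in> words X j" "h' \<in> schreier X j Y" "s * t = t' * h'" using assms(2) by blast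
    have "w = t' * (h' * h)" using w g t' by (metis mult.assoc)
    moreover have "h' * h \<in> words (schreier X j Y) (Suc k)" using t' g by auto
    ultimately show "w \<in> {t * h | t h. t \<in> words X j \<and> h \<in> words (schreier X j Y) (Suc k)}"
      using t' by blast
  qed
qed

lemma finite_words_schreier:
  assumes "finite X" "1 \<in> X"
    and "\<And>g. g \<in> words X (Suc j) \<Longrightarrow> \<exists>t\<in>words X j. \<exists>h\<in>schreier X j Y. g = t * h"
    and "finite (\<Union>k. words (schreier X j Y) k)"
  shows "finite (\<Union>k. words X k)"
proof (rule finite_subset)
  show "(\<Union>k. words X k) \<subseteq> (\<lambda>(t,h). t * h) ` (words X j \<times> (\<Union>k. words (schreier X j Y) k))"
  proof
    fix w assume "w \<in> (\<Union>k. words X k)"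
    then obtain k where "w \<in> words X k" by blast
    from subsetD[OF words_schreier[OF assms(2,3)] this] obtain t h where
      "w = t * h" "t \<in> words X j" "h \<in> words (schreier X j Y) k" by blast
    then show "w \<in> (\<lambda>(t,h). t * h) ` (words X j \<times> (\<Union>k. words (schreier X j Y) k))" by force
  qed
  show "finite ((\<lambda>(t,h). t * h) ` (words X j \<times> (\<Union>k. words (schreier X j Y) k)))"
    using assms(1,4) by (intro finite_imageI finite_cartesian_product) auto
qed

text \<open>Two elements conjugating \<open>Y\<close> in the same way differ by the centralizer;
  \<open>minv t * g\<close> has length \<open>j + (j + 1)\<close>.\<close>

lemma conj_eq_imp_coset:
  assumes X: "sym_gens n X" and g: "g \<in> words X (Suc j)" and t: "t \<in> words X j"
    and eq: "\<And>y. y \<in> Y \<Longrightarrow> g * y * minv g = t * y * minv t"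
  shows "\<exists>h\<in>schreier X j Y. g = t * h"
proof -
  note gi = sym_gens_inverse[OF X g] and ti = sym_gens_inverse[OF X t]
  let ?h = "minv t * g"
  have "j + Suc j = 2 * j + 1" by simp
  then have "?h \<in> words X (2 * j + 1)" using words_mult[OF ti(1) g] by metis
  moreover have "?h * y = y * ?h" if "y \<in> Y" for y
  proof -
    have "minv t * (g * y * minv g) * g = minv t * (t * y * minv t) * g" using eq[OF that] by simp
    then have "minv t * g * y * (minv g * g) = (minv t * t) * y * (minv t * g)" by (simp only: mult.assoc)
    then show ?thesis using gi ti by simp
  qed
  ultimately have "?h \<in> schreier X j Y" by (simp add: schreier_def)
  moreover have "g = t * ?h" using ti by (simp add: mult.assoc[symmetric])
  ultimately show ?thesis by blast
qed

text \<open>The conjugates of \<open>a\<close> share its eigenvalues, as \<open>minv g\<close>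
  carries eigenmatrices of a conjugate to eigenmatrices of \<open>a\<close>. If they commute there
  are at most \<open>n ^ n\<close> of them, and conjugates correspond to cosets of the
  centralizer.\<close>

lemma centralizer_index:
  assumes X: "sym_gens n X" and n: "n > 0"
    and a: "supp_le n a" "scal a = 1" "a ^ M = 1" "M > 0"
    and comm: "\<And>g h. g \<in> words X (Suc (n ^ n)) \<Longrightarrow> h \<in> words X (Suc (n ^ n)) \<Longrightarrow>
       (g * a * minv g) * (h * a * minv h) = (h * a * minv h) * (g * a * minv g)"
  obtains j where "j \<le> n ^ n"
    "\<And>g. g \<in> words X (Suc j) \<Longrightarrow> \<exists>t\<in>words X j. \<exists>h\<in>schreier X j {a}. g = t * h"
proof -
  note X' = sym_gensD[OF X]
  let ?f = "\<lambda>g. g * a * minv g"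
  let ?W = "words X (Suc (n ^ n))"
  obtain A where A: "finite A" "card A \<le> n"
    "\<And>E c. supp_le n E \<Longrightarrow> scal E = 0 \<Longrightarrow> E \<noteq> 0 \<Longrightarrow> a * E = cscal c * E \<Longrightarrow> c \<in> A"
    using finite_eigenvalues[OF a(1)] by metis
  have "card (?f ` ?W) \<le> n ^ n"
  proof (rule card_commuting_bound[OF _ n a(4) _ _ A(1,2)])
    show "finite (?f ` ?W)" using X' by (intro finite_imageI finite_words)
    show "supp_le n c \<and> scal c = 1 \<and> c ^ M = 1" if c: "c \<in> ?f ` ?W" for c
    proof -
      obtain g where g: "c = ?f g" "g \<in> ?W" using c by blast
      note gi = sym_gens_inverse[OF X g(2)]
      show ?thesis
        using g(1) a gi conj_power[OF gi(3,2), of a M] sym_gens_words[OF X g(2)] sym_gens_words[OF X gi(1)]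
        by (simp add: scal_ent_mult(1))
    qed
    show "c * d = d * c" if "c \<in> ?f ` ?W" "d \<in> ?f ` ?W" for c d using that comm by blast
    show "b \<in> A" if E: "c \<in> ?f ` ?W" "supp_le n E" "scal E = 0" "E \<noteq> 0" "c * E = cscal b * E" for c E b
    proof -
      obtain g where g: "c = ?f g" "g \<in> ?W" using E(1) by blast
      note gi = sym_gens_inverse[OF X g(2)]
      have "minv g * (c * E) = (minv g * g) * (a * (minv g * E))" by (simp add: g mult.assoc)
      then have "a * (minv g * E) = cscal b * (minv g * E)"
        unfolding E(5) gi(3) cscal_left_commute[of "minv g"] by simp
      moreover have "minv g * E \<noteq> 0"
      proof
        assume "minv g * E = 0"
        then have "g * (minv g * E) = 0" by simp
        then show False using gi E(4) by (simp add: mult.assoc[symmetric])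
      qed
      ultimately show ?thesis
        using sym_gens_words[OF X gi(1)] E by (intro A(3)[of "minv g * E"]) (auto simp: scal_ent_mult(1))
    qed
  qed
  from image_words_stall[OF X' this] obtain j where j: "j \<le> n ^ n" "?f ` words X (Suc j) \<subseteq> ?f ` words X j"
    by metis
  show thesis
  proof (rule that[OF j(1)])
    fix g assume g: "g \<in> words X (Suc j)"
    then obtain t where t: "t \<in> words X j" "?f g = ?f t" using j(2) by blast
    then show "\<exists>t\<in>words X j. \<exists>h\<in>schreier X j {a}. g = t * h"
      using conj_eq_imp_coset[OF X g t(1), of "{a}"] by blast
  qed
qed

section \<open>Maximal minors of the trace form on words\<close>

lemma adj_mat_sum:
  fixes A :: "'a::comm_ring_1 mat"
  assumes "A \<in> carrier_mat d d" "k < d" "j < d"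
  shows "(\<Sum>i<d. adj_mat A $$ (k,i) * A $$ (i,j)) = (if k = j then det A else 0)"
proof -
  have "(adj_mat A * A) $$ (k,j) = (\<Sum>i<d. adj_mat A $$ (k,i) * A $$ (i,j))"
    using assms adj_mat(1)[OF assms(1)] by (simp add: scalar_prod_def atLeast0LessThan)
  then show ?thesis using assms adj_mat(3)[OF assms(1)] by (cases "k = j") auto
qed

text \<open>The Schur complement of \<open>A\<close> vanishes. By Cramer's rule the first
  \<open>d\<close> rows express a kernel vector through its last coordinate, which is nonzero
  because \<open>A\<close> is invertible; the last row is then the claim.\<close>

lemma bordered_minor_zero:
  fixes g :: "nat \<Rightarrow> nat \<Rightarrow> complex" and d :: nat
  defines "A \<equiv> mat d d (\<lambda>(i,j). g i j)"
  assumes "det A \<noteq> 0" and "det (mat (Suc d) (Suc d) (\<lambda>(i,j). g i j)) = 0"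
  shows "det A * g d d = (\<Sum>i<d. \<Sum>j<d. g d i * adj_mat A $$ (i,j) * g j d)"
proof -
  let ?B = "mat (Suc d) (Suc d) (\<lambda>(i,j). g i j)"
  have A: "A \<in> carrier_mat d d" by (simp add: A_def)
  obtain v where v: "v \<in> carrier_vec (Suc d)" "v \<noteq> 0\<^sub>v (Suc d)" "?B *\<^sub>v v = 0\<^sub>v (Suc d)"
    using assms(3) det_0_iff_vec_prod_zero[of ?B "Suc d"] by auto
  have row: "(\<Sum>j<d. g i j * v $ j) + g i d * v $ d = 0" if "i \<le> d" for i
  proof -
    have "(?B *\<^sub>v v) $ i = (\<Sum>j<Suc d. g i j * v $ j)"
      using that v(1) by (simp add: scalar_prod_def atLeast0LessThan del: sum.lessThan_Suc)
    then show ?thesis using v(3) that by simp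
  qed
  have sol: "det A * v $ k = - (v $ d * (\<Sum>i<d. adj_mat A $$ (k,i) * g i d))" if "k < d" for k
  proof -
    have "det A * v $ k = (\<Sum>j<d. (\<Sum>i<d. adj_mat A $$ (k,i) * A $$ (i,j)) * v $ j)"
      using that by (simp add: adj_mat_sum[OF A that] if_distrib[of "\<lambda>z. z * _"] cong: if_cong)
    also have "\<dots> = (\<Sum>i<d. adj_mat A $$ (k,i) * (\<Sum>j<d. g i j * v $ j))"
      unfolding sum_distrib_left sum_distrib_right
      by (subst sum.swap) (auto simp: A_def mult.assoc intro!: sum.cong)
    also have "\<dots> = (\<Sum>i<d. adj_mat A $$ (k,i) * (- (g i d * v $ d)))"
      using row by (intro sum.cong refl) (simp add: add_eq_0_iff2)
    also have "\<dots> = - (v $ d * (\<Sum>i<d. adj_mat A $$ (k,i) * g i d))"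
      by (simp add: sum_distrib_left sum_negf mult_ac)
    finally show ?thesis .
  qed
  have "v $ d \<noteq> 0"
  proof
    assume "v $ d = 0"
    then have "v $ k = 0" if "k \<le> d" for k
      using sol[of k] assms(2) that by (cases "k = d") auto
    then have "v = 0\<^sub>v (Suc d)" using v(1) by (intro eq_vecI) auto
    then show False using v(2) by simp
  qed
  moreover have "v $ d * (det A * g d d) = v $ d * (\<Sum>i<d. \<Sum>j<d. g d i * adj_mat A $$ (i,j) * g j d)"
  proof -
    have "det A * (g d d * v $ d) = - (\<Sum>k<d. g d k * (det A * v $ k))"
      using row[of d] by (simp add: add_eq_0_iff mult_ac flip: sum_distrib_left)
    also have "(\<Sum>k<d. g d k * (det A * v $ k)) = (\<Sum>k<d. - (v $ d * (\<Sum>i<d. g d k * adj_mat A $$ (k,i) * g i d)))"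
      by (intro sum.cong refl) (simp add: sol sum_distrib_left mult_ac)
    finally show ?thesis by (simp add: sum_negf sum_distrib_left mult_ac)
  qed
  ultimately show ?thesis by simp
qed

section \<open>Frames of short words\<close>

definition gram :: "nat \<Rightarrow> nat \<Rightarrow> (nat \<Rightarrow> smat) \<Rightarrow> (nat \<Rightarrow> smat) \<Rightarrow> complex mat" where
  "gram n d x y = mat d d (\<lambda>(i,j). tr n (x i * y j))"

text \<open>The last clause says that the trace form has no larger rank on words of length
  \<open>k + W\<close>: such words are known to the form through their traces against
  \<open>x\<close> and \<open>y\<close>. The slack \<open>W\<close> leaves room to multiply
  \<open>x i\<close> and \<open>y j\<close> by a word of length \<open>W\<close>.\<close>

definition frame :: "nat \<Rightarrow> smat set \<Rightarrow> nat \<Rightarrow> nat \<Rightarrow> nat \<Rightarrow> (nat \<Rightarrow> smat) \<Rightarrow> (nat \<Rightarrow> smat) \<Rightarrow> bool" where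
  "frame n X k W d x y \<longleftrightarrow> (\<forall>i<d. x i \<in> words X k \<and> y i \<in> words X k) \<and> det (gram n d x y) \<noteq> 0 \<and>
     (\<forall>u\<in>words X (k + W). \<forall>v\<in>words X (k + W). det (gram n d x y) * tr n (u * v) =
        (\<Sum>i<d. \<Sum>j<d. tr n (u * y i) * adj_mat (gram n d x y) $$ (i,j) * tr n (x j * v)))"

text \<open>The size of a maximal nonzero minor of the trace form on words of length \<open>i * W\<close> is at
  most \<open>n\<^sup>2\<close>, hence it stays the same in one of the first \<open>n\<^sup>2 + 1\<close> steps.\<close>

lemma frame_exists:
  assumes X: "sym_gens n X"
  obtains k d x y where "k \<le> n * n * W" "d \<le> n * n" "frame n X k W d x y"
proof -
  define P where "P = (\<lambda>k d. \<exists>x y. (\<forall>i<d. x i \<in> words X k \<and> y i \<in> words X k) \<and> det (gram n d x y) \<noteq> 0)"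
  have le: "d \<le> n * n" if P: "P k d" for k d
  proof -
    obtain x y where "\<And>i. i < d \<Longrightarrow> x i \<in> words X k" "\<And>i. i < d \<Longrightarrow> y i \<in> words X k"
      "det (gram n d x y) \<noteq> 0" using P unfolding P_def by blast
    then show ?thesis using trace_form_minor[of d n x y] sym_gens_words(1)[OF X] unfolding gram_def by blast
  qed
  have P0: "P k 0" for k by (auto simp: P_def gram_def)
  define m where "m = (\<lambda>i. Max {d. P (i * W) d})"
  have fin: "finite {d. P k d}" for k
    by (rule finite_subset[of _ "{..n * n}"]) (use le in auto)
  have Pm: "P (i * W) (m i)" and mle: "m i \<le> n * n" and mmax: "P (i * W) d \<Longrightarrow> d \<le> m i" for i d
  proof -
    show "P (i * W) (m i)" using Max_in[OF fin, of "i * W"] P0 unfolding m_def by auto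
    then show "m i \<le> n * n" by (rule le)
    show "P (i * W) d \<Longrightarrow> d \<le> m i" unfolding m_def using fin by (intro Max_ge) auto
  qed
  have mono: "m i \<le> m (Suc i)" for i
  proof (rule mmax)
    have "words X (i * W) \<subseteq> words X (Suc i * W)"
      using sym_gensD[OF X] by (intro words_mono) auto
    then show "P (Suc i * W) (m i)" using Pm[of i] unfolding P_def by blast
  qed
  have "\<exists>i\<le>n * n. m (Suc i) = m i"
  proof (rule ccontr)
    assume neg: "\<not> ?thesis"
    have "i \<le> m i" if "i \<le> Suc (n * n)" for i
      using that
    proof (induction i)
      case (Suc i)
      then have "m (Suc i) \<noteq> m i" using neg by auto
      then show ?case using mono[of i] Suc by simp
    qed simp
    from this[of "Suc (n * n)"] show False using mle[of "Suc (n * n)"] by simp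
  qed
  then obtain i where i: "i \<le> n * n" "m (Suc i) = m i" by blast
  define k d where "k = i * W" and "d = m i"
  obtain x y where xy: "\<And>i. i < d \<Longrightarrow> x i \<in> words X k \<and> y i \<in> words X k" "det (gram n d x y) \<noteq> 0"
    using Pm[of i] unfolding P_def k_def d_def by blast
  have sub: "words X k \<subseteq> words X (k + W)" using sym_gensD[OF X] by (intro words_mono) auto
  have "det (gram n d x y) * tr n (u * v) =
        (\<Sum>i<d. \<Sum>j<d. tr n (u * y i) * adj_mat (gram n d x y) $$ (i,j) * tr n (x j * v))"
    if uv: "u \<in> words X (k + W)" "v \<in> words X (k + W)" for u v
  proof -
    \<comment> \<open>Appending \<open>u\<close> and \<open>v\<close> gives a minor of size
      \<open>d + 1\<close> on words of length \<open>Suc i * W\<close>, which vanishes because the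
      maximal size does not change from \<open>i\<close> to \<open>Suc i\<close>.\<close>
    define x' y' where "x' = x(d := u)" and "y' = y(d := v)"
    define g where "g = (\<lambda>i j. tr n (x' i * y' j))"
    have A: "mat d d (\<lambda>(i,j). g i j) = gram n d x y"
      by (rule eq_matI) (auto simp: gram_def g_def x'_def y'_def)
    have B: "mat (Suc d) (Suc d) (\<lambda>(i,j). g i j) = gram n (Suc d) x' y'"
      by (simp add: gram_def g_def)
    have "det (gram n (Suc d) x' y') = 0"
    proof (rule ccontr)
      assume "det (gram n (Suc d) x' y') \<noteq> 0"
      moreover have "x' i \<in> words X (Suc i' * W) \<and> y' i \<in> words X (Suc i' * W)"
        if "i < Suc d" "i' * W = k" for i i'
        using xy(1)[of i] sub uv that by (auto simp: x'_def y'_def less_Suc_eq add.commute)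
      ultimately have "P (Suc i * W) (Suc d)" unfolding P_def k_def by blast
      then have "Suc d \<le> m (Suc i)" by (rule mmax)
      then show False using i(2) by (simp add: d_def)
    qed
    then have "det (gram n d x y) * g d d = (\<Sum>i<d. \<Sum>j<d. g d i * adj_mat (gram n d x y) $$ (i,j) * g j d)"
      using bordered_minor_zero[where g=g and d=d] xy(2) unfolding A B by blast
    then show ?thesis by (simp add: g_def x'_def y'_def)
  qed
  then have "frame n X k W d x y" unfolding frame_def using xy by blast
  moreover have "k \<le> n * n * W" "d \<le> n * n" using i(1) mle by (auto simp: k_def d_def)
  ultimately show thesis using that by blast
qed

lemma frame_formula:
  assumes "frame n X k W d x y" "u \<in> words X (k + W)" "v \<in> words X (k + W)"
  shows "det (gram n d x y) * tr n (u * v) =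
    (\<Sum>i<d. \<Sum>j<d. tr n (u * y i) * adj_mat (gram n d x y) $$ (i,j) * tr n (x j * v))"
  using assms unfolding frame_def by blast

lemma frameD:
  assumes "frame n X k W d x y"
  shows "i < d \<Longrightarrow> x i \<in> words X k" "i < d \<Longrightarrow> y i \<in> words X k" "det (gram n d x y) \<noteq> 0"
  using assms unfolding frame_def by auto

lemma gram_carrier [simp]: "gram n d x y \<in> carrier_mat d d"
  by (simp add: gram_def)

text \<open>The frame formula first turns equal coefficients into
  \<open>tr (w * y i) = tr (y i)\<close> and then into \<open>tr w = n\<close>; an element of finite
  order with this trace is 1.\<close>

lemma frame_faithful:
  assumes X: "sym_gens n X" and f: "frame n X k W d x y" and w: "w \<in> words X W"
    and eq: "\<And>i j. i < d \<Longrightarrow> j < d \<Longrightarrow> tr n (x i * w * y j) = tr n (x i * y j)"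
    and tor: "w ^ M = 1" "M > 0"
  shows "w = 1"
proof (rule torsion_tr_eq_n[OF _ _ tor])
  note F = frameD[OF f]
  let ?G = "gram n d x y"
  have one: "1 \<in> words X l" for l using one_in_words sym_gensD[OF X] by blast
  have wk: "w \<in> words X (k + W)" using words_mono[of X W "k + W"] sym_gensD[OF X] w by auto
  have 1: "tr n (w * y i) = tr n (y i)" if i: "i < d" for i
  proof -
    have wy: "w * y i \<in> words X (k + W)" using words_mult[OF w F(2)[OF i]] by (simp add: add.commute)
    have "det ?G * tr n (1 * (w * y i)) = (\<Sum>a<d. \<Sum>b<d. tr n (1 * y a) * adj_mat ?G $$ (a,b) * tr n (x b * (w * y i)))"
      by (rule frame_formula[OF f one wy])
    also have "\<dots> = (\<Sum>a<d. tr n (y a) * (\<Sum>b<d. adj_mat ?G $$ (a,b) * ?G $$ (b,i)))"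
      using eq i by (auto simp: gram_def mult.assoc sum_distrib_left intro!: sum.cong)
    also have "\<dots> = (\<Sum>a<d. if a = i then tr n (y i) * det ?G else 0)"
      using adj_mat_sum[OF gram_carrier] i by (intro sum.cong) auto
    also have "\<dots> = det ?G * tr n (y i)" using i by simp
    finally show ?thesis using F(3) by simp
  qed
  have "det ?G * tr n (w * 1) = (\<Sum>i<d. \<Sum>j<d. tr n (w * y i) * adj_mat ?G $$ (i,j) * tr n (x j * 1))"
    by (rule frame_formula[OF f wk one])
  also have "\<dots> = (\<Sum>i<d. \<Sum>j<d. tr n (1 * y i) * adj_mat ?G $$ (i,j) * tr n (x j * 1))"
    using 1 by simp
  also have "\<dots> = det ?G * tr n (1 * 1)"
    by (rule frame_formula[OF f one one, symmetric])
  finally show "tr n w = of_nat n" using F(3) by simp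
qed (use sym_gens_words[OF X w] in auto)

text \<open>Reduction to \<open>u * minv v\<close>: in the frame formula for
  \<open>(x i * u) * (minv v * y j)\<close>, only the first factor involves \<open>u\<close>, and
  its coefficients agree with those of \<open>v\<close>.\<close>

lemma frame_separates:
  assumes X: "sym_gens n X" and f: "frame n X k W d x y"
    and uv: "u \<in> words X l" "v \<in> words X l" "2 * l \<le> W"
    and eq: "\<And>i j. i < d \<Longrightarrow> j < d \<Longrightarrow> tr n (x i * u * y j) = tr n (x i * v * y j)"
    and tor: "torsion (words X W)"
  shows "u = v"
proof -
  note F = frameD[OF f] and vi = sym_gens_inverse[OF X uv(2)]
  let ?G = "gram n d x y" and ?v = "minv v"
  have mono: "words X (k + l) \<subseteq> words X (k + W)" "words X (l + l) \<subseteq> words X W"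
    by (intro words_mono; use sym_gensD[OF X] uv(3) in simp)+
  have uvw: "u * ?v \<in> words X W" using words_mult[OF uv(1) vi(1)] mono by blast
  obtain M where M: "M > 0" "(u * ?v) ^ M = 1" using tor uvw unfolding torsion_def by blast
  have "tr n (x i * (u * ?v) * y j) = tr n (x i * y j)" if ij: "i < d" "j < d" for i j
  proof -
    have xu: "x i * u \<in> words X (k + W)" "x i * v \<in> words X (k + W)"
      using words_mult[OF F(1)[OF ij(1)]] uv mono by blast+
    have vy: "?v * y j \<in> words X (k + W)"
      using words_mult[OF vi(1) F(2)[OF ij(2)]] mono by (auto simp: add.commute)
    have "det ?G * tr n (x i * u * (?v * y j)) =
        (\<Sum>a<d. \<Sum>b<d. tr n (x i * u * y a) * adj_mat ?G $$ (a,b) * tr n (x b * (?v * y j)))"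
      by (rule frame_formula[OF f xu(1) vy])
    also have "\<dots> = (\<Sum>a<d. \<Sum>b<d. tr n (x i * v * y a) * adj_mat ?G $$ (a,b) * tr n (x b * (?v * y j)))"
      using eq ij by simp
    also have "\<dots> = det ?G * tr n (x i * v * (?v * y j))"
      by (rule frame_formula[OF f xu(2) vy, symmetric])
    also have "x i * v * (?v * y j) = x i * (v * ?v) * y j" by (simp only: mult.assoc)
    finally show ?thesis using F(3) vi by (simp add: mult.assoc)
  qed
  from frame_faithful[OF X f uvw this M(2,1)] have "u * ?v = 1" .
  then have "u * (?v * v) = v" by (simp add: mult.assoc[symmetric])
  then show ?thesis using vi by simp
qed

section \<open>Conjugates of roots of unity\<close>

definition ev :: "int poly \<Rightarrow> complex \<Rightarrow> complex" where
  "ev P z = poly (map_poly of_int P) z"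

lemma ev_simps [simp]:
  "ev 0 z = 0" "ev 1 z = 1" "ev (P + Q) z = ev P z + ev Q z" "ev (P - Q) z = ev P z - ev Q z"
  "ev (- P) z = - ev P z" "ev (P * Q) z = ev P z * ev Q z" "ev (monom c k) z = of_int c * z ^ k"
  "ev (smult c P) z = of_int c * ev P z" "ev (P ^ k) z = ev P z ^ k"
  by (simp_all add: ev_def hom_distribs poly_monom)

lemma ev_sum: "ev (\<Sum>i\<in>I. f i) z = (\<Sum>i\<in>I. ev (f i) z)"
  by (induction I rule: infinite_finite_induct) auto

lemma comm_ring_hom_ev: "comm_ring_hom (\<lambda>P. ev P z)"
  by unfold_locales auto

lemma ev_eq_sum:
  assumes "degree P < d"
  shows "ev P z = (\<Sum>j<d. of_int (coeff P j) * z ^ j)"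
proof -
  have "ev P z = (\<Sum>j\<le>degree P. of_int (coeff P j) * z ^ j)"
    by (simp add: ev_def poly_altdef)
  also have "\<dots> = (\<Sum>j<d. of_int (coeff P j) * z ^ j)"
    using assms by (intro sum.mono_neutral_left) (auto simp: coeff_eq_0)
  finally show ?thesis .
qed

lemma ev_dvd: "P dvd Q \<Longrightarrow> ev P z = 0 \<Longrightarrow> ev Q z = 0"
  by (auto elim!: dvdE)

text \<open>This is the primitive minimal polynomial of \<open>z\<close>. The remainder of a
  pseudo-division by it vanishes at \<open>z\<close> and has smaller degree, so divisibility holds
  up to a nonzero integer factor.\<close>

lemma minimal_ev_poly:
  assumes "Q \<noteq> 0" "ev Q z = 0"
  obtains F where "F \<noteq> 0" "ev F z = 0" "content F = 1" "degree F > 0"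
    "\<And>P. P \<noteq> 0 \<Longrightarrow> ev P z = 0 \<Longrightarrow> degree F \<le> degree P"
    "\<And>P. ev P z = 0 \<Longrightarrow> \<exists>c q. c \<noteq> 0 \<and> smult c P = F * q"
proof -
  obtain F0 where F0: "F0 \<noteq> 0" "ev F0 z = 0" and
    min: "\<And>P. P \<noteq> 0 \<Longrightarrow> ev P z = 0 \<Longrightarrow> degree F0 \<le> degree P"
    using ex_has_least_nat[of "\<lambda>F. F \<noteq> 0 \<and> ev F z = 0" Q degree] assms by blast
  define F where "F = primitive_part F0"
  have F0F: "F0 = smult (content F0) F" by (simp add: F_def)
  have F: "F \<noteq> 0" "content F = 1" "degree F = degree F0"
    using F0(1) by (simp_all add: F_def)
  have evF: "ev F z = 0" using F0 F0F by (metis content_eq_zero_iff ev_simps(8) mult_eq_0_iff of_int_eq_0_iff)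
  have degF: "degree F > 0"
  proof (rule ccontr)
    assume "\<not> ?thesis"
    then obtain c where "F = [:c:]" by (metis degree_eq_zeroE not_gr_zero)
    then show False using evF F(1) by (simp add: ev_def)
  qed
  have "\<exists>c q. c \<noteq> 0 \<and> smult c P = F * q" if "ev P z = 0" for P
  proof -
    obtain q r where qr: "pseudo_divmod P F = (q, r)" by fastforce
    from pseudo_divmod[OF F(1) qr] obtain c where *: "c \<noteq> 0" "smult c P = F * q + r" "r = 0 \<or> degree r < degree F"
      using F(1) by (metis leading_coeff_0_iff power_not_zero)
    have "ev r z = 0" using arg_cong[OF *(2), of "\<lambda>p. ev p z"] that evF by simp
    then have "r = 0" using min[of r] *(3) F(3) by fastforce
    then show ?thesis using * by auto
  qed
  then show thesis using that[of F] F evF degF min by simp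
qed

text \<open>With leading coefficient 1 or -1, the factor \<open>c\<close> of the pseudo-division
  squares to 1 and can be moved to the other side.\<close>

lemma int_poly_division:
  fixes F P :: "int poly"
  assumes "\<bar>lead_coeff F\<bar> = 1" "degree F > 0"
  shows "\<exists>Q R. P = F * Q + R \<and> degree R < degree F"
proof -
  obtain q r where qr: "pseudo_divmod P F = (q, r)" by fastforce
  have F0: "F \<noteq> 0" using assms by auto
  define c where "c = lead_coeff F ^ (Suc (degree P) - degree F)"
  have cc: "c * c = 1"
    using assms(1) unfolding c_def by (simp flip: power_mult_distrib) (metis abs_mult_self_eq mult_1 power_one)
  from pseudo_divmod[OF F0 qr] have *: "smult c P = F * q + r" "r = 0 \<or> degree r < degree F"
    unfolding c_def by auto
  have "P = smult c (smult c P)" by (simp add: cc)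
  also have "\<dots> = F * smult c q + smult c r" unfolding * by (simp add: smult_add_right)
  finally show ?thesis
    using * assms(2) by (intro exI[of _ "smult c q"] exI[of _ "smult c r"])
      (auto intro: le_less_trans[OF degree_smult_le])
qed

section \<open>Integrality of norms\<close>

lemma det_vandermonde_nonzero:
  fixes h :: "nat \<Rightarrow> complex"
  assumes "inj_on h {..<d}"
  shows "det (mat d d (\<lambda>(k,j). h k ^ j)) \<noteq> 0"
proof
  let ?V = "mat d d (\<lambda>(k,j). h k ^ j)"
  assume "det ?V = 0"
  then obtain w where w: "w \<in> carrier_vec d" "w \<noteq> 0\<^sub>v d" "?V *\<^sub>v w = 0\<^sub>v d"
    using det_0_iff_vec_prod_zero[of ?V d] by auto
  define p where "p = (\<Sum>j<d. monom (w $ j) j)"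
  have cp: "coeff p j = (if j < d then w $ j else 0)" for j
    by (simp add: p_def coeff_sum)
  have "poly p (h k) = 0" if "k < d" for k
  proof -
    have "(?V *\<^sub>v w) $ k = (\<Sum>j<d. h k ^ j * w $ j)"
      using that w(1) by (simp add: scalar_prod_def atLeast0LessThan)
    then show ?thesis using w(3) that by (simp add: p_def poly_sum poly_monom mult.commute)
  qed
  then have sub: "h ` {..<d} \<subseteq> {z. poly p z = 0}" by auto
  have "p \<noteq> 0"
  proof
    assume "p = 0"
    then have "w $ j = 0" if "j < d" for j using cp[of j] that by simp
    then have "w = 0\<^sub>v d" using w(1) by (intro eq_vecI) auto
    then show False using w(2) by simp
  qed
  then obtain j where "coeff p j \<noteq> 0" by (metis leading_coeff_0_iff)
  then have "d > 0" using cp by (metis not_less_zero gr0I)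
  then have "degree p < d" using cp by (intro degree_lessI) auto
  moreover have "card (h ` {..<d}) \<le> card {z. poly p z = 0}"
    using \<open>p \<noteq> 0\<close> by (intro card_mono sub poly_roots_finite)
  moreover have "card {z. poly p z = 0} \<le> degree p" using \<open>p \<noteq> 0\<close> by (rule poly_roots_degree)
  ultimately show False using assms by (simp add: card_image)
qed

text \<open>The product of the values at all conjugates is the determinant of the multiplication
  on \<open>\<int>[x]/(F)\<close>, as the Vandermonde matrix diagonalizes the latter.\<close>

lemma norm_is_int:
  fixes F P :: "int poly"
  assumes F: "\<bar>lead_coeff F\<bar> = 1" "degree F > 0" and card: "card {z. ev F z = 0} = degree F"
  shows "(\<Prod>z | ev F z = 0. ev P z) \<in> \<int>"
proof -
  define d where "d = degree F"
  have fin: "finite {z. ev F z = 0}" using card F(2) by (metis card.infinite less_irrefl)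
  obtain h where h: "bij_betw h {..<d} {z. ev F z = 0}"
    using ex_bij_betw_nat_finite[OF fin] by (auto simp: card d_def atLeast0LessThan)
  have "\<forall>i. \<exists>Q R. monom 1 i * P = F * Q + R \<and> degree R < d"
    using int_poly_division[OF F] unfolding d_def by blast
  then obtain Q R where R: "\<And>i. monom 1 i * P = F * Q i + R i" "\<And>i. degree (R i) < d" by metis
  have evR: "ev (R i) z = z ^ i * ev P z" if "ev F z = 0" for i z
    using arg_cong[OF R(1)[of i], of "\<lambda>p. ev p z"] that by simp
  \<comment> \<open>Column \<open>i\<close> of \<open>A\<close> holds the coefficients of
    \<open>monom 1 i * P\<close> reduced modulo \<open>F\<close>; evaluation at the roots gives
    \<open>V * A = D * V\<close>.\<close>
  define A where "A = mat d d (\<lambda>(j,i). coeff (R i) j)"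
  define V where "V = mat d d (\<lambda>(k,j). h k ^ j)"
  define D where "D = mat d d (\<lambda>(k,j). if k = j then ev P (h k) else 0)"
  have hz: "ev F (h k) = 0" if "k < d" for k using h that by (auto simp: bij_betw_def)
  have "V * map_mat of_int A = D * V"
  proof (rule eq_matI)
    fix k i assume "k < dim_row (D * V)" "i < dim_col (D * V)"
    then have ki: "k < d" "i < d" by (auto simp: D_def V_def)
    have "(V * map_mat of_int A) $$ (k,i) = (\<Sum>j<d. of_int (coeff (R i) j) * h k ^ j)"
      using ki by (simp add: V_def A_def scalar_prod_def atLeast0LessThan mult.commute)
    also have "\<dots> = h k ^ i * ev P (h k)" using ev_eq_sum[OF R(2)] evR[OF hz[OF ki(1)]] by simp
    also have "\<dots> = (\<Sum>j<d. (if k = j then ev P (h k) * h j ^ i else 0))" using ki by simp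
    also have "\<dots> = (D * V) $$ (k,i)"
      using ki by (simp add: V_def D_def scalar_prod_def atLeast0LessThan if_distrib[of "\<lambda>z. z * _"] cong: if_cong)
    finally show "(V * map_mat of_int A) $$ (k,i) = (D * V) $$ (k,i)" .
  qed (auto simp: V_def A_def D_def)
  moreover have c: "V \<in> carrier_mat d d" "D \<in> carrier_mat d d" "A \<in> carrier_mat d d"
    by (auto simp: V_def D_def A_def)
  ultimately have "det V * det (map_mat of_int A) = det D * det V"
    using det_mult[of V d "map_mat of_int A"] det_mult[of D d V] by auto
  moreover have "det V \<noteq> 0"
    unfolding V_def using h by (intro det_vandermonde_nonzero) (auto simp: bij_betw_def)
  ultimately have "det D = of_int (det A)" by simp
  then have detD: "det D \<in> \<int>" by simp
  have "upper_triangular D" by (auto simp: D_def)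
  then have "det D = prod_list (diag_mat D)" using det_upper_triangular c(2) by blast
  also have "\<dots> = (\<Prod>k<d. ev P (h k))"
    by (simp add: diag_mat_def D_def prod.list_conv_set_nth atLeast0LessThan)
  also have "\<dots> = (\<Prod>z | ev F z = 0. ev P z)" by (rule prod.reindex_bij_betw[OF h])
  finally show ?thesis using detD by simp
qed

text \<open>\<open>S\<close> is the root set of the minimal polynomial \<open>F\<close> of a
  primitive root of unity \<open>\<zeta>\<close>. The product over \<open>S\<close> is the modulus
  of a norm, which is a nonzero integer when \<open>ev P \<zeta>\<close> is nonzero.\<close>

lemma conjugates_exist:
  assumes "M > 0"
  obtains \<zeta> S where "\<zeta> ^ M = 1" "\<And>z. z ^ M = 1 \<Longrightarrow> \<exists>e. z = \<zeta> ^ e"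
    "finite S" "S \<noteq> {}" "\<And>z. z \<in> S \<Longrightarrow> z ^ M = 1"
    "\<And>P z. ev P \<zeta> = 0 \<Longrightarrow> z \<in> S \<Longrightarrow> ev P z = 0"
    "\<And>P. ev P \<zeta> \<noteq> 0 \<Longrightarrow> 1 \<le> (\<Prod>z\<in>S. cmod (ev P z))"
proof -
  define \<zeta> where "\<zeta> = cis (2 * pi / real M)"
  have zk: "\<zeta> ^ j = cis (2 * pi * real j / real M)" for j by (simp add: \<zeta>_def DeMoivre mult_ac)
  have zM: "\<zeta> ^ M = 1" using assms by (simp add: zk)
  have gen: "\<exists>e. z = \<zeta> ^ e" if "z ^ M = 1" for z
    using bij_betw_roots_unity[OF assms] that unfolding bij_betw_def zk by blast
  define Q0 :: "int poly" where "Q0 = monom 1 M - 1"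
  have evQ0: "ev Q0 z = z ^ M - 1" for z by (simp add: Q0_def)
  have Q0: "degree Q0 = M" "lead_coeff Q0 = 1"
  proof -
    show "degree Q0 = M" unfolding Q0_def using assms
      unfolding diff_conv_add_uminus by (subst degree_add_eq_left) (auto simp: degree_monom_eq)
    then show "lead_coeff Q0 = 1" using assms by (simp add: Q0_def)
  qed
  have "Q0 \<noteq> 0" using Q0 by auto
  moreover have "ev Q0 \<zeta> = 0" using zM by (simp add: evQ0)
  ultimately obtain F where F0: "F \<noteq> 0" "ev F \<zeta> = 0" "content F = 1" "degree F > 0"
    and Fmin: "\<And>P. P \<noteq> 0 \<Longrightarrow> ev P \<zeta> = 0 \<Longrightarrow> degree F \<le> degree P"
    and Fdiv: "\<And>P. ev P \<zeta> = 0 \<Longrightarrow> \<exists>c q. c \<noteq> 0 \<and> smult c P = F * q"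
    using minimal_ev_poly by metis
  \<comment> \<open>Gauss's lemma: as \<open>F\<close> and \<open>Q0\<close> have content 1, the
    cofactor has content \<open>\<bar>c\<bar>\<close>, and the factor \<open>c\<close> can be
    cancelled over the integers.\<close>
  have "F dvd Q0"
  proof -
    obtain c q where cq: "c \<noteq> 0" "smult c Q0 = F * q" using Fdiv \<open>ev Q0 \<zeta> = 0\<close> by blast
    have "content Q0 dvd 1" by (metis Q0 content_dvd_coeff)
    then have c1: "content Q0 = 1" by (metis normalize_content is_unit_normalize)
    then have "content q = \<bar>c\<bar>" using arg_cong[OF cq(2), of content] F0(3) c1 by (simp add: content_mult)
    then have "smult c Q0 = smult \<bar>c\<bar> (F * primitive_part q)"
      using content_times_primitive_part[of q] cq(2) by (metis mult_smult_right)
    also have "\<dots> = smult c (F * smult (sgn c) (primitive_part q))"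
      by (simp add: abs_sgn mult.commute)
    finally have "smult c (Q0 - F * smult (sgn c) (primitive_part q)) = 0"
      by (simp only: smult_diff_right diff_self)
    then have "Q0 = F * smult (sgn c) (primitive_part q)"
      using cq(1) by (simp only: smult_eq_0_iff simp_thms right_minus_eq)
    then show ?thesis by (rule dvdI)
  qed
  note F = this F0(2)
  from F(1) obtain H where H: "Q0 = F * H" by (elim dvdE)
  have nz: "F \<noteq> 0" "H \<noteq> 0" using H Q0 by auto
  have "lead_coeff F * lead_coeff H = 1" using Q0(2) unfolding H lead_coeff_mult .
  then have lead: "\<bar>lead_coeff F\<bar> = 1" by (metis abs_zmult_eq_1 abs_1)
  note degF = F0(4)
  define S where "S = {z. ev F z = 0}"
  have SM: "z ^ M = 1" if "z \<in> S" for z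
    using ev_dvd[OF F(1), of z] that by (simp add: S_def evQ0)
  have fin: "finite S" by (rule finite_subset[OF _ finite_rou[OF assms]]) (use SM in auto)
  have root_bound: "card {z. ev P z = 0} \<le> degree P \<and> finite {z. ev P z = 0}" if "P \<noteq> 0" for P
  proof -
    have "map_poly of_int P \<noteq> (0::complex poly)" using that by simp
    from poly_roots_degree[OF this] poly_roots_finite[OF this] show ?thesis by (simp add: ev_def)
  qed
  \<comment> \<open>The \<open>M\<close> distinct roots of \<open>Q0\<close> are covered by those of
    \<open>F\<close> and \<open>H\<close>, each of which has at most as many as its degree; hence
    \<open>F\<close> has its full number of distinct roots.\<close>
  have card: "card S = degree F"
  proof (rule antisym)
    show "card S \<le> degree F" unfolding S_def using root_bound[OF nz(1)] by simp
    have "M = card (rou M)" using assms by (simp add: card_roots_unity_eq)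
    also have "\<dots> \<le> card (S \<union> {z. ev H z = 0})"
    proof (rule card_mono)
      show "finite (S \<union> {z. ev H z = 0})" using fin root_bound[OF nz(2)] by simp
      show "rou M \<subseteq> S \<union> {z. ev H z = 0}"
      proof
        fix z assume "z \<in> rou M"
        then have "ev (F * H) z = 0" using evQ0[of z] unfolding H by simp
        then show "z \<in> S \<union> {z. ev H z = 0}" by (auto simp: S_def)
      qed
    qed
    also have "\<dots> \<le> card S + degree H" using card_Un_le[of S] root_bound[OF nz(2)] by (meson add_left_mono le_trans)
    finally show "degree F \<le> card S" using Q0(1) nz by (simp add: H degree_mult_eq)
  qed
  have conj0: "ev P z = 0" if P: "ev P \<zeta> = 0" "z \<in> S" for P z
  proof -
    obtain c q where cq: "c \<noteq> 0" "smult c P = F * q" using Fdiv[OF P(1)] by blast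
    show ?thesis using arg_cong[OF cq(2), of "\<lambda>p. ev p z"] P(2) cq(1) by (simp add: S_def)
  qed
  \<comment> \<open>The minimal polynomial \<open>G\<close> of a common root of \<open>P\<close> and
    \<open>F\<close> divides both up to integer factors. It does not vanish at
    \<open>\<zeta>\<close>, so its cofactor in \<open>F\<close> does, against the minimality of
    \<open>F\<close>.\<close>
  have conj1: "ev P z \<noteq> 0" if P: "ev P \<zeta> \<noteq> 0" "z \<in> S" for P z
  proof
    assume Pz: "ev P z = 0"
    have Fz: "ev F z = 0" using P(2) by (simp add: S_def)
    obtain G where G: "G \<noteq> 0" "ev G z = 0" "degree G > 0"
      and Gdiv: "\<And>P. ev P z = 0 \<Longrightarrow> \<exists>c q. c \<noteq> 0 \<and> smult c P = G * q"
      using minimal_ev_poly[OF nz(1) Fz] by metis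
    obtain c q where cq: "c \<noteq> 0" "smult c P = G * q" using Gdiv[OF Pz] by blast
    have Gz: "ev G \<zeta> \<noteq> 0" using arg_cong[OF cq(2), of "\<lambda>p. ev p \<zeta>"] P(1) cq(1) by auto
    obtain c' q' where cq': "c' \<noteq> 0" "smult c' F = G * q'" using Gdiv[OF Fz] by blast
    have q': "q' \<noteq> 0" using cq' nz(1) by auto
    have "ev q' \<zeta> = 0" using arg_cong[OF cq'(2), of "\<lambda>p. ev p \<zeta>"] F(2) Gz by simp
    then have "degree F \<le> degree q'" using Fmin q' by blast
    moreover have "degree F = degree G + degree q'"
      using arg_cong[OF cq'(2), of degree] cq'(1) G(1) q' by (simp add: degree_mult_eq)
    ultimately show False using G(3) by simp
  qed
  have "1 \<le> (\<Prod>z\<in>S. cmod (ev P z))" if "ev P \<zeta> \<noteq> 0" for P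
  proof -
    obtain m where m: "(\<Prod>z\<in>S. ev P z) = of_int m"
      using norm_is_int[OF lead degF, of P] card unfolding S_def by (auto elim: Ints_cases)
    have "(\<Prod>z\<in>S. ev P z) \<noteq> 0" using conj1[OF that] fin by simp
    then have "m \<noteq> 0" using m by auto
    then have "1 \<le> cmod (of_int m)" by simp
    then show ?thesis by (simp add: prod_norm m)
  qed
  moreover have "S \<noteq> {}" using F(2) by (auto simp: S_def)
  ultimately show thesis using that[of \<zeta> S] zM gen fin SM conj0 by blast
qed

section \<open>Representations at the conjugates\<close>

lemma (in comm_ring_hom) hom_adj_mat:
  "adj_mat (map_mat hom A) = map_mat hom (adj_mat A)"
proof (rule eq_matI)
  fix i j assume "i < dim_row (map_mat hom (adj_mat A))" "j < dim_col (map_mat hom (adj_mat A))"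
  then have ij: "i < dim_row A" "j < dim_col A" by (auto simp: adj_mat_def)
  have "mat_delete (map_mat hom A) j i = map_mat hom (mat_delete A j i)"
    by (rule eq_matI) (auto simp: mat_delete_def)
  then show "adj_mat (map_mat hom A) $$ (i,j) = map_mat hom (adj_mat A) $$ (i,j)"
    using ij by (simp add: adj_mat_def cofactor_def hom_mult hom_power hom_uminus)
qed (auto simp: adj_mat_def)

lemma adj_mat_sum':
  fixes A :: "'a::comm_ring_1 mat"
  assumes "A \<in> carrier_mat d d" "k < d" "j < d"
  shows "(\<Sum>i<d. A $$ (k,i) * adj_mat A $$ (i,j)) = (if k = j then det A else 0)"
proof -
  have "(A * adj_mat A) $$ (k,j) = (\<Sum>i<d. A $$ (k,i) * adj_mat A $$ (i,j))"
    using assms adj_mat(1)[OF assms(1)] by (simp add: scalar_prod_def atLeast0LessThan)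
  then show ?thesis using assms adj_mat(2)[OF assms(1)] by (cases "k = j") auto
qed

section \<open>Bounds for minors and for products over the conjugates\<close>

lemma cmod_det_le:
  assumes "A \<in> carrier_mat d d" "\<And>i j. i < d \<Longrightarrow> j < d \<Longrightarrow> cmod (A $$ (i,j)) \<le> c"
    and "1 \<le> c" "d \<le> D"
  shows "cmod (det A) \<le> fact D * c ^ D"
proof -
  have "cmod (det A) \<le> (\<Sum>p | p permutes {0..<d}. c ^ d)"
    unfolding det_def'[OF assms(1)]
  proof (rule sum_norm_le)
    fix p assume "p \<in> {p. p permutes {0..<d}}"
    then have p: "p i < d" if "i < d" for i using that permutes_in_image[of p "{0..<d}" i] by auto
    have "cmod (signof p * (\<Prod>i = 0..<d. A $$ (i, p i))) = (\<Prod>i = 0..<d. cmod (A $$ (i, p i)))"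
      by (simp add: norm_mult sign_def flip: prod_norm)
    also have "\<dots> \<le> (\<Prod>i = 0..<d. c)" by (rule prod_mono) (use assms(2) p in auto)
    finally show "cmod (signof p * (\<Prod>i = 0..<d. A $$ (i, p i))) \<le> c ^ d" by simp
  qed
  also have "\<dots> = fact d * c ^ d" by (simp add: card_permutations)
  also have "\<dots> \<le> fact D * c ^ D"
    using assms(3,4) by (intro mult_mono fact_mono power_increasing) auto
  finally show ?thesis .
qed

lemma cmod_adj_mat_le:
  assumes A: "A \<in> carrier_mat d d" "\<And>i j. i < d \<Longrightarrow> j < d \<Longrightarrow> cmod (A $$ (i,j)) \<le> c"
    and c: "1 \<le> c" "d \<le> D" and ij: "i < d" "j < d"
  shows "cmod (adj_mat A $$ (i,j)) \<le> fact D * c ^ D"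
proof -
  have "cmod (adj_mat A $$ (i,j)) = cmod (det (mat_delete A j i))"
    using A(1) ij by (simp add: adj_mat_def cofactor_def norm_mult norm_power)
  also have "\<dots> \<le> fact D * c ^ D"
  proof (rule cmod_det_le[where d = "d - 1"])
    show "mat_delete A j i \<in> carrier_mat (d - 1) (d - 1)" by (rule mat_delete_carrier[OF A(1)])
    show "cmod (mat_delete A j i $$ (i',j')) \<le> c" if "i' < d - 1" "j' < d - 1" for i' j'
      using A(1) that by (auto simp: mat_delete_def intro!: A(2))
  qed (use c in auto)
  finally show ?thesis .
qed

text \<open>Every small factor costs more than a large factor, at most \<open>B\<close>, can make up
  for; if the small ones were the majority, the product would be less than 1.\<close>

lemma half_bounded_below:
  fixes f :: "'a \<Rightarrow> real"
  assumes "finite S" "\<And>s. s \<in> S \<Longrightarrow> 0 \<le> f s \<and> f s \<le> B" "1 \<le> B" "1 \<le> (\<Prod>s\<in>S. f s)"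
  shows "card S \<le> 2 * card {s \<in> S. 1 / (2 * B) \<le> f s}"
proof (rule ccontr)
  define G where "G = {s \<in> S. 1 / (2 * B) \<le> f s}"
  assume "\<not> ?thesis"
  then have "\<not> card S \<le> 2 * card G" by (simp add: G_def)
  moreover have G: "G \<subseteq> S" "finite G" using assms(1) by (auto simp: G_def)
  moreover have "card (S - G) = card S - card G" using G by (simp add: card_Diff_subset)
  ultimately have less: "card G < card (S - G)" by simp
  have "(\<Prod>s\<in>S. f s) = (\<Prod>s\<in>S - G. f s) * (\<Prod>s\<in>G. f s)" by (rule prod.subset_diff[OF G(1) assms(1)])
  also have "\<dots> \<le> (\<Prod>s\<in>S - G. 1 / (2 * B)) * (\<Prod>s\<in>G. B)"
    using assms G(1) by (intro mult_mono prod_mono prod_nonneg) (auto simp: G_def)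
  also have "\<dots> = (1 / 2) ^ card (S - G) * (B ^ card G / B ^ card (S - G))"
    using assms(3) by (simp add: power_divide power_mult_distrib)
  also have "\<dots> \<le> (1 / 2) ^ card (S - G) * 1"
    using assms(3) less by (intro mult_left_mono) (auto simp: divide_le_eq_1 intro: power_increasing)
  also have "\<dots> < 1" using less by (simp add: power_less_one_iff)
  finally show False using assms(4) by simp
qed

text \<open>In \<open>place_reps\<close> the index set \<open>S\<close> stands for the Galois conjugates of a cyclotomic field, \<open>S'\<close>
  for those at which the representations are bounded, and the last clause for the product formula
  applied to a matrix entry of \<open>w - 1\<close>.\<close>

definition place_reps ::
  "real \<Rightarrow> nat \<Rightarrow> smat set \<Rightarrow> nat \<Rightarrow> complex set \<Rightarrow> complex set \<Rightarrow> (complex \<Rightarrow> smat \<Rightarrow> smat) \<Rightarrow> bool" where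
  "place_reps C W X d S S' \<rho> \<longleftrightarrow> finite S \<and> S \<noteq> {} \<and> S' \<subseteq> S \<and> card S \<le> 2 * card S' \<and>
    (\<forall>s\<in>S. \<rho> s 1 = 1 \<and> (\<forall>u\<in>words X W. supp_le d (\<rho> s u)) \<and>
       (\<forall>u\<in>words X W. \<forall>v\<in>words X W. \<rho> s (u * v) = \<rho> s u * \<rho> s v)) \<and>
    (\<forall>s\<in>S'. \<forall>u\<in>words X W. nrm (\<rho> s u) \<le> C) \<and>
    (\<forall>w\<in>words X W. w \<noteq> 1 \<longrightarrow> (\<forall>s\<in>S. \<rho> s w \<noteq> 1) \<and>
       (\<exists>b. (\<forall>s\<in>S. 0 \<le> b s \<and> b s \<le> C) \<and> (\<forall>s\<in>S. b s \<le> C * nrm (\<rho> s w - 1)) \<and> 1 \<le> (\<Prod>s\<in>S. b s)))"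

text \<open>The trace is a sum of \<open>n\<close> powers of \<open>\<zeta>\<close>, so it lifts to
  a sum of \<open>n\<close> monomials, which has modulus at most \<open>n\<close> at every root of
  unity.\<close>

lemma ev_lift_trace:
  assumes x: "supp_le n x" "x ^ M = 1" "M > 0" and z: "\<And>z. z ^ M = 1 \<Longrightarrow> \<exists>e. z = \<zeta> ^ e"
  shows "\<exists>P. ev P \<zeta> = tr n x \<and> (\<forall>z\<in>rou M. cmod (ev P z) \<le> of_nat n)"
proof -
  obtain \<beta> :: "nat \<Rightarrow> complex" where \<beta>: "\<And>i. \<beta> i ^ M = 1" "\<And>k. tr n (x ^ k) = (\<Sum>i<n. \<beta> i ^ k)"
    using torsion_trace[OF x(1,2)] by metis
  have "\<forall>i. \<exists>e. \<beta> i = \<zeta> ^ e" using z \<beta>(1) by blast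
  from choice[OF this] obtain e where e: "\<And>i. \<beta> i = \<zeta> ^ e i" by blast
  let ?P = "\<Sum>i<n. monom 1 (e i) :: int poly"
  have "ev ?P \<zeta> = tr n x" using \<beta>(2)[of 1] by (simp add: ev_sum e)
  moreover have "cmod (ev ?P z) \<le> of_nat n" if "z \<in> rou M" for z
  proof -
    have "cmod z ^ M = 1 ^ M" using that by (simp flip: norm_power)
    then have "cmod z = 1" using x(3) power_eq_imp_eq_base[of "cmod z" M 1] by simp
    then have "cmod (ev ?P z) \<le> (\<Sum>i<n. 1)"
      unfolding ev_sum by (intro sum_norm_le) (simp add: norm_power)
    then show ?thesis by simp
  qed
  ultimately show ?thesis by blast
qed

text \<open>For a frame with Gram matrix \<open>G\<close>, the inverse of \<open>G\<close> times the
  matrix of the traces of \<open>x i * w * y j\<close> represents \<open>w\<close>. Its numerators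
  and its denominator \<open>det G\<close> are integer polynomials in \<open>\<zeta>\<close>, so it
  can be formed at every conjugate. \<open>C\<close> is chosen before \<open>W\<close>.\<close>

lemma place_reps_exist:
  "\<exists>C\<ge>1. \<forall>W. \<exists>l. \<forall>X. sym_gens n X \<longrightarrow> torsion (words X l) \<longrightarrow>
     (\<exists>d S S' \<rho>. d \<le> n * n \<and> place_reps C W X d S S' \<rho>)"
proof -
  \<comment> \<open>At every conjugate \<open>c\<close> bounds the entries of the Gram matrix, with
    \<open>n + 1\<close> to ensure \<open>1 \<le> c\<close>; \<open>B\<close> bounds its determinant
    and adjugate, \<open>B1\<close> the numerators. \<open>C\<close> also bounds the norm where the
    determinant is at least \<open>1 / (2 * B)\<close>.\<close>
  define c B B1 C :: real where "c = n + 1" and "B = fact (n * n) * c ^ (n * n)"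
    and "B1 = (n * n) * (B * c)" and "C = 1 + (n * n) * ((n * n) * (B1 * (2 * B) + 1)) + B1 + B"
  have c1: "1 \<le> c" by (simp add: c_def)
  have B1: "1 \<le> B" unfolding B_def using c1 by (intro mult_ge1_I one_le_power) auto
  have B10: "0 \<le> B1" unfolding B1_def using c1 B1 by simp
  have C: "1 \<le> C" "B \<le> C" "B1 + B \<le> C" unfolding C_def using B1 B10 by auto
  have main: "\<exists>d S S' \<rho>. d \<le> n * n \<and> place_reps C W X d S S' \<rho>"
    if X: "sym_gens n X" and tor: "torsion (words X (2 * (n * n * W + W)))" for W X
  proof -
    \<comment> \<open>This covers \<open>x i * w * y j\<close> for \<open>w\<close> a product of two
      words of length \<open>W\<close>, since \<open>k \<le> n * n * W\<close>.\<close>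
    let ?l = "2 * (n * n * W + W)"
    note X' = sym_gensD[OF X]
    obtain M where M: "M > 0" "\<And>g. g \<in> words X ?l \<Longrightarrow> g ^ M = 1"
      using torsion_common_exponent[OF finite_words[OF X'(1)] tor] by metis
    obtain k d x y where kd: "k \<le> n * n * W" "d \<le> n * n" and f: "frame n X k W d x y"
      using frame_exists[OF X] by metis
    note F = frameD[OF f]
    obtain \<zeta> S where \<zeta>: "\<zeta> ^ M = 1" "\<And>z. z ^ M = 1 \<Longrightarrow> \<exists>e. z = \<zeta> ^ e"
      and S: "finite S" "S \<noteq> {}" "\<And>z. z \<in> S \<Longrightarrow> z ^ M = 1"
      "\<And>P z. ev P \<zeta> = 0 \<Longrightarrow> z \<in> S \<Longrightarrow> ev P z = 0"
      "\<And>P. ev P \<zeta> \<noteq> 0 \<Longrightarrow> 1 \<le> (\<Prod>z\<in>S. cmod (ev P z))"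
      by (rule conjugates_exist[OF M(1)]) (rule that)
    have S0: "ev P z \<noteq> 0" if "ev P \<zeta> \<noteq> 0" "z \<in> S" for P z
      proof
      assume "ev P z = 0"
      then have "(\<Prod>z\<in>S. cmod (ev P z)) = 0" using that(2) S(1) by (intro prod_zero) auto
      then show False using S(5)[OF that(1)] by simp
    qed
    have "\<forall>w\<in>words X ?l. \<exists>P. ev P \<zeta> = tr n w \<and> (\<forall>z\<in>rou M. cmod (ev P z) \<le> of_nat n)"
      using ev_lift_trace[OF sym_gens_words(1)[OF X] M(2) M(1) \<zeta>(2)] by blast
    \<comment> \<open>\<open>t w\<close> is an integer polynomial whose value at
      \<open>\<zeta>\<close> is the trace of \<open>w\<close>; its values on \<open>S\<close> play
      the role of the conjugates of that trace.\<close>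
    from bchoice[OF this] obtain t where
      t: "\<And>w. w \<in> words X ?l \<Longrightarrow> ev (t w) \<zeta> = tr n w"
      "\<And>w z. w \<in> words X ?l \<Longrightarrow> z \<in> rou M \<Longrightarrow> cmod (ev (t w) z) \<le> of_nat n"
      by blast
    have tb: "cmod (ev (t w) z) \<le> c" if "w \<in> words X ?l" "z \<in> S" for w z
      using t(2)[OF that(1), of z] S(3)[OF that(2)] by (simp add: c_def)
    have inl: "w \<in> words X ?l" if "w \<in> words X m" "m \<le> 2 * (k + W)" for w m
      using words_mono[OF X'(2), of m ?l] that kd(1) by auto
    have inl1: "x i * w * y j \<in> words X ?l" if "i < d" "j < d" "w \<in> words X (2 * W)" for i j w
      by (rule inl[OF words_mult[OF words_mult[OF F(1)[OF that(1)] that(3)] F(2)[OF that(2)]]]) simp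
    have W2: "words X W \<subseteq> words X (2 * W)" by (rule words_mono[OF X'(2)]) simp
    define G where "G = mat d d (\<lambda>(i,j). t (x i * y j))"
    define a where "a = (\<lambda>i j. adj_mat G $$ (i,j))"
    \<comment> \<open>The numerators, namely the adjugate of \<open>G\<close> times the traces of
      \<open>x m * w * y j\<close>; division by \<open>det G\<close> is postponed so that everything
      can be evaluated at other conjugates.\<close>
    define N where "N = (\<lambda>w i j. \<Sum>m<d. a i m * t (x m * w * y j))"
    have G: "G \<in> carrier_mat d d" by (simp add: G_def)
    have xyl: "x i * y j \<in> words X ?l" if "i < d" "j < d" for i j
      using inl1[OF that, of 1] one_in_words[OF X'(2)] by simp
    have Gz: "cmod (map_mat (\<lambda>P. ev P z) G $$ (i,j)) \<le> c" if "i < d" "j < d" "z \<in> S" for i j z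
      using that tb[OF xyl] by (simp add: G_def)
    have evdet: "ev (det G) z = det (map_mat (\<lambda>P. ev P z) G)" for z
      by (rule comm_ring_hom.hom_det[OF comm_ring_hom_ev, symmetric])
    have eva: "ev (a i j) z = adj_mat (map_mat (\<lambda>P. ev P z) G) $$ (i,j)" if "i < d" "j < d" for i j z
      using that adj_mat(1)[OF G] by (simp add: a_def comm_ring_hom.hom_adj_mat[OF comm_ring_hom_ev])
    have detb: "cmod (ev (det G) z) \<le> B" if "z \<in> S" for z
      unfolding evdet B_def using Gz[OF _ _ that] c1 kd(2) G by (intro cmod_det_le[where d=d]) auto
    have ab: "cmod (ev (a i j) z) \<le> B" if "z \<in> S" "i < d" "j < d" for i j z
      unfolding eva[OF that(2,3)] B_def using Gz[OF _ _ that(1)] c1 kd(2) G that(2,3)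
      by (intro cmod_adj_mat_le[where d=d]) auto
    have Nb: "cmod (ev (N w i j) z) \<le> B1" if "z \<in> S" "i < d" "j < d" "w \<in> words X (2 * W)" for w i j z
    proof -
      have "cmod (ev (N w i j) z) \<le> (\<Sum>m<d. B * c)"
        unfolding N_def ev_sum
        using ab tb[OF inl1] that B1 by (intro sum_norm_le) (auto simp: norm_mult intro!: mult_mono)
      also have "\<dots> \<le> B1" unfolding B1_def using kd(2) B1 c1 by (auto intro!: mult_right_mono simp flip: of_nat_mult)
      finally show ?thesis .
    qed
    have G\<zeta>: "map_mat (\<lambda>P. ev P \<zeta>) G = gram n d x y"
      by (rule eq_matI) (auto simp: G_def gram_def t(1)[OF xyl])
    have det\<zeta>: "ev (det G) \<zeta> = det (gram n d x y)" by (simp add: evdet G\<zeta>)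
    have det0: "ev (det G) \<zeta> \<noteq> 0" using F(3) by (simp add: det\<zeta>)
    have N\<zeta>: "ev (N w i j) \<zeta> = (\<Sum>m<d. adj_mat (gram n d x y) $$ (i,m) * tr n (x m * w * y j))"
      if "i < d" "j < d" "w \<in> words X (2 * W)" for w i j
      unfolding N_def ev_sum using that by (intro sum.cong) (simp_all add: eva G\<zeta> t(1)[OF inl1])
    have N1: "N 1 i j = (if i = j then det G else 0)" if "i < d" "j < d" for i j
      using adj_mat_sum[OF G that] that by (simp add: N_def a_def G_def)
    \<comment> \<open>At \<open>\<zeta>\<close> this is the frame formula for the products
      \<open>(x p * u) * (v * y j)\<close>; as a relation between integer polynomials it passes to
      all conjugates.\<close>
    have Nmult: "(\<Sum>m<d. ev (N u i m) z * ev (N v m j) z) = ev (det G) z * ev (N (u * v) i j) z"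
      if z: "z \<in> S" and ij: "i < d" "j < d" and uv: "u \<in> words X W" "v \<in> words X W" for u v i j z
    proof -
      let ?A = "\<lambda>i j. adj_mat (gram n d x y) $$ (i,j)"
      have uv2: "u \<in> words X (2 * W)" "v \<in> words X (2 * W)" "u * v \<in> words X (2 * W)"
        using uv W2 words_mult[OF uv] by (auto simp: mult_2)
      have "ev ((\<Sum>m<d. N u i m * N v m j) - det G * N (u * v) i j) \<zeta> = 0"
      proof -
        have "(\<Sum>m<d. ev (N u i m) \<zeta> * ev (N v m j) \<zeta>) =
           (\<Sum>m<d. (\<Sum>p<d. ?A i p * tr n (x p * u * y m)) * (\<Sum>q<d. ?A m q * tr n (x q * v * y j)))"
          using ij uv2 by (intro sum.cong) (simp_all add: N\<zeta>)
        also have "\<dots> = (\<Sum>m<d. \<Sum>p<d. \<Sum>q<d. ?A i p * (tr n (x p * u * y m) * ?A m q * tr n (x q * (v * y j))))"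
          by (simp add: sum_distrib_left sum_distrib_right mult.assoc) (subst sum.swap, simp add: mult.left_commute mult.assoc)
        also have "\<dots> = (\<Sum>p<d. ?A i p * (\<Sum>m<d. \<Sum>q<d. tr n (x p * u * y m) * ?A m q * tr n (x q * (v * y j))))"
          by (subst sum.swap) (simp add: sum_distrib_left)
        also have "\<dots> = (\<Sum>p<d. ?A i p * (det (gram n d x y) * tr n ((x p * u) * (v * y j))))"
        proof (intro sum.cong refl arg_cong2[where f = "times"] frame_formula[OF f, symmetric])
          fix p assume "p \<in> {..<d}"
          then show "x p * u \<in> words X (k + W)" "v * y j \<in> words X (k + W)"
            using words_mult[OF F(1) uv(1)] words_mult[OF uv(2) F(2)[OF ij(2)]] by (auto simp: add.commute)
        qed
        also have "\<dots> = (\<Sum>p<d. det (gram n d x y) * (?A i p * tr n (x p * (u * v) * y j)))"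
          by (intro sum.cong refl) (simp only: mult.assoc mult.left_commute[of _ "det (gram n d x y)"])
        also have "\<dots> = det (gram n d x y) * ev (N (u * v) i j) \<zeta>"
          by (simp only: N\<zeta>[OF ij uv2(3)] sum_distrib_left)
        finally show ?thesis by (simp add: ev_sum det\<zeta>)
      qed
      from S(4)[OF this z] show ?thesis by (simp add: ev_sum)
    qed
    define R where "R = (\<lambda>z w. mat d d (\<lambda>(i,j). ev (N w i j) z / ev (det G) z))"
    define \<rho> where "\<rho> = (\<lambda>z w. of_mat d 1 (R z w))"
    have R: "R z w \<in> carrier_mat d d" for z w by (simp add: R_def)
    define S' where "S' = {z \<in> S. 1 / (2 * B) \<le> cmod (ev (det G) z)}"
    have card: "card S \<le> 2 * card S'"
      unfolding S'_def using S(1,5) detb B1 det0 by (intro half_bounded_below) auto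
    have one: "\<rho> z 1 = 1" if "z \<in> S" for z
    proof -
      have "R z 1 = 1\<^sub>m d" using S0[OF det0 that] by (intro eq_matI) (auto simp: R_def N1)
      then show ?thesis by (simp add: \<rho>_def of_mat_1)
    qed
    have mult: "\<rho> z (u * v) = \<rho> z u * \<rho> z v" if "z \<in> S" "u \<in> words X W" "v \<in> words X W" for z u v
    proof -
      have "R z (u * v) = R z u * R z v"
      proof (rule eq_matI)
        fix i j assume "i < dim_row (R z u * R z v)" "j < dim_col (R z u * R z v)"
        then have ij: "i < d" "j < d" by (auto simp: R_def)
        have "(R z u * R z v) $$ (i,j) = (\<Sum>m<d. ev (N u i m) z * ev (N v m j) z) / (ev (det G) z * ev (det G) z)"
          using ij by (simp add: R_def scalar_prod_def atLeast0LessThan sum_divide_distrib)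
        also have "\<dots> = R z (u * v) $$ (i,j)"
          using ij S0[OF det0 that(1)] by (simp add: Nmult[OF that(1) ij that(2,3)] R_def)
        finally show "R z (u * v) $$ (i,j) = (R z u * R z v) $$ (i,j)" by simp
      qed (auto simp: R_def)
      then show ?thesis using of_mat_mult[OF R R, where c = 1 and d = 1] by (simp add: \<rho>_def)
    qed
    have bounded: "nrm (\<rho> z u) \<le> C" if z: "z \<in> S'" and u: "u \<in> words X W" for z u
    proof -
      have zS: "z \<in> S" "1 / (2 * B) \<le> cmod (ev (det G) z)" using z by (auto simp: S'_def)
      have pos: "0 < 1 / (2 * B)" using B1 by simp
      \<comment> \<open>The summand 1 pays for subtracting the scalar part on the diagonal.\<close>
      have e: "cmod (ent (\<rho> z u) i j) \<le> B1 * (2 * B) + 1" if "i < d" "j < d" for i j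
      proof -
        have "u \<in> words X (2 * W)" using u W2 by blast
        have "cmod (R z u $$ (i,j)) = cmod (ev (N u i j) z) / cmod (ev (det G) z)"
          using that by (simp add: R_def norm_divide)
        also have "\<dots> \<le> B1 / (1 / (2 * B))"
          by (rule frac_le[OF B10 Nb[OF zS(1) that \<open>u \<in> words X (2 * W)\<close>] pos zS(2)])
        finally show ?thesis
          using that norm_triangle_ineq4[of "R z u $$ (i,j)" "if i = j then 1 else 0"]
          by (auto simp: \<rho>_def ent_of_mat split: if_splits)
      qed
      have "nrm (\<rho> z u) = 1 + (\<Sum>i<d. \<Sum>j<d. cmod (ent (\<rho> z u) i j))"
        using nrm_eq[of d "\<rho> z u"] by (simp add: \<rho>_def)
      also have "\<dots> \<le> 1 + (\<Sum>i<d. \<Sum>j<d. B1 * (2 * B) + 1)"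
        using e by (intro add_left_mono sum_mono) auto
      also have "\<dots> = 1 + d * (d * (B1 * (2 * B) + 1))" by simp
      also have "\<dots> \<le> 1 + (n * n) * ((n * n) * (B1 * (2 * B) + 1))"
        using kd(2) B10 B1 by (intro add_left_mono mult_mono) (auto simp flip: of_nat_mult)
      also have "\<dots> \<le> C" unfolding C_def using B1 B10 by simp
      finally show ?thesis .
    qed
    have faithful: "(\<forall>z\<in>S. \<rho> z w \<noteq> 1) \<and> (\<exists>b. (\<forall>z\<in>S. 0 \<le> b z \<and> b z \<le> C) \<and>
        (\<forall>z\<in>S. b z \<le> C * nrm (\<rho> z w - 1)) \<and> 1 \<le> (\<Prod>z\<in>S. b z))"
      if w: "w \<in> words X W" "w \<noteq> 1" for w
    proof -
      have w2: "w \<in> words X (2 * W)" using w W2 by blast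
      \<comment> \<open>\<open>b i j\<close> evaluates to \<open>det G\<close> times an entry of
        \<open>\<rho> z w - 1\<close>. If all of them vanished at \<open>\<zeta>\<close>, then
        \<open>w\<close> and 1 would have the same traces on the frame; one that does not vanish
        feeds the product formula.\<close>
      define b where "b = (\<lambda>i j. N w i j - (if i = j then det G else 0))"
      have "\<exists>i<d. \<exists>j<d. ev (b i j) \<zeta> \<noteq> 0"
      proof (rule ccontr)
        assume "\<not> ?thesis"
        then have b0: "ev (N w i j) \<zeta> = (if i = j then det (gram n d x y) else 0)" if "i < d" "j < d" for i j
          using that by (auto simp: b_def det\<zeta> split: if_splits)
        have "tr n (x i * w * y j) = tr n (x i * y j)" if ij: "i < d" "j < d" for i j
        proof -
          let ?g = "gram n d x y"
          have "(\<Sum>m<d. ?g $$ (i,m) * ev (N w m j) \<zeta>) = (\<Sum>m<d. if m = j then ?g $$ (i,j) * det ?g else 0)"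
            using b0 ij by (intro sum.cong) auto
          then have "?g $$ (i,j) * det ?g = (\<Sum>m<d. ?g $$ (i,m) * ev (N w m j) \<zeta>)" using ij by simp
          also have "\<dots> = (\<Sum>m<d. \<Sum>p<d. ?g $$ (i,m) * adj_mat ?g $$ (m,p) * tr n (x p * w * y j))"
            using ij w2 by (intro sum.cong) (simp_all add: N\<zeta> sum_distrib_left mult.assoc)
          also have "\<dots> = (\<Sum>p<d. (\<Sum>m<d. ?g $$ (i,m) * adj_mat ?g $$ (m,p)) * tr n (x p * w * y j))"
            by (subst sum.swap) (simp add: sum_distrib_right)
          also have "\<dots> = (\<Sum>p<d. if i = p then det ?g * tr n (x i * w * y j) else 0)"
            using adj_mat_sum'[OF gram_carrier ij(1)] by (intro sum.cong) auto
          also have "\<dots> = det ?g * tr n (x i * w * y j)" using ij by simp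
          finally show ?thesis using F(3) ij by (simp add: gram_def)
        qed
        from frame_faithful[OF X f w(1) this M(2) M(1)] have "w = 1"
          using inl[OF w(1)] by simp
        then show False using w(2) by simp
      qed
      then obtain i j where ij: "i < d" "j < d" and b0: "ev (b i j) \<zeta> \<noteq> 0" by blast
      have e: "ev (b i j) z = ev (det G) z * ent (\<rho> z w - 1) i j" if "z \<in> S" for z
        using S0[OF det0 that] ij by (simp add: b_def \<rho>_def R_def smat_simps ent_of_mat field_simps)
      have "\<rho> z w \<noteq> 1" if "z \<in> S" for z
        using e[OF that] S0[OF b0 that] by (auto simp: smat_simps)
      moreover have "cmod (ev (b i j) z) \<le> C" if "z \<in> S" for z
      proof -
        have "cmod (ev (b i j) z) \<le> cmod (ev (N w i j) z) + cmod (ev (if i = j then det G else 0) z)"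
          unfolding b_def ev_simps by (rule norm_triangle_ineq4)
        also have "\<dots> \<le> B1 + B"
          using Nb[OF that ij w2] detb[OF that] B1 by (intro add_mono) auto
        finally show ?thesis using C(3) by simp
      qed
      moreover have "cmod (ev (b i j) z) \<le> C * nrm (\<rho> z w - 1)" if "z \<in> S" for z
        unfolding e[OF that] norm_mult
        using detb[OF that] C B1 by (intro mult_mono cmod_ent_le_nrm) auto
      ultimately show ?thesis using S(5)[OF b0] by (intro conjI exI[of _ "\<lambda>z. cmod (ev (b i j) z)"]) auto
    qed
    have "place_reps C W X d S S' \<rho>"
      unfolding place_reps_def using S(1,2) card one mult bounded faithful
      by (auto simp: S'_def \<rho>_def)
    then show ?thesis using kd(2) by blast
  qed
  show ?thesis using C(1) main by blast
qed

section \<open>Conjugates of a bounded power commute\<close>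

lemma nrm_cscal_mult: "nrm (cscal c * x) = cmod c * nrm x"
proof -
  obtain N where N: "supp_le N x" using supp_le_exists by blast
  then show ?thesis
    by (simp add: nrm_eq[where N=N] norm_mult sum_distrib_left algebra_simps)
qed

lemma nrm_sum: "nrm (\<Sum>i\<in>I. f i) \<le> (\<Sum>i\<in>I. nrm (f i))"
proof (induction I rule: infinite_finite_induct)
  case (insert i I)
  then show ?case using nrm_add[of "f i" "\<Sum>i\<in>I. f i"] by simp
qed (simp_all add: nrm_def smat_simps)

text \<open>The product of \<open>Z - 1\<close> with the sum of the powers of \<open>Z\<close> is 0.
  This sum is within \<open>N / 4\<close> of \<open>N\<close>, so \<open>N * nrm (Z - 1)\<close> is
  at most a quarter of itself.\<close>

lemma small_root_of_1:
  assumes Z: "Z ^ N = 1" "N > 0" and C: "\<And>i. i < N \<Longrightarrow> nrm (Z ^ i) \<le> C"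
    and small: "nrm (Z - 1) \<le> 1 / (4 * real N * C)" and C1: "1 \<le> C"
  shows "Z = 1"
proof -
  define e where "e = nrm (Z - 1)"
  have e: "0 \<le> e" "real N * (C * e) \<le> 1 / 4"
    using small C1 Z(2) by (auto simp: e_def field_simps)
  have pw: "nrm (Z ^ i - 1) \<le> real i * (C * e)" if "i < N" for i
    using that
  proof (induction i)
    case (Suc i)
    have "Z ^ Suc i - 1 = Z ^ i * (Z - 1) + (Z ^ i - 1)" by (simp add: algebra_simps power_commutes)
    then have "nrm (Z ^ Suc i - 1) \<le> nrm (Z ^ i) * e + nrm (Z ^ i - 1)"
      unfolding e_def by (metis add_right_mono nrm_add nrm_mult order_trans)
    also have "\<dots> \<le> C * e + real i * (C * e)"
      using Suc e(1) C by (intro add_mono mult_right_mono) auto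
    finally show ?case by (simp add: algebra_simps)
  qed (simp add: nrm_def smat_simps)
  have tele: "(Z - 1) * (\<Sum>i<k. Z ^ i) = Z ^ k - 1" for k
    by (induction k) (simp_all add: algebra_simps)
  have "cscal (of_nat N) * (Z - 1) = (\<Sum>i<N. Z - 1)"
    by (induction N) (simp_all add: cscal_simps distrib_right)
  also have "\<dots> = (\<Sum>i<N. Z - 1) - (Z - 1) * (\<Sum>i<N. Z ^ i)" by (simp add: tele Z(1))
  also have "\<dots> = (\<Sum>i<N. (Z - 1) * (1 - Z ^ i))"
    by (simp only: sum_distrib_left sum_subtractf[symmetric] right_diff_distrib mult.right_neutral)
  finally have "real N * e = nrm (\<Sum>i<N. (Z - 1) * (1 - Z ^ i))"
    unfolding e_def by (metis nrm_cscal_mult norm_of_nat)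
  also have "\<dots> \<le> (\<Sum>i<N. nrm ((Z - 1) * (1 - Z ^ i)))" by (rule nrm_sum)
  also have "\<dots> \<le> (\<Sum>i<N. e * (1 / 4))"
  proof (rule sum_mono)
    fix i assume "i \<in> {..<N}"
    then have "real i * (C * e) \<le> real N * (C * e)" using e C1 by (intro mult_right_mono) auto
    then have "nrm (1 - Z ^ i) \<le> 1 / 4"
      using pw[of i] \<open>i \<in> _\<close> e(2) by (simp add: nrm_minus_commute)
    then show "nrm ((Z - 1) * (1 - Z ^ i)) \<le> e * (1 / 4)"
      unfolding e_def by (intro order_trans[OF nrm_mult] mult_left_mono) auto
  qed
  finally have "real N * e \<le> real N * (e / 4)" by simp
  then have "e = 0" using Z(2) e(1) by (simp add: mult_le_cancel_left_pos)
  then show ?thesis unfolding e_def using nrm_eq_0 by fastforce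
qed

lemma floor_eq_imp_close:
  fixes a b K :: real
  assumes "\<lfloor>K * a\<rfloor> = \<lfloor>K * b\<rfloor>" "K > 0"
  shows "\<bar>a - b\<bar> \<le> 1 / K"
proof -
  have "\<bar>K * a - K * b\<bar> < 1"
    using assms(1) by linarith
  then have "K * \<bar>a - b\<bar> < 1" using assms(2) by (simp add: abs_mult flip: right_diff_distrib)
  then show ?thesis using assms(2) by (simp add: field_simps)
qed

text \<open>All coordinates are rounded to a grid of mesh \<open>1 / K\<close>; \<open>Q\<close>
  exceeds the number of cells and depends only on \<open>D\<close>, \<open>C\<close> and
  \<open>e\<close>.\<close>

lemma bounded_pigeonhole:
  fixes C e :: real
  assumes "e > 0"
  shows "\<exists>Q\<ge>(1::nat). \<forall>f. (\<forall>i\<le>Q. supp_le D (f i) \<and> nrm (f i) \<le> C) \<longrightarrow> (\<exists>i j. i < j \<and> j \<le> Q \<and> nrm (f i - f j) \<le> e)"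
proof -
  \<comment> \<open>There are \<open>1 + D * D\<close> coordinates, the scalar part included, and
    each may differ by \<open>2 / K\<close>; these differences add up to \<open>e\<close>.\<close>
  define K where "K = 2 * (1 + real D * real D) / e"
  have K: "K > 0" unfolding K_def using assms by (intro divide_pos_pos) (auto intro: add_pos_nonneg)
  define L where "L = \<lceil>K * C\<rceil> + 1"
  define I where "I = {..D} \<times> {..D}"
  \<comment> \<open>The index \<open>(D, D)\<close> just outside the block carries the scalar
    part.\<close>
  define cc where "cc = (\<lambda>x (i,j). if i = D \<and> j = D then scal x else ent x i j)"
  define key where "key = (\<lambda>x. restrict (\<lambda>p. (\<lfloor>K * Re (cc x p)\<rfloor>, \<lfloor>K * Im (cc x p)\<rfloor>)) I)"
  define T where "T = I \<rightarrow>\<^sub>E ({-L..L} \<times> {-L..L})"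
  have finT: "finite T" unfolding T_def I_def by (intro finite_PiE) auto
  have *: "\<exists>i j. i < j \<and> j \<le> Suc (card T) \<and> nrm (f i - f j) \<le> e"
    if f: "\<forall>i\<le>Suc (card T). supp_le D (f i) \<and> nrm (f i) \<le> C" for f :: "nat \<Rightarrow> smat"
  proof -
    have fl: "\<lfloor>K * r\<rfloor> \<in> {-L..L}" if "\<bar>r\<bar> \<le> C" for r
    proof -
      have "\<bar>K * r\<bar> \<le> K * C" using K that by (simp add: abs_mult)
      then show ?thesis unfolding L_def atLeastAtMost_iff by linarith
    qed
    have cc_le: "cmod (cc x p) \<le> nrm x" for x p
      using cmod_ent_le_nrm[of x] by (auto simp: cc_def nrm_def sum_nonneg split: prod.splits)
    have "key (f i) \<in> T" if "i \<le> Suc (card T)" for i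
      unfolding T_def key_def
    proof (rule restrict_PiE_iff[THEN iffD2], intro ballI SigmaI fl)
      fix p
      have "cmod (cc (f i) p) \<le> C" using cc_le f that by (meson order_trans)
      then show "\<bar>Re (cc (f i) p)\<bar> \<le> C" "\<bar>Im (cc (f i) p)\<bar> \<le> C"
        using abs_Re_le_cmod abs_Im_le_cmod order_trans by blast+
    qed
    then have "(\<lambda>i. key (f i)) ` {..Suc (card T)} \<subseteq> T" by auto
    then have "card ((\<lambda>i. key (f i)) ` {..Suc (card T)}) \<le> card T" by (rule card_mono[OF finT])
    then have "\<not> inj_on (\<lambda>i. key (f i)) {..Suc (card T)}" by (auto dest: card_image)
    then obtain i j where ij: "i < j" "j \<le> Suc (card T)" "key (f i) = key (f j)"
      unfolding inj_on_def by (metis atMost_iff linorder_neqE_nat)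
    have close: "cmod (cc (f i) p - cc (f j) p) \<le> 2 / K" if "p \<in> I" for p
    proof -
      have "\<bar>Re (cc (f i) p) - Re (cc (f j) p)\<bar> \<le> 1 / K" "\<bar>Im (cc (f i) p) - Im (cc (f j) p)\<bar> \<le> 1 / K"
        using fun_cong[OF ij(3), of p] that K by (auto simp: key_def intro!: floor_eq_imp_close)
      then show ?thesis using cmod_le[of "cc (f i) p - cc (f j) p"] by simp
    qed
    have sup: "supp_le D (f i - f j)" using f ij by simp
    have "nrm (f i - f j) = cmod (scal (f i - f j)) + (\<Sum>a<D. \<Sum>b<D. cmod (ent (f i - f j) a b))"
      by (rule nrm_eq[OF sup])
    also have "\<dots> \<le> 2 / K + (\<Sum>a<D. \<Sum>b<D. 2 / K)"
    proof (intro add_mono sum_mono)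
      show "cmod (scal (f i - f j)) \<le> 2 / K"
        using close[of "(D,D)"] by (simp add: I_def cc_def smat_simps)
      show "cmod (ent (f i - f j) a b) \<le> 2 / K" if "a \<in> {..<D}" "b \<in> {..<D}" for a b
        using close[of "(a,b)"] that by (auto simp: I_def cc_def smat_simps)
    qed
    also have "\<dots> = 2 * (1 + real D * real D) / K" using K by (simp add: field_simps)
    also have "\<dots> = e"
    proof -
      have "2 * P / (2 * P / e) = e" if "P > 0" for P :: real using that assms by simp
      moreover have "1 + real D * real D > 0" by (intro add_pos_nonneg) auto
      ultimately show ?thesis unfolding K_def by blast
    qed
    finally show ?thesis using ij by blast
  qed
  show ?thesis
  proof (rule exI[of _ "Suc (card T)"], intro conjI allI impI)
    fix f :: "nat \<Rightarrow> smat" assume "\<forall>i\<le>Suc (card T). supp_le D (f i) \<and> nrm (f i) \<le> C"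
    then show "\<exists>i j. i < j \<and> j \<le> Suc (card T) \<and> nrm (f i - f j) \<le> e" by (rule *)
  qed simp
qed

section \<open>Iterated commutators\<close>

definition mcomm :: "'a::monoid_mult \<Rightarrow> 'a \<Rightarrow> 'a" where
  "mcomm x y = x * y * minv x * minv y"

text \<open>Every step takes commutators with elements of \<open>A\<close> itself. Each thus
  contributes one more factor of the size of \<open>y - 1\<close>, and an element commuting with
  \<open>A\<close> commutes with all iterated commutators.\<close>

primrec iter_comms :: "'a::monoid_mult set \<Rightarrow> nat \<Rightarrow> 'a set" where
  "iter_comms A 0 = A"
| "iter_comms A (Suc j) = {mcomm x y | x y. x \<in> iter_comms A j \<and> y \<in> A}"

lemma iter_comms_words:
  assumes X: "sym_gens n X" and A: "A \<subseteq> words X m"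
  shows "iter_comms A j \<subseteq> words X (4 ^ j * m)"
proof (induction j)
  case (Suc j)
  show ?case
  proof
    fix z assume "z \<in> iter_comms A (Suc j)"
    then obtain x y where z: "z = mcomm x y" "x \<in> iter_comms A j" "y \<in> A" by auto
    have x: "x \<in> words X (4 ^ j * m)" and y: "y \<in> words X m" using z Suc A by auto
    have "z \<in> words X (4 ^ j * m + m + 4 ^ j * m + m)"
      unfolding z(1) mcomm_def by (intro words_mult x y sym_gens_inverse[OF X])
    moreover have "m \<le> 4 ^ j * m" by simp
    then have "4 ^ j * m + m + 4 ^ j * m + m \<le> 4 ^ Suc j * m"
      unfolding power_Suc mult.assoc by linarith
    ultimately show "z \<in> words X (4 ^ Suc j * m)"
      using words_mono sym_gensD[OF X] by blast
  qed
qed (simp add: A)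

lemma commute_minv:
  assumes "z * x = x * z" "x * minv x = 1" "minv x * x = 1"
  shows "z * minv x = minv x * z"
proof -
  have "minv x * (z * x) * minv x = minv x * (x * z) * minv x" using assms(1) by simp
  then have "minv x * z * (x * minv x) = (minv x * x) * z * minv x" by (simp only: mult.assoc)
  then show ?thesis using assms by simp
qed

lemma iter_comms_commute:
  assumes X: "sym_gens n X" and A: "A \<subseteq> words X m"
    and z: "\<And>y. y \<in> A \<Longrightarrow> z * y = y * z" and x: "x \<in> iter_comms A j"
  shows "z * x = x * z"
  using x
proof (induction j arbitrary: x)
  case (Suc j)
  then obtain u y where x: "x = mcomm u y" "u \<in> iter_comms A j" "y \<in> A" by auto
  have u: "u \<in> words X (4 ^ j * m)" and y: "y \<in> words X m"
    using iter_comms_words[OF X A] x A by auto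
  show ?case
    unfolding x(1) mcomm_def
    by (intro commute_mult commute_minv Suc.IH z x sym_gens_inverse[OF X u] sym_gens_inverse[OF X y])
qed (use z in auto)

lemma mcomm_eq_1_iff:
  assumes "x * minv x = 1" "minv x * x = 1" "y * minv y = 1" "minv y * y = 1"
  shows "mcomm x y = 1 \<longleftrightarrow> x * y = y * x" and "x * y = mcomm x y * y * x"
proof -
  have "mcomm x y * y * x = x * y * (minv x * (minv y * y) * x)" by (simp add: mcomm_def mult.assoc)
  also have "\<dots> = x * y" using assms by simp
  finally show 1: "x * y = mcomm x y * y * x" by simp
  show "mcomm x y = 1 \<longleftrightarrow> x * y = y * x"
  proof
    assume "x * y = y * x"
    then have "mcomm x y = y * (x * minv x) * minv y" by (simp add: mcomm_def mult.assoc)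
    then show "mcomm x y = 1" using assms by simp
  qed (use 1 in simp)
qed

text \<open>\<open>Q\<close> comes before \<open>L\<close> and \<open>R\<close>: it is a pigeonhole
  bound for matrices whose size and norm are bounded in terms of \<open>n\<close>. The exponent
  \<open>q\<close> depends on \<open>g\<close> but not on \<open>h\<close>, because conjugation by
  \<open>h\<close> enlarges the distance to 1 by at most \<open>C ^ 2\<close>.\<close>

lemma commuting_conjugates:
  "\<exists>Q\<ge>1. \<forall>L R. \<exists>l. \<forall>X. sym_gens n X \<longrightarrow> torsion (words X l) \<longrightarrow> (\<forall>g\<in>words X L.
     \<exists>q. 1 \<le> q \<and> q \<le> Q \<and> (\<forall>h\<in>words X R. g ^ q * (h * g ^ q * minv h) = (h * g ^ q * minv h) * g ^ q))"
proof -
  from place_reps_exist[of n] obtain C :: real where C: "1 \<le> C" and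
    reps: "\<And>W. \<exists>l. \<forall>X. sym_gens n X \<longrightarrow> torsion (words X l) \<longrightarrow>
     (\<exists>d S S' \<rho>. d \<le> n * n \<and> place_reps C W X d S S' \<rho>)" by blast
  define N :: nat where "N = fact n"
  have N: "1 \<le> N" by (simp add: N_def)
  \<comment> \<open>Within distance \<open>e\<close> of 1, an element of exponent \<open>N\<close>
    with bounded powers is 1. Moreover \<open>2 * C * e\<close> is at most one half, which makes
    commutators contract.\<close>
  define e where "e = 1 / (4 * real N * C)"
  have "1 \<le> real N * C" using N C by (simp add: mult_ge1_I)
  then have e: "0 < e" "2 * C * e \<le> 1 / 2" "e \<le> 1"
    using C N by (auto simp: e_def field_simps)
  \<comment> \<open>One factor \<open>C\<close> is spent on cancelling \<open>g ^ i\<close> in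
    \<open>g ^ j\<close>, two on conjugating by \<open>h\<close>.\<close>
  have "e / C ^ 3 > 0" using e C by simp
  from bounded_pigeonhole[OF this, of "n * n" C] obtain Q :: nat where Q: "1 \<le> Q" and
    pigeon: "\<And>f. (\<And>i. i \<le> Q \<Longrightarrow> supp_le (n * n) (f i) \<and> nrm (f i) \<le> C) \<Longrightarrow>
      \<exists>i j. i < j \<and> j \<le> Q \<and> nrm (f i - f j) \<le> e / C ^ 3" by blast
  \<comment> \<open>A proportion \<open>1 / (2 * Q)\<close> of the conjugates contributes
    \<open>2 ^ K\<close> to the denominator of the product, which must outweigh a factor
    \<open>C\<close> from each conjugate.\<close>
  obtain K where K: "C ^ (2 * Q) < 2 ^ K" using real_arch_pow[of 2 "C ^ (2 * Q)"] by auto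
  have K1: "1 \<le> K"
  proof (rule ccontr)
    assume "\<not> 1 \<le> K"
    then have "K = 0" by simp
    then show False using K one_le_power[OF C, of "2 * Q"] by simp
  qed
  show ?thesis
  proof (rule exI[of _ Q], intro conjI Q allI)
    fix L R
    \<comment> \<open>\<open>m\<close> bounds the lengths of \<open>a\<close> and of its conjugate
      \<open>b\<close>; \<open>W\<close> leaves room for \<open>N\<close>-th powers of iterated
      commutators and for the products formed from them.\<close>
    define m where "m = Q * L + 2 * R"
    define W where "W = (N + 4) * (4 ^ K * m)"
    obtain l0 where l0: "\<And>X. sym_gens n X \<Longrightarrow> torsion (words X l0) \<Longrightarrow>
     (\<exists>d S S' \<rho>. d \<le> n * n \<and> place_reps C W X d S S' \<rho>)" using reps[of W] by blast
    show "\<exists>l. \<forall>X. sym_gens n X \<longrightarrow> torsion (words X l) \<longrightarrow> (\<forall>g\<in>words X L.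
     \<exists>q. 1 \<le> q \<and> q \<le> Q \<and> (\<forall>h\<in>words X R. g ^ q * (h * g ^ q * minv h) = (h * g ^ q * minv h) * g ^ q))"
    proof (rule exI[of _ "max l0 W"], intro allI impI ballI)
      fix X g
      assume X: "sym_gens n X" and tor: "torsion (words X (max l0 W))" and g: "g \<in> words X L"
      note X' = sym_gensD[OF X]
      note inv = sym_gens_inverse[OF X]
      have torl: "torsion (words X l0)" "torsion (words X W)"
        by (rule torsion_mono[OF tor words_mono[OF X'(2)]], simp)+
      obtain M where M: "M > 0" "\<And>g. g \<in> words X W \<Longrightarrow> g ^ M = 1"
        using torsion_common_exponent[OF finite_words[OF X'(1)] torl(2)] by blast
      obtain d S S' \<rho> where d: "d \<le> n * n" and pr: "place_reps C W X d S S' \<rho>"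
        using l0[OF X torl(1)] by blast
      note pr' = pr[unfolded place_reps_def]
      note S = pr'[THEN conjunct1] pr'[THEN conjunct2, THEN conjunct1] pr'[THEN conjunct2, THEN conjunct2, THEN conjunct1] pr'[THEN conjunct2, THEN conjunct2, THEN conjunct2, THEN conjunct1]
      note p5 = pr'[THEN conjunct2, THEN conjunct2, THEN conjunct2, THEN conjunct2, THEN conjunct1]
      note p6 = pr'[THEN conjunct2, THEN conjunct2, THEN conjunct2, THEN conjunct2, THEN conjunct2, THEN conjunct1]
      note p7 = pr'[THEN conjunct2, THEN conjunct2, THEN conjunct2, THEN conjunct2, THEN conjunct2, THEN conjunct2]
      have \<rho>1: "\<rho> s 1 = 1" if "s \<in> S" for s using p5 that by blast
      have \<rho>s: "supp_le d (\<rho> s u)" if "s \<in> S" "u \<in> words X W" for s u using p5 that by blast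
      have \<rho>m: "\<rho> s (u * v) = \<rho> s u * \<rho> s v" if "s \<in> S" "u \<in> words X W" "v \<in> words X W" for s u v
        using p5 that by blast
      have \<rho>b: "nrm (\<rho> s u) \<le> C" if "s \<in> S'" "u \<in> words X W" for s u using p6 that by blast
      have \<rho>f: "(\<forall>s\<in>S. \<rho> s w \<noteq> 1) \<and> (\<exists>b. (\<forall>s\<in>S. 0 \<le> b s \<and> b s \<le> C) \<and>
          (\<forall>s\<in>S. b s \<le> C * nrm (\<rho> s w - 1)) \<and> 1 \<le> (\<Prod>s\<in>S. b s))"
        if "w \<in> words X W" "w \<noteq> 1" for w
        by (rule p7[THEN bspec, THEN mp]) fact+
      have finS': "finite S'" using S finite_subset by blast
      have mW: "words X i \<subseteq> words X W" if "i \<le> (N + 4) * (4 ^ K * m)" for i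
        using that words_mono[OF X'(2)] by (simp add: W_def)
      have m4: "m \<le> 4 ^ K * m" by simp
      have mW1: "words X i \<subseteq> words X W" if "i \<le> 4 * (4 ^ K * m)" for i
        by (rule mW) (use that in \<open>simp add: algebra_simps\<close>)
      have gW: "g ^ i \<in> words X W" "minv (g ^ i) \<in> words X W" if "i \<le> Q" for i
      proof -
        have "i * L \<le> 4 * (4 ^ K * m)"
          using m4 mult_le_mono1[OF that, of L] unfolding m_def by linarith
        from mW1[OF this] show "g ^ i \<in> words X W" "minv (g ^ i) \<in> words X W"
          using words_power[OF g, of i] inv(1)[OF words_power[OF g, of i]] by blast+
      qed
      define near where "near = (\<lambda>q. {s \<in> S'. nrm (\<rho> s (g ^ q) - 1) \<le> e / C ^ 2})"
      have "\<exists>q\<in>{1..Q}. s \<in> near q" if s: "s \<in> S'" for s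
      proof -
        have sS: "s \<in> S" using s S by blast
        have "supp_le (n * n) (\<rho> s (g ^ i)) \<and> nrm (\<rho> s (g ^ i)) \<le> C" if "i \<le> Q" for i
          using supp_le_mono[OF \<rho>s[OF sS gW(1)[OF that]] d] \<rho>b[OF s gW(1)[OF that]] by blast
        from pigeon[of "\<lambda>i. \<rho> s (g ^ i)", OF this] obtain i j where
          ij: "i < j" "j \<le> Q" "nrm (\<rho> s (g ^ i) - \<rho> s (g ^ j)) \<le> e / C ^ 3" by blast
        let ?q = "j - i" and ?v = "minv (g ^ i)"
        note iv = inv[OF words_power[OF g, of i]]
        have "g ^ j = g ^ i * g ^ ?q" using ij(1) by (simp flip: power_add)
        then have "?v * g ^ j = g ^ ?q" using iv(3) by (simp add: mult.assoc[symmetric])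
        then have "\<rho> s (g ^ ?q) - 1 = \<rho> s ?v * (\<rho> s (g ^ j) - \<rho> s (g ^ i))"
          using \<rho>m[OF sS gW(2) gW(1), of i j] \<rho>m[OF sS gW(2) gW(1), of i i] ij iv(3) \<rho>1[OF sS]
          by (simp add: right_diff_distrib)
        then have "nrm (\<rho> s (g ^ ?q) - 1) \<le> nrm (\<rho> s ?v) * nrm (\<rho> s (g ^ j) - \<rho> s (g ^ i))"
          by (metis nrm_mult)
        also have "\<dots> \<le> C * (e / C ^ 3)"
          using \<rho>b[OF s gW(2), of i] ij C by (intro mult_mono) (auto simp: nrm_minus_commute)
        also have "\<dots> = e / C ^ 2" using C by (simp add: power3_eq_cube power2_eq_square)
        finally show ?thesis using s ij by (intro bexI[of _ ?q]) (auto simp: near_def)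
      qed
      then have cov: "S' \<subseteq> (\<Union>q\<in>{1..Q}. near q)" by blast
      \<comment> \<open>Averaging over the \<open>Q\<close> exponents: one of them works on at least
        \<open>1 / Q\<close> of \<open>S'\<close>, hence on at least \<open>1 / (2 * Q)\<close> of
        all conjugates.\<close>
      have "\<exists>q\<in>{1..Q}. card S' \<le> Q * card (near q)"
      proof (rule ccontr)
        assume neg: "\<not> ?thesis"
        have "card S' \<le> card (\<Union>q\<in>{1..Q}. near q)"
          using finS' by (intro card_mono cov) (auto simp: near_def)
        also have "\<dots> \<le> (\<Sum>q\<in>{1..Q}. card (near q))" by (rule card_UN_le) simp
        finally have "Q * card S' \<le> (\<Sum>q\<in>{1..Q}. Q * card (near q))"
          by (simp flip: sum_distrib_left)
        also have "\<dots> < (\<Sum>q\<in>{1..Q}. card S')"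
        proof (rule sum_strict_mono)
          show "Q * card (near q) < card S'" if "q \<in> {1..Q}" for q
            using neg that by (meson not_le_imp_less)
        qed (use Q in auto)
        finally show False by simp
      qed
      then obtain q where q: "1 \<le> q" "q \<le> Q" "card S' \<le> Q * card (near q)" by auto
      have nearS: "near q \<subseteq> S" "near q \<subseteq> S'" using S by (auto simp: near_def)
      have cardS: "card S \<le> 2 * Q * card (near q)" using S(4) q(3) by simp
      have near0: "card (near q) > 0"
        using cardS S(1,2) by (metis card_gt_0_iff gr0I le_zero_eq mult_0_right)
      then obtain s0 where s0: "s0 \<in> near q" by (metis card_gt_0_iff ex_in_conv)
      show "\<exists>q. 1 \<le> q \<and> q \<le> Q \<and> (\<forall>h\<in>words X R. g ^ q * (h * g ^ q * minv h) = (h * g ^ q * minv h) * g ^ q)"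
      proof (intro exI[of _ q] conjI q(1,2) ballI)
        fix h assume h: "h \<in> words X R"
        note ih = inv[OF h]
        define a b where "a = g ^ q" and "b = h * a * minv h"
        define A where "A = {a, b}"
        have am: "a \<in> words X (Q * L)"
          using words_power[OF g, of q] words_mono[OF X'(2) mult_le_mono1[OF q(2), of L]]
          unfolding a_def by blast
        have "b \<in> words X (R + Q * L + R)"
          unfolding b_def by (intro words_mult h am ih)
        then have bm: "b \<in> words X m" by (simp add: m_def add_ac mult_2)
        have "words X (Q * L) \<subseteq> words X m" by (rule words_mono[OF X'(2)]) (simp add: m_def)
        then have A: "A \<subseteq> words X m" using am bm by (auto simp: A_def)
        have AW: "iter_comms A j \<subseteq> words X (4 ^ K * m)" if "j \<le> K" for j
        proof -
          have "4 ^ j * m \<le> 4 ^ K * m" using that by (intro mult_le_mono1 power_increasing) auto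
          then show ?thesis using iter_comms_words[OF X A, of j] words_mono[OF X'(2)] by blast
        qed
        have AW': "y \<in> words X (4 ^ K * m)" if "y \<in> A" for y using AW[of 0] that by auto
        have hW: "h \<in> words X W" "minv h \<in> words X W" "a \<in> words X W" "a * minv h \<in> words X W"
        proof -
          have "R \<le> 4 * (4 ^ K * m)" "Q * L \<le> 4 * (4 ^ K * m)" "Q * L + R \<le> 4 * (4 ^ K * m)"
            using m4 unfolding m_def by linarith+
          then show "h \<in> words X W" "minv h \<in> words X W" "a \<in> words X W" "a * minv h \<in> words X W"
            using mW1 h ih(1) am words_mult[OF am ih(1)] by blast+
        qed
        have nA: "nrm (\<rho> s y - 1) \<le> e" if s: "s \<in> near q" and y: "y \<in> A" for s y
        proof -
          have sS: "s \<in> S" "s \<in> S'" using s nearS by auto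
          have na: "nrm (\<rho> s a - 1) \<le> e / C ^ 2" using s by (simp add: near_def a_def)
          have "\<rho> s b - 1 = \<rho> s h * (\<rho> s a - 1) * \<rho> s (minv h)"
            using \<rho>m[OF sS(1) hW(1,4)] \<rho>m[OF sS(1) hW(3,2)] \<rho>m[OF sS(1) hW(1,2)] ih(2) \<rho>1[OF sS(1)]
            by (simp add: b_def algebra_simps)
          then have "nrm (\<rho> s b - 1) \<le> nrm (\<rho> s h) * nrm (\<rho> s a - 1) * nrm (\<rho> s (minv h))"
            by (metis nrm_mult mult_right_mono nrm_nonneg order_trans)
          also have "\<dots> \<le> C * (e / C ^ 2) * C"
            using \<rho>b[OF sS(2)] hW na C e by (intro mult_mono) auto
          also have "\<dots> = e" using C by (simp add: power2_eq_square)
          finally have nb: "nrm (\<rho> s b - 1) \<le> e" .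
          have "e / C ^ 2 \<le> e" using C e by (simp add: field_simps one_le_power)
          then show ?thesis using na nb y by (auto simp: A_def)
        qed
        have nI: "nrm (\<rho> s x - 1) \<le> e * (1 / 2) ^ j"
          if "s \<in> near q" "x \<in> iter_comms A j" "j \<le> K" for s x j
          using that
        proof (induction j arbitrary: x)
          case 0
          then show ?case using nA by simp
        next
          case (Suc j)
          have sS: "s \<in> S" "s \<in> S'" using Suc.prems(1) nearS by auto
          obtain u y where x: "x = mcomm u y" "u \<in> iter_comms A j" "y \<in> A" using Suc.prems(2) by auto
          have u: "u \<in> words X (4 ^ K * m)" and y: "y \<in> words X (4 ^ K * m)"
            using AW[of j] x Suc.prems(3) AW' by auto
          have W2: "u \<in> words X W" "y \<in> words X W" "u * y \<in> words X W" "y * u \<in> words X W"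
            "minv u * minv y \<in> words X W"
            using u y words_mult[OF u y] words_mult[OF y u] words_mult[OF inv(1)[OF u] inv(1)[OF y]]
              mW1[of "4 ^ K * m"] mW1[of "4 ^ K * m + 4 ^ K * m"] by auto
          have xe: "x = (u * y) * (minv u * minv y)" by (simp add: x(1) mcomm_def mult.assoc)
          have "y * u * (minv u * minv y) = y * (u * minv u) * minv y" by (simp only: mult.assoc)
          then have one: "y * u * (minv u * minv y) = 1" using inv[OF u] inv[OF y] by simp
          let ?U = "\<rho> s u" and ?Y = "\<rho> s y" and ?V = "\<rho> s (minv u * minv y)"
          have "\<rho> s x - 1 = (?U * ?Y - ?Y * ?U) * ?V"
            using \<rho>m[OF sS(1) W2(3,5)] \<rho>m[OF sS(1) W2(4,5)] \<rho>m[OF sS(1) W2(1,2)] \<rho>m[OF sS(1) W2(2,1)]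
              one \<rho>1[OF sS(1)] by (simp add: xe left_diff_distrib)
          \<comment> \<open>Subtracting 1 does not change a commutator, so the difference is
            quadratically small.\<close>
          also have "?U * ?Y - ?Y * ?U = (?U - 1) * (?Y - 1) - (?Y - 1) * (?U - 1)"
            by (simp add: algebra_simps)
          finally have "nrm (\<rho> s x - 1) \<le> nrm ((?U - 1) * (?Y - 1) - (?Y - 1) * (?U - 1)) * nrm ?V"
            by (simp add: nrm_mult)
          also have "\<dots> \<le> (2 * (nrm (?U - 1) * nrm (?Y - 1))) * nrm ?V"
          proof (intro mult_right_mono nrm_nonneg)
            have "nrm ((?U - 1) * (?Y - 1) - (?Y - 1) * (?U - 1)) \<le> nrm ((?U - 1) * (?Y - 1)) + nrm ((?Y - 1) * (?U - 1))"
              by (rule nrm_diff)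
            also have "\<dots> \<le> nrm (?U - 1) * nrm (?Y - 1) + nrm (?Y - 1) * nrm (?U - 1)"
              by (intro add_mono nrm_mult)
            finally show "nrm ((?U - 1) * (?Y - 1) - (?Y - 1) * (?U - 1)) \<le> 2 * (nrm (?U - 1) * nrm (?Y - 1))"
              by simp
          qed
          also have "\<dots> \<le> (2 * ((e * (1 / 2) ^ j) * e)) * C"
            using Suc.IH[OF Suc.prems(1) x(2)] Suc.prems(1,3) nA[OF _ x(3)] \<rho>b[OF sS(2) W2(5)] e C
            by (intro mult_mono) auto
          also have "\<dots> = (e * (1 / 2) ^ j) * (2 * C * e)" by simp
          also have "\<dots> \<le> (e * (1 / 2) ^ j) * (1 / 2)" using e by (intro mult_left_mono) auto
          finally show ?case by simp
        qed
        \<comment> \<open>For a nontrivial \<open>w\<close>, the factors on \<open>near q\<close>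
          are at most \<open>C / 2 ^ K\<close> and the others at most \<open>C\<close>, so their
          product would be less than 1.\<close>
        have top: "iter_comms A K \<subseteq> {1}"
        proof
          fix w assume w: "w \<in> iter_comms A K"
          show "w \<in> {1}"
          proof (rule ccontr)
            assume "w \<notin> {1}"
            moreover have "w \<in> words X W" using w AW[of K] mW1[of "4 ^ K * m"] by auto
            ultimately obtain \<beta> where \<beta>: "\<And>s. s \<in> S \<Longrightarrow> 0 \<le> \<beta> s \<and> \<beta> s \<le> C"
              "\<And>s. s \<in> S \<Longrightarrow> \<beta> s \<le> C * nrm (\<rho> s w - 1)" "1 \<le> (\<Prod>s\<in>S. \<beta> s)"
              using \<rho>f[of w] by blast
            let ?D = "near q"
            have fD: "finite ?D" using S(1) nearS finite_subset by blast
            have small: "\<beta> s \<le> C * (1 / 2) ^ K" if "s \<in> ?D" for s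
            proof -
              have "nrm (\<rho> s w - 1) \<le> e * (1 / 2) ^ K" by (rule nI[OF that w]) simp
              also have "\<dots> \<le> 1 * (1 / 2) ^ K" using e by (intro mult_right_mono) auto
              finally have "C * nrm (\<rho> s w - 1) \<le> C * (1 / 2) ^ K" using C by simp
              then show ?thesis using \<beta>(2)[of s] nearS that by fastforce
            qed
            have "(\<Prod>s\<in>S. \<beta> s) = (\<Prod>s\<in>S - ?D. \<beta> s) * (\<Prod>s\<in>?D. \<beta> s)"
              by (rule prod.subset_diff[OF nearS(1) S(1)])
            also have "\<dots> \<le> (\<Prod>s\<in>S - ?D. C) * (\<Prod>s\<in>?D. C * (1 / 2) ^ K)"
              using \<beta>(1) nearS small C by (intro mult_mono prod_mono prod_nonneg) auto
            also have "\<dots> = C ^ (card (S - ?D) + card ?D) * ((1 / 2) ^ K) ^ card ?D"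
              by (simp add: power_add power_mult_distrib)
            also have "card (S - ?D) + card ?D = card S"
              using card_Diff_subset[OF fD nearS(1)] card_mono[OF S(1) nearS(1)] by simp
            also have "C ^ card S * ((1 / 2) ^ K) ^ card ?D \<le> C ^ (2 * Q * card ?D) * ((1 / 2) ^ K) ^ card ?D"
              using C cardS by (intro mult_right_mono power_increasing) auto
            also have "\<dots> = (C ^ (2 * Q) / 2 ^ K) ^ card ?D"
              by (simp add: power_mult power_divide)
            also have "\<dots> < 1" using K C near0 by (subst power_less_one_iff) (auto simp: divide_less_eq)
            finally show False using \<beta>(3) by simp
          qed
        qed
        \<comment> \<open>If the next level is trivial, \<open>z\<close> commutes with
          \<open>A\<close>, hence with both entries of the commutator that it is. Its order is then
          bounded by \<open>n!\<close>, and being near 1 at the conjugate \<open>s0\<close> it is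
          1.\<close>
        have step: "iter_comms A (Suc i) \<subseteq> {1}" if le: "Suc (Suc i) \<le> K" and one: "iter_comms A (Suc (Suc i)) \<subseteq> {1}" for i
        proof
          fix z assume z: "z \<in> iter_comms A (Suc i)"
          have zK: "z \<in> words X (4 ^ K * m)" using z AW[of "Suc i"] le by auto
          obtain u y where uy: "z = mcomm u y" "u \<in> iter_comms A i" "y \<in> A" using z by auto
          have u: "u \<in> words X (4 ^ K * m)" and y: "y \<in> words X (4 ^ K * m)"
            using AW[of i] uy le AW' by auto
          have zA: "z * v = v * z" if v: "v \<in> A" for v
          proof -
            have "mcomm z v \<in> iter_comms A (Suc (Suc i))"
              unfolding iter_comms.simps(2)[of A "Suc i"] using z v by blast
            then have "mcomm z v = 1" using one by blast
            then show ?thesis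
              using mcomm_eq_1_iff(1) inv[OF zK] inv[OF AW'[OF v]] by blast
          qed
          have zu: "z * u = u * z" by (rule iter_comms_commute[OF X A zA uy(2)])
          have inW: "w \<in> words X W" if "w \<in> words X (4 ^ K * m)" for w
            using that mW1[of "4 ^ K * m"] by auto
          have uyz: "u * y = z * y * u"
            unfolding uy(1) by (rule mcomm_eq_1_iff(2)) (use inv[OF u] inv[OF y] in auto)
          have zN: "z ^ N = 1"
            unfolding N_def
            by (rule central_commutator_exponent[OF _ M(2)[OF inW[OF u]] _ _ M(2)[OF inW[OF y]] _ _ M(2)[OF inW[OF zK]] M(1) uyz zu zA[OF uy(3)]])
              (use sym_gens_words[OF X u] sym_gens_words[OF X y] sym_gens_words[OF X zK] in auto)
          have sS: "s0 \<in> S" "s0 \<in> S'" using s0 nearS by auto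
          let ?Z = "\<rho> s0 z"
          have zi: "z ^ i \<in> words X W" if "i \<le> N" for i
          proof -
            have "i * (4 ^ K * m) \<le> (N + 4) * (4 ^ K * m)" using that by (intro mult_le_mono1) simp
            from mW[OF this] show ?thesis using words_power[OF zK, of i] by blast
          qed
          have Zi: "\<rho> s0 (z ^ i) = ?Z ^ i" if "i \<le> N" for i
            using that
          proof (induction i)
            case (Suc i)
            then show ?case using \<rho>m[OF sS(1) inW[OF zK] zi[of i]] by simp
          qed (simp add: \<rho>1[OF sS(1)])
          have "?Z = 1"
          proof (rule small_root_of_1[where N = N and C = C])
            show "?Z ^ N = 1" using Zi[of N] zN \<rho>1[OF sS(1)] by simp
            show "nrm (?Z ^ i) \<le> C" if "i < N" for i
              using \<rho>b[OF sS(2) zi[of i]] Zi[of i] that by simp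
            have "nrm (?Z - 1) \<le> e * (1 / 2) ^ Suc i" by (rule nI[OF s0 z]) (use le in simp)
            also have "\<dots> \<le> e * 1" using e by (intro mult_left_mono power_le_one) auto
            finally show "nrm (?Z - 1) \<le> 1 / (4 * real N * C)" by (simp add: e_def)
          qed (use N C in auto)
          then show "z \<in> {1}" using \<rho>f[OF inW[OF zK]] sS(1) by blast
        qed
        \<comment> \<open>The descent stops at level 1, which contains the commutator of
          \<open>a\<close> and \<open>b\<close>; its step applies only to elements that are
          commutators.\<close>
        have "iter_comms A 1 \<subseteq> {1}"
          using K1
        proof (rule inc_induct)
          show "iter_comms A K \<subseteq> {1}" by (rule top)
          fix i assume i: "1 \<le> i" "i < K" "iter_comms A (Suc i) \<subseteq> {1}"
          then obtain i' where "i = Suc i'" by (cases i) auto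
          then show "iter_comms A i \<subseteq> {1}" using step[of i'] i by simp
        qed
        moreover have "mcomm a b \<in> iter_comms A 1" by (auto simp: A_def)
        ultimately have "mcomm a b = 1" by blast
        then have "a * b = b * a"
          using mcomm_eq_1_iff(1) inv[OF AW'[of a]] inv[OF AW'[of b]] by (auto simp: A_def)
        then show "g ^ q * (h * g ^ q * minv h) = (h * g ^ q * minv h) * g ^ q"
          by (simp add: a_def b_def)
      qed
    qed
  qed
qed

section \<open>Groups with bounded powers central\<close>

lemma card_nth_roots_le: "P > 0 \<Longrightarrow> finite {z::complex. z ^ P = a} \<and> card {z::complex. z ^ P = a} \<le> P"
  by (cases "a = 0") (auto simp: card_nth_roots finite_nth_roots)

text \<open>Eigenvalues of \<open>x\<close> are \<open>P\<close>-th roots of those of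
  \<open>v\<close>, at most \<open>n * P\<close> candidates, and the trace is determined by their
  multiplicities. \<open>M\<close> does not enter the count.\<close>

lemma trace_values:
  assumes v: "supp_le n v" and P: "P > 0" and M: "M > 0"
  obtains T where "finite T" "card T \<le> (n + 1) ^ (n * P)"
    "\<And>x. supp_le n x \<Longrightarrow> scal x = 1 \<Longrightarrow> x ^ M = 1 \<Longrightarrow> x ^ P = v \<Longrightarrow> tr n x \<in> T"
proof -
  obtain A where A: "finite A" "card A \<le> n"
    "\<And>E c. supp_le n E \<Longrightarrow> scal E = 0 \<Longrightarrow> E \<noteq> 0 \<Longrightarrow> v * E = cscal c * E \<Longrightarrow> c \<in> A"
    using finite_eigenvalues[OF v] by metis
  define R where "R = (\<Union>a\<in>A. {z. z ^ P = a})"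
  have finR: "finite R" unfolding R_def using A(1) card_nth_roots_le[OF P] by blast
  have "card R \<le> (\<Sum>a\<in>A. card {z::complex. z ^ P = a})" unfolding R_def by (rule card_UN_le[OF A(1)])
  also have "\<dots> \<le> (\<Sum>a\<in>A. P)" by (rule sum_mono) (use card_nth_roots_le[OF P] in blast)
  also have "\<dots> \<le> n * P" using A(2) by simp
  finally have cR: "card R \<le> n * P" .
  \<comment> \<open>The multiplicity of the eigenvalue 1 is eliminated through the total
    \<open>n\<close>, since the projection for \<open>c = 1\<close> has scalar part 1 and
    \<open>idempotent_trace\<close> does not apply to it.\<close>
  define f where "f = (\<lambda>m. of_nat n + (\<Sum>c\<in>R. (c - 1) * of_nat (m c)) :: complex)"
  define T where "T = f ` (R \<rightarrow>\<^sub>E {..n})"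
  show thesis
  proof (rule that[of T])
    show "finite T" unfolding T_def using finR by (intro finite_imageI finite_PiE) auto
    have "card T \<le> card (R \<rightarrow>\<^sub>E {..n})" unfolding T_def using finR by (intro card_image_le finite_PiE) auto
    also have "\<dots> = (n + 1) ^ card R" using finR by (simp add: card_funcsetE)
    also have "\<dots> \<le> (n + 1) ^ (n * P)" using cR by (intro power_increasing) auto
    finally show "card T \<le> (n + 1) ^ (n * P)" .
    fix x assume x: "supp_le n x" "scal x = 1" "x ^ M = 1" "x ^ P = v"
    let ?p = "\<lambda>c. eproj M c x"
    have m: "\<exists>m\<le>n. tr n (?p c) = of_nat m" if "c \<in> rou M" "c \<noteq> 1" for c
    proof -
      have "supp_le n (?p c)" "scal (?p c) = 0" "?p c * ?p c = ?p c"
        using x that M by (simp_all add: scal_eproj eproj_idem)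
      from idempotent_trace[OF this] show ?thesis by metis
    qed
    then obtain m where m: "\<And>c. c \<in> rou M \<Longrightarrow> c \<noteq> 1 \<Longrightarrow> m c \<le> n \<and> tr n (?p c) = of_nat (m c)"
      by metis
    have R: "?p c = 0" if "c \<in> rou M" "c \<noteq> 1" "c \<notin> R" for c
    proof (rule ccontr)
      assume "?p c \<noteq> 0"
      moreover have "v * ?p c = cscal (c ^ P) * ?p c"
        using eigen_power[OF eproj_eigen[OF x(3) that(1) M], of P] x(4) by simp
      ultimately have "c ^ P \<in> A" using x that M by (intro A(3)) (simp_all add: scal_eproj)
      then show False using that(3) by (auto simp: R_def)
    qed
    have "tr n x = (\<Sum>c\<in>rou M. tr n (x * ?p c))"
      by (simp add: sum_eproj[OF M] flip: tr_sum sum_distrib_left)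
    also have "\<dots> = (\<Sum>c\<in>rou M. c * tr n (?p c))"
      by (intro sum.cong refl) (simp add: eproj_eigen[OF x(3) _ M] tr_cscal_mult)
    also have "\<dots> = (\<Sum>c\<in>rou M. tr n (?p c)) + (\<Sum>c\<in>rou M. (c - 1) * tr n (?p c))"
      by (simp add: algebra_simps sum.distrib[symmetric])
    also have "(\<Sum>c\<in>rou M. tr n (?p c)) = of_nat n"
      by (simp add: sum_eproj[OF M] flip: tr_sum)
    also have "(\<Sum>c\<in>rou M. (c - 1) * tr n (?p c)) = (\<Sum>c\<in>rou M \<inter> R. (c - 1) * tr n (?p c))"
    proof (rule sum.mono_neutral_right)
      show "\<forall>c\<in>rou M - rou M \<inter> R. (c - 1) * tr n (?p c) = 0" using R by fastforce
    qed (use finite_rou[OF M] in auto)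
    also have "\<dots> = (\<Sum>c\<in>R. (c - 1) * of_nat (if c \<in> rou M \<and> c \<noteq> 1 then m c else 0))"
    proof (rule sum.mono_neutral_cong_left)
      show "(c - 1) * tr n (?p c) = (c - 1) * of_nat (if c \<in> rou M \<and> c \<noteq> 1 then m c else 0)"
        if "c \<in> rou M \<inter> R" for c
        using m[of c] that by (cases "c = 1") auto
    qed (use finR in auto)
    finally have "tr n x = f (restrict (\<lambda>c. if c \<in> rou M \<and> c \<noteq> 1 then m c else 0) R)"
      by (simp add: f_def cong: sum.cong)
    moreover have "restrict (\<lambda>c. if c \<in> rou M \<and> c \<noteq> 1 then m c else 0) R \<in> R \<rightarrow>\<^sub>E {..n}"
      using m by auto
    ultimately show "tr n x \<in> T" unfolding T_def by blast
  qed
qed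

lemma power_mult_commuting:
  fixes a b :: "'a::monoid_mult"
  assumes "a * b = b * a"
  shows "(a * b) ^ k = a ^ k * b ^ k"
proof (induction k)
  case (Suc k)
  have "b * a ^ k = a ^ k * b" using commute_power[of b a k] assms by simp
  then have "a * (b * a ^ k) * b ^ k = a * (a ^ k * b) * b ^ k" by simp
  then show ?case using Suc by (simp add: mult.assoc)
qed simp

text \<open>A coset of the center is determined by the elements \<open>g * s * minv g\<close>, and
  these by their traces on a frame. Each such trace takes at most \<open>B\<close> values, because a
  fixed power of \<open>x i * (g * s * minv g) * y j\<close> does not depend on
  \<open>g\<close>.\<close>

lemma central_powers_index:
  assumes Q: "Q > 0"
  shows "\<exists>L J l. \<forall>X. sym_gens n X \<longrightarrow> card X \<le> r \<longrightarrow> torsion (words X l) \<longrightarrow>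
    (\<forall>w\<in>words X L. \<forall>s\<in>X. w ^ Q * s = s * w ^ Q) \<longrightarrow>
    (\<exists>j\<le>J. \<forall>g\<in>words X (Suc j). \<exists>t\<in>words X j. \<exists>h\<in>schreier X j X. g = t * h)"
proof -
  define N :: nat where "N = fact n"
  define B where "B = (n + 1) ^ (n * (Q * N))"
  \<comment> \<open>The number of possible tuples of traces: there are at most \<open>n * n\<close>
    choices for each of \<open>i\<close> and \<open>j\<close>, and at most \<open>r\<close> for the
    letter \<open>s\<close>.\<close>
  define J where "J = B ^ (n * n * (n * n * r))"
  \<comment> \<open>\<open>p\<close> is the length of a conjugate of a letter, \<open>W\<close>
    allows two of them to be compared, and \<open>L\<close> accommodates the words
    \<open>x i * (g * s * minv g) * y j\<close>. \<open>l\<close> also covers the quotient of two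
    \<open>Q\<close>-th powers of these.\<close>
  define p where "p = Suc J + 1 + Suc J"
  define W where "W = 2 * p"
  define L where "L = 2 * (n * n * W) + p"
  define l where "l = W + L + 2 * (Q * L)"
  have B1: "1 \<le> B" unfolding B_def by (rule one_le_power) simp
  show ?thesis
  proof (rule exI[of _ L], rule exI[of _ J], rule exI[of _ l], intro allI impI)
    fix X assume X: "sym_gens n X" and cX: "card X \<le> r" and tor: "torsion (words X l)"
      and central: "\<forall>w\<in>words X L. \<forall>s\<in>X. w ^ Q * s = s * w ^ Q"
    note X' = sym_gensD[OF X]
    note inv = sym_gens_inverse[OF X]
    obtain M where M: "M > 0" "\<And>g. g \<in> words X l \<Longrightarrow> g ^ M = 1"
      using torsion_common_exponent[OF finite_words[OF X'(1)] tor] by blast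
    have inl: "words X i \<subseteq> words X l" if "i \<le> W \<or> i \<le> L \<or> i \<le> 2 * (Q * L)" for i
      using that by (intro words_mono[OF X'(2)]) (auto simp: l_def)
    obtain k d x y where kd: "k \<le> n * n * W" "d \<le> n * n" and f: "frame n X k W d x y"
      using frame_exists[OF X] by metis
    note F = frameD[OF f]
    define I where "I = {..<d} \<times> {..<d} \<times> X"
    have conj_words: "g * s * minv g \<in> words X p" if "g \<in> words X (Suc J)" "s \<in> X" for g s
      unfolding p_def by (intro words_mult that words_letter inv(1)[OF that(1)])
    have inL: "words X (k + p + k) \<subseteq> words X L"
      using kd(1) by (intro words_mono[OF X'(2)]) (simp add: L_def)
    have "\<exists>T. finite T \<and> card T \<le> B \<and> (\<forall>g\<in>words X (Suc J). tr n (x i * (g * s * minv g) * y j) \<in> T)"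
      if ij: "i < d" "j < d" and s: "s \<in> X" for i j s
    proof -
      define w1 where "w1 = x i * s * y j"
      have "k + 1 + k \<le> k + p + k" by (simp add: p_def)
      moreover have "w1 \<in> words X (k + 1 + k)"
        unfolding w1_def by (intro words_mult words_letter F ij s)
      ultimately have w1: "w1 \<in> words X L"
        using inL words_mono[OF X'(2)] by blast
      have "supp_le n (w1 ^ (Q * N))" using sym_gens_words(1)[OF X w1] by simp
      from trace_values[OF this, of "Q * N" M] Q M(1) obtain T where
        T: "finite T" "card T \<le> B"
        "\<And>w. supp_le n w \<Longrightarrow> scal w = 1 \<Longrightarrow> w ^ M = 1 \<Longrightarrow> w ^ (Q * N) = w1 ^ (Q * N) \<Longrightarrow> tr n w \<in> T"
        unfolding B_def N_def by (metis fact_gt_zero nat_0_less_mult_iff)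
      have "tr n (x i * (g * s * minv g) * y j) \<in> T" if g: "g \<in> words X (Suc J)" for g
      proof -
        define w where "w = x i * (g * s * minv g) * y j"
        have "w \<in> words X (k + p + k)" unfolding w_def by (intro words_mult F ij conj_words g s)
        then have w: "w \<in> words X L" using inL by blast
        have q1: "w1 ^ Q \<in> words X (Q * L)" and qw: "w ^ Q \<in> words X (Q * L)"
          using words_power w1 w by blast+
        \<comment> \<open>Both powers commute with \<open>X\<close> by hypothesis, so their quotient
          \<open>z\<close> does too; comparing determinants on its eigenspaces bounds its
          order.\<close>
        define z where "z = w ^ Q * minv (w1 ^ Q)"
        have z: "z \<in> words X (Q * L + Q * L)" unfolding z_def by (intro words_mult qw inv(1)[OF q1])
        have zX: "z * s = s * z" if s: "s \<in> X" for s
        proof -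
          have "s * w1 ^ Q = w1 ^ Q * s" "s * w ^ Q = w ^ Q * s" using central w1 w s by auto
          then have "s * z = z * s"
            unfolding z_def by (intro commute_mult commute_minv inv[OF q1])
          then show ?thesis by simp
        qed
        have zw: "z * u = u * z" if "u \<in> words X i" for u i
          by (rule words_commute[OF _ that]) (use zX in blast)
        have eq: "w ^ Q = z * w1 ^ Q" using inv(3)[OF q1] by (simp add: z_def mult.assoc)
        have zM: "z ^ M = 1" by (rule M(2)) (use z inl[of "Q * L + Q * L"] in auto)
        have w1M: "w1 ^ M = 1" and wM: "w ^ M = 1" using M(2) inl[of L] w1 w by auto
        have ws: "w = x i * g * s * minv g * y j" by (simp add: w_def mult.assoc)
        have sw: "s \<in> words X 1" by (rule words_letter[OF s])
        note supp = sym_gens_words(1)[OF X F(1)[OF ij(1)]] sym_gens_words(1)[OF X sw]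
          sym_gens_words(1)[OF X F(2)[OF ij(2)]] sym_gens_words(1)[OF X g] sym_gens_words(1)[OF X inv(1)[OF g]]
        note comm = zw[OF F(1)[OF ij(1)]] zw[OF sw] zw[OF F(2)[OF ij(2)]] zw[OF g] zw[OF inv(1)[OF g]]
        have "z ^ N = 1"
          unfolding N_def
          by (rule central_quotient_exponent[OF supp sym_gens_words[OF X z] zM M(1) comm inv(2)[OF g]
                w1M[unfolded w1_def] eq[unfolded ws w1_def]])
        \<comment> \<open>This power is now the same for all \<open>g\<close>, so all the traces lie
          in the one set attached to \<open>w1\<close>.\<close>
        then have "w ^ (Q * N) = w1 ^ (Q * N)"
          using power_mult_commuting[of z "w1 ^ Q" N] zw[OF q1] by (simp add: power_mult eq)
        then show ?thesis
          unfolding w_def[symmetric] using T(3) sym_gens_words[OF X w] wM by blast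
      qed
      then show ?thesis using T by blast
    qed
    then have "\<forall>q\<in>I. \<exists>T. finite T \<and> card T \<le> B \<and>
        (\<forall>g\<in>words X (Suc J). tr n (x (fst q) * (g * snd (snd q) * minv g) * y (fst (snd q))) \<in> T)"
      by (auto simp: I_def)
    from bchoice[OF this] obtain T where T: "\<And>q. q \<in> I \<Longrightarrow> finite (T q)" "\<And>q. q \<in> I \<Longrightarrow> card (T q) \<le> B"
      "\<And>q g. q \<in> I \<Longrightarrow> g \<in> words X (Suc J) \<Longrightarrow> tr n (x (fst q) * (g * snd (snd q) * minv g) * y (fst (snd q))) \<in> T q"
      by blast
    define \<phi> where "\<phi> = (\<lambda>g. restrict (\<lambda>q. tr n (x (fst q) * (g * snd (snd q) * minv g) * y (fst (snd q)))) I)"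
    have finI: "finite I" using X' by (simp add: I_def)
    have "card I = d * (d * card X)" by (simp add: I_def card_cartesian_product)
    also have "\<dots> \<le> (n * n) * ((n * n) * r)" by (intro mult_le_mono kd cX)
    finally have cI: "card I \<le> n * n * (n * n * r)" by simp
    have "\<phi> ` words X (Suc J) \<subseteq> PiE I T"
    proof (rule image_subsetI)
      fix g assume g: "g \<in> words X (Suc J)"
      show "\<phi> g \<in> PiE I T"
        unfolding \<phi>_def by (rule restrict_PiE_iff[THEN iffD2], intro ballI T(3)[OF _ g])
    qed
    then have "card (\<phi> ` words X (Suc J)) \<le> card (PiE I T)"
      using finI T(1) by (intro card_mono finite_PiE)
    also have "\<dots> = (\<Prod>q\<in>I. card (T q))" by (rule card_PiE[OF finI])
    also have "\<dots> \<le> (\<Prod>q\<in>I. B)" by (intro prod_mono) (use T(2) in auto)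
    also have "\<dots> \<le> J" unfolding J_def using cI B1 by (auto intro: power_increasing)
    finally obtain j where j: "j \<le> J" "\<phi> ` words X (Suc j) \<subseteq> \<phi> ` words X j"
      using image_words_stall[OF X'] by metis
    have torW: "torsion (words X W)" by (rule torsion_mono[OF tor inl]) simp
    have "\<exists>t\<in>words X j. \<exists>h\<in>schreier X j X. g = t * h" if g: "g \<in> words X (Suc j)" for g
    proof -
      obtain t where t: "t \<in> words X j" "\<phi> g = \<phi> t" using j(2) g by blast
      have gJ: "g \<in> words X (Suc J)" "t \<in> words X (Suc J)"
        by (rule subsetD[OF words_mono[OF X'(2)] g] subsetD[OF words_mono[OF X'(2)] t(1)];
          use j(1) in simp)+
      have "g * s * minv g = t * s * minv t" if s: "s \<in> X" for s
      proof (rule frame_separates[OF X f _ _ _ _ torW])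
        show "g * s * minv g \<in> words X p" "t * s * minv t \<in> words X p" using conj_words gJ s by auto
        show "2 * p \<le> W" by (simp add: W_def)
        show "tr n (x i * (g * s * minv g) * y i') = tr n (x i * (t * s * minv t) * y i')"
          if "i < d" "i' < d" for i i'
          using fun_cong[OF t(2), of "(i, i', s)"] that s by (simp add: \<phi>_def I_def)
      qed
      then have "\<exists>h\<in>schreier X j X. g = t * h" by (rule conj_eq_imp_coset[OF X g t(1)])
      then show ?thesis using t(1) by blast
    qed
    then show "\<exists>j\<le>J. \<forall>g\<in>words X (Suc j). \<exists>t\<in>words X j. \<exists>h\<in>schreier X j X. g = t * h"
      using j(1) by blast
  qed
qed

section \<open>Groups whose short words have finite order are finite\<close>

text \<open>Induction on \<open>t\<close>, where \<open>n + 1 - t\<close> is a lower bound for the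
  number of idempotents commuting with \<open>X\<close>; at \<open>t = 0\<close> there would be more
  than \<open>n\<close>. \<open>r\<close> is arbitrary because the Schreier generators of a
  centralizer may outnumber \<open>X\<close>.\<close>

lemma finite_if_short_torsion:
  assumes n: "n > 0"
  shows "\<exists>l. \<forall>X F. sym_gens n X \<longrightarrow> card X \<le> r \<longrightarrow> orth_fam n F \<longrightarrow> n + 1 - t \<le> card F \<longrightarrow>
    (\<forall>x\<in>X. \<forall>E\<in>F. E * x = x * E) \<longrightarrow> torsion (words X l) \<longrightarrow> finite (\<Union>k. words X k)"
proof (induction t arbitrary: r)
  case 0
  have "\<not> n + 1 - 0 \<le> card F" if "orth_fam n F" for F using orth_fam_card[OF that] by simp
  then show ?case by blast
next
  case (Suc t)
  obtain Q where Q: "Q \<ge> 1" and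
    conjs: "\<And>L R. \<exists>l. \<forall>X. sym_gens n X \<longrightarrow> torsion (words X l) \<longrightarrow> (\<forall>g\<in>words X L.
     \<exists>q. 1 \<le> q \<and> q \<le> Q \<and> (\<forall>h\<in>words X R. g ^ q * (h * g ^ q * minv h) = (h * g ^ q * minv h) * g ^ q))"
    using commuting_conjugates[of n] by blast
  \<comment> \<open>Different words may need different exponents up to \<open>Q\<close>;
    \<open>fact Q\<close> is a multiple of all of them. \<open>L\<close> arises here from
    \<open>Q\<close> alone, before torsion is required for commuting conjugates.\<close>
  obtain L J l2 where cent: "\<And>X. sym_gens n X \<Longrightarrow> card X \<le> r \<Longrightarrow> torsion (words X l2) \<Longrightarrow>
    (\<And>w s. w \<in> words X L \<Longrightarrow> s \<in> X \<Longrightarrow> w ^ fact Q * s = s * w ^ fact Q) \<Longrightarrow>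
    \<exists>j\<le>J. \<forall>g\<in>words X (Suc j). \<exists>t\<in>words X j. \<exists>h\<in>schreier X j X. g = t * h"
    using central_powers_index[of "fact Q" n r] by (metis fact_gt_zero)
  define J1 where "J1 = n ^ n"
  \<comment> \<open>The length of \<open>minv u * v\<close> for conjugating words \<open>u\<close>
    and \<open>v\<close> of length \<open>Suc J1\<close>.\<close>
  define R where "R = Suc J1 + Suc J1"
  obtain l1 where l1: "\<And>X g. sym_gens n X \<Longrightarrow> torsion (words X l1) \<Longrightarrow> g \<in> words X L \<Longrightarrow>
     \<exists>q. 1 \<le> q \<and> q \<le> Q \<and> (\<forall>h\<in>words X R. g ^ q * (h * g ^ q * minv h) = (h * g ^ q * minv h) * g ^ q)"
    using conjs[of L R] by blast
  obtain l3 where l3: "\<And>X F. sym_gens n X \<Longrightarrow> card X \<le> r ^ (2 * J1 + 1) \<Longrightarrow> orth_fam n F \<Longrightarrow> n + 1 - t \<le> card F \<Longrightarrow>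
    (\<forall>x\<in>X. \<forall>E\<in>F. E * x = x * E) \<Longrightarrow> torsion (words X l3) \<Longrightarrow> finite (\<Union>k. words X k)"
    using Suc.IH[of "r ^ (2 * J1 + 1)"] by blast
  \<comment> \<open>The factor \<open>2 * J1 + 1\<close> converts length in Schreier generators into
    length in \<open>X\<close>.\<close>
  define l where "l = l1 + l2 + (2 * J1 + 1) * l3 + Q * L + (2 * J + 1)"
  have "finite (\<Union>k. words X k)"
    if X: "sym_gens n X" and cX: "card X \<le> r" and F: "orth_fam n F" "n + 1 - Suc t \<le> card F"
      and XF: "\<forall>x\<in>X. \<forall>E\<in>F. E * x = x * E" and tor: "torsion (words X l)" for X F
  proof -
    note X' = sym_gensD[OF X]
    note inv = sym_gens_inverse[OF X]
    have tors: "torsion (words X i)" if "i \<le> l" for i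
      by (rule torsion_mono[OF tor words_mono[OF X'(2) that]])
    have wF: "E * w = w * E" if "E \<in> F" "w \<in> words X i" for E w i
      by (rule words_commute[OF _ that(2)]) (use XF that(1) in blast)
    show ?thesis
    \<comment> \<open>Either some word has no central power among the first \<open>Q\<close>, and
      the centralizer of a suitable power carries a finer family, or all words of length
      \<open>L\<close> have a common central power.\<close>
    proof (cases "\<exists>g\<in>words X L. \<forall>q. 1 \<le> q \<and> q \<le> Q \<longrightarrow> (\<exists>s\<in>X. g ^ q * s \<noteq> s * g ^ q)")
      case True
      then obtain g where g: "g \<in> words X L" "\<And>q. 1 \<le> q \<Longrightarrow> q \<le> Q \<Longrightarrow> \<exists>s\<in>X. g ^ q * s \<noteq> s * g ^ q"
        by blast
      obtain q where q: "1 \<le> q" "q \<le> Q" and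
        comm: "\<And>h. h \<in> words X R \<Longrightarrow> g ^ q * (h * g ^ q * minv h) = (h * g ^ q * minv h) * g ^ q"
        using l1[OF X _ g(1)] tors[of l1] by (auto simp: l_def)
      define a where "a = g ^ q"
      obtain s where s: "s \<in> X" "s * a \<noteq> a * s" using g(2)[OF q] by (metis a_def)
      have "q * L \<le> l" using mult_le_mono1[OF q(2), of L] unfolding l_def by linarith
      have aw: "a \<in> words X (q * L)" unfolding a_def by (rule words_power[OF g(1)])
      obtain M where M: "M > 0" "a ^ M = 1"
        using tors[OF \<open>q * L \<le> l\<close>] aw unfolding torsion_def by blast
      have aa: "supp_le n a" "scal a = 1" using sym_gens_words[OF X aw] by auto
      \<comment> \<open>Conjugating back by \<open>u\<close> reduces this to \<open>a\<close> and
        its conjugate by \<open>minv u * v\<close>.\<close>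
      have pair: "(u * a * minv u) * (v * a * minv v) = (v * a * minv v) * (u * a * minv u)"
        if u: "u \<in> words X (Suc (n ^ n))" and v: "v \<in> words X (Suc (n ^ n))" for u v
      proof -
        note iu = inv[OF u] and iv = inv[OF v]
        define k where "k = minv u * v"
        have kR: "k \<in> words X R" unfolding k_def R_def J1_def by (intro words_mult iu v)
        note ik = inv[OF kR]
        have vk: "v = u * k" using iu by (simp add: k_def mult.assoc[symmetric])
        have "minv v = minv k * minv u"
        proof (rule minv_eqI)
          have "v * (minv k * minv u) = u * (k * minv k) * minv u" by (simp add: vk mult.assoc)
          then show "v * (minv k * minv u) = 1" using ik iu by simp
          have "minv k * minv u * v = minv k * (minv u * u) * k" by (simp add: vk mult.assoc)
          then show "minv k * minv u * v = 1" using ik iu by simp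
        qed
        then have vb: "v * a * minv v = u * (k * a * minv k) * minv u" by (simp add: vk mult.assoc)
        have uc: "(u * c * minv u) * (u * e * minv u) = u * (c * e) * minv u" for c e
        proof -
          have "(u * c * minv u) * (u * e * minv u) = u * c * (minv u * u) * e * minv u" by (simp only: mult.assoc)
          then show ?thesis using iu by (simp add: mult.assoc)
        qed
        show ?thesis unfolding vb uc using comm[OF kR] by (simp add: a_def)
      qed
      obtain j where j: "j \<le> n ^ n" and
        cos: "\<And>g. g \<in> words X (Suc j) \<Longrightarrow> \<exists>t\<in>words X j. \<exists>h\<in>schreier X j {a}. g = t * h"
        using centralizer_index[OF X n aa M(2,1) pair] by blast
      let ?X = "schreier X j {a}"
      have sub: "?X \<subseteq> words X (2 * j + 1)" by (auto simp: schreier_def)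
      have sX: "supp_le n s" "scal s = 1" using sym_gens_words[OF X words_letter[OF s(1)]] by auto
      \<comment> \<open>\<open>s\<close> commutes with \<open>F\<close> but not with
        \<open>a\<close>, so the family splits. The Schreier generators commute with
        \<open>a\<close> and with \<open>F\<close>, hence with the finer family.\<close>
      obtain F' where F': "orth_fam n F'" "card F < card F'"
        "\<And>y E'. y * a = a * y \<Longrightarrow> (\<And>E. E \<in> F \<Longrightarrow> y * E = E * y) \<Longrightarrow> E' \<in> F' \<Longrightarrow> y * E' = E' * y"
        using orth_fam_split[OF F(1) aa M(2,1) wF[OF _ aw] sX s(2)] wF[OF _ words_letter[OF s(1)]] by metis
      have "finite (\<Union>k. words ?X k)"
      proof (rule l3)
        show "sym_gens n ?X" by (rule sym_gens_schreier[OF X])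
        have "card ?X \<le> card (words X (2 * j + 1))"
          by (intro card_mono sub finite_words X')
        also have "\<dots> \<le> card X ^ (2 * j + 1)" by (rule card_words_le[OF X'(1)])
        also have "\<dots> \<le> r ^ (2 * j + 1)" by (intro power_mono cX) simp
        also have "\<dots> \<le> r ^ (2 * J1 + 1)"
        proof (rule power_increasing)
          have "card X > 0" using X' by (auto simp: card_gt_0_iff)
          then show "1 \<le> r" using cX by simp
        qed (use j in \<open>simp add: J1_def\<close>)
        finally show "card ?X \<le> r ^ (2 * J1 + 1)" .
        show "orth_fam n F'" by fact
        show "n + 1 - t \<le> card F'" using F(2) F'(2) by simp
        show "\<forall>x\<in>?X. \<forall>E\<in>F'. E * x = x * E"
        proof (intro ballI)
          fix x E assume x: "x \<in> ?X" and E: "E \<in> F'"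
          have "x * E = E * x"
            by (rule F'(3)[OF _ _ E]) (use x wF[of _ x "2 * j + 1"] in \<open>auto simp: schreier_def simp del: words.simps\<close>)
          then show "E * x = x * E" by simp
        qed
        have "(2 * j + 1) * l3 \<le> (2 * J1 + 1) * l3" using j by (intro mult_le_mono1) (simp add: J1_def)
        then have "(2 * j + 1) * l3 \<le> l" unfolding l_def by linarith
        then show "torsion (words ?X l3)" by (rule torsion_mono[OF tors words_words[OF sub]])
      qed
      then show ?thesis using cos by (intro finite_words_schreier[OF X', of j "{a}"])
    next
      case False
      have central: "w ^ fact Q * s = s * w ^ fact Q" if "w \<in> words X L" "s \<in> X" for w s
      proof -
        obtain q where q: "1 \<le> q" "q \<le> Q" "w ^ q * s = s * w ^ q" using False \<open>w \<in> _\<close> \<open>s \<in> X\<close> by blast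
        then obtain k where "fact Q = q * k" using dvd_fact[of q Q] by (auto elim: dvdE)
        then show ?thesis
          using commute_power[of s "w ^ q" k] q(3) by (simp add: power_mult)
      qed
      obtain j where j: "j \<le> J" and
        cos: "\<And>g. g \<in> words X (Suc j) \<Longrightarrow> \<exists>t\<in>words X j. \<exists>h\<in>schreier X j X. g = t * h"
        using cent[OF X cX tors[of l2] central] by (auto simp: l_def)
      have sub: "schreier X j X \<subseteq> words X (2 * j + 1)" by (auto simp: schreier_def)
      have "torsion (schreier X j X)" "finite (schreier X j X)"
        using j sym_gensD(1)[OF sym_gens_schreier[OF X]]
        by (auto intro!: torsion_mono[OF tors[of "2 * j + 1"] sub] simp: l_def)
      then obtain M where M: "M > 0" "\<And>g. g \<in> schreier X j X \<Longrightarrow> g ^ M = 1"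
        using torsion_common_exponent by blast
      have "finite (\<Union>k. words (schreier X j X) k)"
      proof (rule finite_words_commuting[OF _ M])
        show "finite (schreier X j X)" by fact
        show "x * y = y * x" if "x \<in> schreier X j X" "y \<in> schreier X j X" for x y
          by (rule words_commute[of X]) (use that in \<open>auto simp: schreier_def simp del: words.simps\<close>)
      qed
      then show ?thesis using cos by (intro finite_words_schreier[OF X', of j X])
    qed
  qed
  then show ?case by blast
qed

section \<open>Transfer to the general linear group\<close>

abbreviation gl_word :: "nat \<Rightarrow> complex mat list \<Rightarrow> complex mat" where
  "gl_word n w \<equiv> foldr (\<lambda>x y. x \<otimes>\<^bsub>GL n\<^esub> y) w \<one>\<^bsub>GL n\<^esub>"

lemma of_mat_foldr:
  assumes "set w \<subseteq> carrier (GL n)"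
  shows "gl_word n w \<in> carrier (GL n)"
    "of_mat n 1 (gl_word n w) = foldr times (map (of_mat n 1) w) 1"
proof -
  interpret group "GL n" by (rule group_GL)
  have c: "A \<in> carrier_mat n n" if "A \<in> carrier (GL n)" for A using that by (simp add: carrier_GL)
  have "gl_word n w \<in> carrier (GL n) \<and>
    of_mat n 1 (gl_word n w) = foldr times (map (of_mat n 1) w) 1"
    using assms
  proof (induction w)
    case Nil
    show ?case using one_closed by (simp add: one_GL of_mat_1)
  next
    case (Cons A w)
    then show ?case
      using of_mat_mult[OF c c, of A _ 1 1] m_closed by (simp add: mult_GL)
  qed
  then show "gl_word n w \<in> carrier (GL n)"
    "of_mat n 1 (gl_word n w) = foldr times (map (of_mat n 1) w) 1" by auto
qed

lemma of_mat_inject: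
  assumes "A \<in> carrier_mat n n" "B \<in> carrier_mat n n" "of_mat n c A = of_mat n c B"
  shows "A = B"
  using assms by (metis to_mat_of_mat)

lemma of_mat_pow:
  assumes "A \<in> carrier (GL n)"
  shows "of_mat n 1 (A [^]\<^bsub>GL n\<^esub> (k::nat)) = of_mat n 1 A ^ k"
proof -
  interpret group "GL n" by (rule group_GL)
  have c: "A \<in> carrier_mat n n" if "A \<in> carrier (GL n)" for A using that by (simp add: carrier_GL)
  show ?thesis
  proof (induction k)
    case (Suc k)
    have "of_mat n 1 (A [^]\<^bsub>GL n\<^esub> Suc k) = of_mat n (1 * 1) (A [^]\<^bsub>GL n\<^esub> k * A)" by (simp add: mult_GL)
    also have "\<dots> = of_mat n 1 (A [^]\<^bsub>GL n\<^esub> k) * of_mat n 1 A"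
      using assms by (intro of_mat_mult c) auto
    finally show ?case by (simp add: Suc power_commutes)
  qed (simp add: one_GL of_mat_1)
qed

lemma word_in_words:
  assumes "1 \<in> X" "set w \<subseteq> X"
  shows "foldr times w 1 \<in> words X (length w)"
  using assms by (induction w) auto

lemma words_foldr:
  "g \<in> words X k \<Longrightarrow> \<exists>w. set w \<subseteq> X \<and> length w = k \<and> g = foldr times w 1"
proof (induction k arbitrary: g)
  case (Suc k)
  then obtain s h where g: "g = s * h" "s \<in> X" "h \<in> words X k" by auto
  then obtain w where "set w \<subseteq> X" "length w = k" "h = foldr times w 1" using Suc.IH by blast
  then show ?case using g by (intro exI[of _ "s # w"]) auto
qed simp

theorem theorem1p1:
  fixes r n :: nat
  assumes "r \<ge> 1" and "n \<ge> 1"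
  shows "\<exists>l::nat. \<forall>S. S \<subseteq> carrier (GL n) \<and> finite S \<and> card S = r \<and> infinite (generate (GL n) S) \<longrightarrow>
           (\<exists>g \<in> generate (GL n) S. infinite_order (GL n) g \<and> word_length (GL n) S g \<le> l)"
proof -
  interpret group "GL n" by (rule group_GL)
  have n: "n > 0" using assms by simp
  \<comment> \<open>\<open>2 * r + 1\<close> counts the generators, their inverses and 1. The
    induction is entered at \<open>t = n\<close> with the single idempotent
    \<open>idn n\<close>.\<close>
  obtain l where l: "\<And>X F. sym_gens n X \<Longrightarrow> card X \<le> 2 * r + 1 \<Longrightarrow> orth_fam n F \<Longrightarrow> n + 1 - n \<le> card F \<Longrightarrow>
    (\<forall>x\<in>X. \<forall>E\<in>F. E * x = x * E) \<Longrightarrow> torsion (words X l) \<Longrightarrow> finite (\<Union>k. words X k)"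
    using finite_if_short_torsion[OF n, of "2 * r + 1" n] by blast
  have "\<exists>g \<in> generate (GL n) S. infinite_order (GL n) g \<and> word_length (GL n) S g \<le> l"
    if S: "S \<subseteq> carrier (GL n)" "finite S" "card S = r" and inf: "infinite (generate (GL n) S)" for S
  proof (rule ccontr)
    assume neg: "\<not> ?thesis"
    let ?f = "of_mat n 1"
    define Y where "Y = S \<union> (\<lambda>s. inv\<^bsub>GL n\<^esub> s) ` S"
    have Y: "Y \<subseteq> carrier (GL n)" using S(1) by (auto simp: Y_def)
    have gen: "g \<in> generate (GL n) S \<longleftrightarrow> (\<exists>w. set w \<subseteq> Y \<and> g = gl_word n w)" for g
      unfolding Y_def by (rule generate_iff_word[OF S(1)])
    define X where "X = insert 1 (?f ` Y)"
    have c: "A \<in> carrier_mat n n" if "A \<in> carrier (GL n)" for A using that by (simp add: carrier_GL)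
    have inv1: "?f A * ?f (inv\<^bsub>GL n\<^esub> A) = 1" "?f (inv\<^bsub>GL n\<^esub> A) * ?f A = 1" if A: "A \<in> carrier (GL n)" for A
    proof -
      have i: "inv\<^bsub>GL n\<^esub> A \<in> carrier (GL n)" using A by simp
      show "?f A * ?f (inv\<^bsub>GL n\<^esub> A) = 1"
        using of_mat_mult[OF c[OF A] c[OF i], of 1 1] r_inv[OF A] by (simp add: mult_GL one_GL of_mat_1)
      show "?f (inv\<^bsub>GL n\<^esub> A) * ?f A = 1"
        using of_mat_mult[OF c[OF i] c[OF A], of 1 1] l_inv[OF A] by (simp add: mult_GL one_GL of_mat_1)
    qed
    have "\<exists>B\<in>Y. ?f A * ?f B = 1 \<and> ?f B * ?f A = 1" if A: "A \<in> Y" for A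
    proof (cases "A \<in> S")
      case True
      then show ?thesis using inv1[of A] S(1) by (intro bexI[of _ "inv\<^bsub>GL n\<^esub> A"]) (auto simp: Y_def)
    next
      case False
      then obtain B where "B \<in> S" "A = inv\<^bsub>GL n\<^esub> B" using A by (auto simp: Y_def)
      then show ?thesis using inv1[of B] S(1) by (intro bexI[of _ B]) (auto simp: Y_def)
    qed
    then have X: "sym_gens n X"
      using S(2) unfolding sym_gens_def X_def by (auto simp: Y_def smat_simps)
    have "card X \<le> Suc (card (?f ` Y))" unfolding X_def by (rule card_insert_le_m1) auto
    also have "card (?f ` Y) \<le> card Y" using S(2) by (intro card_image_le) (simp add: Y_def)
    also have "card Y \<le> card S + card ((\<lambda>s. inv\<^bsub>GL n\<^esub> s) ` S)" unfolding Y_def by (rule card_Un_le)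
    also have "card ((\<lambda>s. inv\<^bsub>GL n\<^esub> s) ` S) \<le> card S" by (rule card_image_le[OF S(2)])
    finally have cX: "card X \<le> 2 * r + 1" using S(3) by simp
    have "torsion (words X l)"
      unfolding torsion_def
    proof
      fix u assume "u \<in> words X l"
      then obtain w where w: "set w \<subseteq> X" "length w = l" "u = foldr times w 1" using words_foldr by blast
      \<comment> \<open>Letters equal to 1 are dropped, so elements of \<open>words X l\<close> come
        from words over \<open>Y\<close> of length at most \<open>l\<close>.\<close>
      have "\<exists>v. set v \<subseteq> Y \<and> length v \<le> length w \<and> foldr times w 1 = foldr times (map ?f v) 1"
        using w(1)
      proof (induction w)
        case (Cons a w)
        then obtain v where v: "set v \<subseteq> Y" "length v \<le> length w" "foldr times w 1 = foldr times (map ?f v) 1" by auto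
        show ?case
        proof (cases "a = 1")
          case True
          then show ?thesis using v by (intro exI[of _ v]) auto
        next
          case False
          then obtain A where "A \<in> Y" "a = ?f A" using Cons.prems by (auto simp: X_def)
          then show ?thesis using v by (intro exI[of _ "A # v"]) auto
        qed
      qed simp
      then obtain v where v: "set v \<subseteq> Y" "length v \<le> l" "u = foldr times (map ?f v) 1" using w by auto
      let ?g = "gl_word n v"
      have gc: "?g \<in> carrier (GL n)" "?f ?g = u" using of_mat_foldr[of v n] v Y by auto
      have "word_length (GL n) S ?g \<le> length v"
        unfolding word_length_def by (rule Least_le) (use v(1) in \<open>auto simp: Y_def\<close>)
      then have "word_length (GL n) S ?g \<le> l" using v(2) by linarith
      moreover have "?g \<in> generate (GL n) S" using gen v(1) by blast
      ultimately have "\<not> infinite_order (GL n) ?g" using neg by blast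
      then obtain k :: nat where "k > 0" "?g [^]\<^bsub>GL n\<^esub> k = \<one>\<^bsub>GL n\<^esub>"
        using infinite_order_iff[OF gc(1)] by blast
      then have "u ^ k = 1" using of_mat_pow[OF gc(1), of k] gc(2) by (simp add: one_GL of_mat_1)
      then show "\<exists>M>0. u ^ M = 1" using \<open>k > 0\<close> by blast
    qed
    moreover have "\<forall>x\<in>X. \<forall>E\<in>{idn n}. E * x = x * E"
    proof (intro ballI)
      fix x E assume "x \<in> X" "E \<in> {idn n}"
      then show "E * x = x * E"
        using mult_compl_idn[of n x] X by (simp add: sym_gens_def algebra_simps)
    qed
    ultimately have fin: "finite (\<Union>k. words X k)"
      by (intro l[OF X cX orth_fam_single[OF n]]) auto
    have "?f ` generate (GL n) S \<subseteq> (\<Union>k. words X k)"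
    proof
      fix u assume "u \<in> ?f ` generate (GL n) S"
      then obtain g where "g \<in> generate (GL n) S" "u = ?f g" by blast
      moreover from this(1) obtain w where "set w \<subseteq> Y" "g = gl_word n w"
        using gen by blast
      ultimately have w: "set w \<subseteq> Y" "u = ?f (gl_word n w)" by auto
      then have "u = foldr times (map ?f w) 1" using of_mat_foldr(2)[of w n] Y by auto
      also have "\<dots> \<in> words X (length (map ?f w))"
        by (rule word_in_words) (use w(1) in \<open>auto simp: X_def\<close>)
      finally show "u \<in> (\<Union>k. words X k)" by blast
    qed
    then have "finite (?f ` generate (GL n) S)" using fin finite_subset by blast
    moreover have "inj_on ?f (generate (GL n) S)"
      using generate_incl[OF S(1)] c of_mat_inject by (intro inj_onI) blast
    ultimately show False using inf finite_imageD by blast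
  qed
  then show ?thesis by blast
qed

end
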